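(* Let $\Theta_1,\Theta_2$ be minimal L-systems (input-output space $\mathbb C$, $J=1$) such that $\Theta_1$ satisfies Hypothesis I and $\Theta_2$ satisfies Hypothesis II, and let $\Theta=\Theta_1\cdot\Theta_2$ be their (general) coupling. Suppose that $V_{\Theta_1}\in\mathfrak M_{\kappa_1}$ and $V_{\Theta_2}\in\mathfrak M_{\kappa_2}^{-1}$, $0\le\kappa_1,\kappa_2<1$. Then $\Theta$ satisfies Hypothesis II and $V_\Theta\in\mathfrak M_{\kappa_1\kappa_2}^{-1}$.
   Context: L-systems. Let $\dot A$ be a closed, densely defined symmetric operator with deficiency indices $(1,1)$ in a Hilbert space $\mathcal H$. Let $\mathcal H_+=\mathrm{Dom}(\dot A^* )$ with inner product $(f,g)_+=(f,g)+(\dot A^*f,\dot A^*g)$, and let $\mathcal H_+\subset\mathcal H\subset\mathcal H_-$ be the associated rigged Hilbert space ($\mathcal H_-$ is the dual of $\mathcal H_+$ with respect to the pairing extending the inner product of $\mathcal H$). For a bounded $\mathbb A:\mathcal H_+\to\mathcal H_-$ the adjoint $\mathbb A^*$ is again bounded $\mathcal H_+\to\mathcal H_-$; $\mathrm{Re}\,\mathbb A=(\mathbb A+\mathbb A^* )/2$, $\mathrm{Im}\,\mathbb A=(\mathbb A-\mathbb A^* )/(2i)$. An operator $T$ with $\dot A\subset T\subset\dot A^*$ belongs to $\Lambda(\dot A)$ if $\rho(T)\neq\emptyset$ and $\mathrm{Dom}(\dot A)=\mathrm{Dom}(T)\cap\mathrm{Dom}(T^* )$. A bounded $\mathbb A:\mathcal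 H_+\to\mathcal H_-$ is a $( * )$-extension of $T$ if $\mathbb A\supset T\supset\dot A$, $\mathbb A^*\supset T^*\supset\dot A$, and the quasi-kernel $\hat A$ of $\mathrm{Re}\,\mathbb A$ (the restriction of $\mathrm{Re}\,\mathbb A$ to $\{f\in\mathcal H_+:\mathrm{Re}\,\mathbb A f\in\mathcal H\}$) is self-adjoint in $\mathcal H$. An L-system is an array $\Theta=\begin{pmatrix}\mathbb A&K&1\\ \mathcal H_+\subset\mathcal H\subset\mathcal H_-&&\mathbb C\end{pmatrix}$, where $\mathbb A$ is a $( * )$-extension of some $T\in\Lambda(\dot A)$ (the main operator), $K:\mathbb C\to\mathcal H_-$ is bounded with adjoint $K^*:\mathcal H_+\to\mathbb C$, $\mathrm{Im}\,\mathbb A=KK^*$, $\mathrm{Ran}(K)=\mathrm{Ran}(\mathrm{Im}\,\mathbb A)$. It is minimal if $\dot A$ is prime (no nontrivial reducing subspace on which $\dot A$ induces a self-adjoint operator). Transfer function: $W_\Theta(z)=1-2iK^*(\mathbb A-zI)^{-1}K$, $z\in\rho(T)$; impedance function: $V_\Theta(z)=K^*(\mathrm{Re}\,\mathbb A-zI)^{-1}K$, $z\in\rho(\hat A)$ (both well defined). Von Neumann parameter and Hypotheses I, II. The main operator $T$ is a maximal dissipative extension of $\dot A$, and there are $g_\pm\in\ker(\dot A^*\mp iI)$, $\|g_\pm\|=1$, with $g_+-\kappa g_-\in\mathrm{Dom}(T)$, $0\le\kappa<1$; $\kappa$ is the von Neumann parameter of $T$. The L-system satisfies Hypothesis I if such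 $g_\pm$ can be chosen with $g_+-g_-\in\mathrm{Dom}(\hat A)$, and Hypothesis II if they can be chosen with $g_++g_-\in\mathrm{Dom}(\hat A)$. Classes ($0\le\kappa<1$): $\mathfrak M_\kappa$ (resp. $\mathfrak M_\kappa^{-1}$) is the set of all analytic $M:\mathbb C_+\to\mathbb C_+$ of the form $M(z)=\int_{\mathbb R}\left(\frac1{\lambda-z}-\frac{\lambda}{1+\lambda^2}\right)d\mu(\lambda)$ with $\mu$ an infinite Borel measure with $\int_{\mathbb R}\frac{d\mu(\lambda)}{1+\lambda^2}=\frac{1-\kappa}{1+\kappa}$ (resp. $=\frac{1+\kappa}{1-\kappa}$). Coupling under Hypothesis I. For $k=1,2$ let $\Theta_k$ act in $\mathcal H_k$, with symmetric operator $\dot A_k$, main operator $T_k$, and $g^k_\pm,\kappa_k$ as in Hypothesis I. Define $\alpha\in(0,\pi/2]$ by $\tan\alpha=\frac1{\kappa_2}\sqrt{\frac{1-\kappa_2^2}{1-\kappa_1^2}}$ if $\kappa_2\ne0$ and $\alpha=\pi/2$ if $\kappa_2=0$; define $\beta$ by $\sin\beta=\kappa_1\sin\alpha$, $\cos\beta=\frac1{\kappa_2}\cos\alpha$ if $\kappa_2\neq0$, and $\sin\beta=\kappa_1$, $\cos\beta=\sqrt{1-\kappa_1^2}$ if $\kappa_2=0$. Let $\dot A$ be the restriction of $(\dot A_1\oplus\dot A_2)^*$ to $\mathrm{Dom}(\dot A_1\oplus\dot A_2)\dot+\mathcal L_0$, where $\mathcal L_0$ is spanned by $\sin\alpha\,(g_+^1-\kappa_1g_-^1)\oplus\cos\alpha\,(g_+^2-\frac1{\kappa_2}g_-^2)$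 if $\kappa_2\ne0$, and by $(g_+^1-\kappa_1g_-^1)\oplus(-\sqrt{1-\kappa_1^2}\,g_-^2)$ if $\kappa_2=0$. Then $\dot A$ is symmetric with deficiency indices $(1,1)$ in $\mathcal H_1\oplus\mathcal H_2$, with normalized deficiency vectors $G_+=\cos\alpha\,g_+^1-\sin\alpha\,g_+^2\in\ker(\dot A^*-iI)$ and $G_-=\cos\beta\,g_-^1-\sin\beta\,g_-^2\in\ker(\dot A^*+iI)$. The operator coupling $T=T_1\uplus T_2$ is the restriction of $(\dot A_1\oplus\dot A_2)^*$ to $\mathrm{Dom}(\dot A)\dot+\mathrm{span}\{G_+-\kappa_1\kappa_2G_-\}$, a maximal dissipative extension of $\dot A$. The coupling $\Theta_1\cdot\Theta_2$ is the L-system with symmetric operator $\dot A$, main operator $T$, rigging $\mathcal H_+=\mathrm{Dom}(\dot A^* )\subset\mathcal H_1\oplus\mathcal H_2\subset\mathcal H_-$, state-space operator $\mathbb A$ the (unique) $( * )$-extension of $T$ such that the quasi-kernel of $\mathrm{Re}\,\mathbb A$ is the self-adjoint extension $\hat A$ of $\dot A$ with $G_+-G_-\in\mathrm{Dom}(\hat A)$, and $Kc=c\chi$ with $\mathrm{Im}\,\mathbb A=(\cdot,\chi)\chi$ ($\chi$ is determined up to a unimodular factor). General coupling. For arbitrary minimal L-systems $\Theta_1,\Theta_2$ with main operators $T_k$ of von Neumann parameters $\kappa_k$, let $\Theta_k'$ be the L-system with the same $\dot A_k,T_k$ whose quasi-kernel satisfies Hypothesis I (with the same $\kappa_k$; if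 $\Theta_k$ satisfies Hypothesis I one takes $\Theta_k'=\Theta_k$ and $\nu_k=1$; if $\Theta_k$ is given as satisfying Hypothesis II with deficiency vectors $g_\pm^k$, the same $g_\pm^k$ are used and $\nu_k=-1$). Then $W_{\Theta_k'}=\nu_kW_{\Theta_k}$ with $|\nu_k|=1$. Let $\Theta'=\Theta_1'\cdot\Theta_2'$. The coupling $\Theta=\Theta_1\cdot\Theta_2$ is the L-system that has the same symmetric operator and main operator as $\Theta'$ (so it differs from $\Theta'$ only by the choice of the quasi-kernel, with the corresponding $\mathbb A$, $K$) and transfer function $W_\Theta=(\nu_1\nu_2)^{-1}W_{\Theta'}$. *)

theory Defs
  imports "HOL-Analysis.Analysis"
begin

section \<open>Complex Hilbert spaces\<close>

text \<open>The inner product is linear in its first argument and conjugate linear in the second one.\<close>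

class complex_inner = real_inner +
  fixes scaleC :: "complex \<Rightarrow> 'a \<Rightarrow> 'a" (infixr "*\<^sub>C" 75)
    and cinner :: "'a \<Rightarrow> 'a \<Rightarrow> complex"
  assumes scaleC_add_right: "c *\<^sub>C (x + y) = c *\<^sub>C x + c *\<^sub>C y"
    and scaleC_add_left: "(c + d) *\<^sub>C x = c *\<^sub>C x + d *\<^sub>C x"
    and scaleC_scaleC: "c *\<^sub>C (d *\<^sub>C x) = (c * d) *\<^sub>C x"
    and scaleR_scaleC: "r *\<^sub>R x = complex_of_real r *\<^sub>C x"
    and cinner_commute: "cinner x y = cnj (cinner y x)"
    and cinner_add_left: "cinner (x + y) u = cinner x u + cinner y u"
    and cinner_scaleC_left: "cinner (c *\<^sub>C x) y = c * cinner x y"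
    and inner_eq_Re_cinner: "inner x y = Re (cinner x y)"

class complex_hilbert = complex_inner + complete_space

lemma scaleC_one: "1 *\<^sub>C x = (x::'a::complex_inner)"
  using scaleR_scaleC[of 1 x] by simp

global_interpretation complex_vector:
  vector_space "scaleC :: complex \<Rightarrow> 'a \<Rightarrow> 'a::complex_inner"
  defines csubspace = complex_vector.subspace
    and cdim = complex_vector.dim
  by unfold_locales (simp_all add: scaleC_add_right scaleC_add_left scaleC_scaleC scaleC_one)

text \<open>The orthogonal sum of two Hilbert spaces.\<close>

instantiation prod :: (complex_inner, complex_inner) complex_inner
begin

definition scaleC_prod_def: "c *\<^sub>C p = (c *\<^sub>C fst p, c *\<^sub>C snd p)"

definition cinner_prod_def: "cinner p q = cinner (fst p) (fst q) + cinner (snd p) (snd q)"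

instance
proof
  fix p q :: "'a \<times> 'b"
  show "cinner p q = cnj (cinner q p)"
    unfolding cinner_prod_def complex_cnj_add by (metis cinner_commute)
qed (auto simp: scaleC_prod_def cinner_prod_def scaleC_add_right scaleC_add_left scaleC_scaleC
      scaleR_scaleC scaleR_prod_def cinner_add_left cinner_scaleC_left inner_prod_def
      inner_eq_Re_cinner algebra_simps)

end

instance prod :: (complex_hilbert, complex_hilbert) complex_hilbert ..

instantiation complex :: complex_hilbert
begin

definition scaleC_complex_def: "c *\<^sub>C x = c * (x::complex)"

definition cinner_complex_def: "cinner x y = x * cnj (y::complex)"

instance
  by standard (auto simp: scaleC_complex_def cinner_complex_def algebra_simps scaleR_conv_of_real
      inner_complex_def)

end


section \<open>Unbounded operators\<close>

text \<open>An operator is identified with its graph, so the domain of \<open>A\<close> is \<open>Domain A\<close>, the inclusion of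
  graphs is the extension relation, and closedness of the operator is closedness of the graph.\<close>

type_synonym 'a graph = "('a \<times> 'a) set"

definition linear_operator :: "'a::complex_inner graph \<Rightarrow> bool" where
  "linear_operator A \<longleftrightarrow> csubspace A \<and> single_valued A"

definition densely_defined :: "'a::complex_inner graph \<Rightarrow> bool" where
  "densely_defined A \<longleftrightarrow> closure (Domain A) = UNIV"

text \<open>The adjoint taken in the subspace \<open>M\<close>; the usual adjoint is the case \<open>M = UNIV\<close>.\<close>

definition adjoint_in :: "'a::complex_inner set \<Rightarrow> 'a graph \<Rightarrow> 'a graph" where
  "adjoint_in M A = {(g, h). g \<in> M \<and> h \<in> M \<and> (\<forall>(f, f') \<in> A. cinner f' g = cinner f h)}"

abbreviation adjoint :: "'a::complex_inner graph \<Rightarrow> 'a graph" where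
  "adjoint A \<equiv> adjoint_in UNIV A"

definition self_adjoint_in :: "'a::complex_inner set \<Rightarrow> 'a graph \<Rightarrow> bool" where
  "self_adjoint_in M A \<longleftrightarrow> A \<subseteq> M \<times> M \<and> linear_operator A \<and> M \<subseteq> closure (Domain A) \<and>
     adjoint_in M A = A"

abbreviation self_adjoint :: "'a::complex_inner graph \<Rightarrow> bool" where
  "self_adjoint A \<equiv> self_adjoint_in UNIV A"

definition symmetric_operator :: "'a::complex_inner graph \<Rightarrow> bool" where
  "symmetric_operator A \<longleftrightarrow> linear_operator A \<and> A \<subseteq> adjoint A"

definition eigenspace :: "'a::complex_inner graph \<Rightarrow> complex \<Rightarrow> 'a set" where
  "eigenspace A z = {g. (g, z *\<^sub>C g) \<in> A}"

definition deficiency_indices_1_1 :: "'a::complex_inner graph \<Rightarrow> bool" where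
  "deficiency_indices_1_1 A \<longleftrightarrow>
     cdim (eigenspace (adjoint A) \<i>) = 1 \<and> cdim (eigenspace (adjoint A) (- \<i>)) = 1"

definition resolvent_set :: "'a::complex_inner graph \<Rightarrow> complex set" where
  "resolvent_set A = {z. (\<forall>h. \<exists>!f. (f, h + z *\<^sub>C f) \<in> A) \<and>
     (\<exists>C. \<forall>(f, f') \<in> A. norm f \<le> C * norm (f' - z *\<^sub>C f))}"

definition dissipative :: "'a::complex_inner graph \<Rightarrow> bool" where
  "dissipative A \<longleftrightarrow> (\<forall>(f, f') \<in> A. 0 \<le> Im (cinner f' f))"

definition maximal_dissipative :: "'a::complex_inner graph \<Rightarrow> bool" where
  "maximal_dissipative A \<longleftrightarrow> linear_operator A \<and> dissipative A \<and>
     (\<forall>B. linear_operator B \<and> dissipative B \<and> A \<subseteq> B \<longrightarrow> B = A)"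

text \<open>The closed subspace \<open>M\<close> reduces \<open>A\<close> if the orthogonal projection \<open>P\<close> onto \<open>M\<close> satisfies
  \<open>(P f, P (A f)) \<in> A\<close> for all \<open>f\<close> in the domain of \<open>A\<close>; below \<open>m = P f\<close> and \<open>m' = P (A f)\<close>.\<close>

definition reducing_subspace :: "'a::complex_inner graph \<Rightarrow> 'a set \<Rightarrow> bool" where
  "reducing_subspace A M \<longleftrightarrow> csubspace M \<and> closed M \<and>
     (\<forall>(f, f') \<in> A. \<exists>(m, m') \<in> A. m \<in> M \<and> m' \<in> M \<and>
        (\<forall>u\<in>M. cinner (f - m) u = 0 \<and> cinner (f' - m') u = 0))"

definition prime_operator :: "'a::complex_inner graph \<Rightarrow> bool" where
  "prime_operator A \<longleftrightarrow>
     \<not> (\<exists>M. M \<noteq> {0} \<and> reducing_subspace A M \<and> self_adjoint_in M (A \<inter> M \<times> M))"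

definition Lambda_class :: "'a::complex_inner graph \<Rightarrow> 'a graph set" where
  "Lambda_class A = {T. linear_operator T \<and> A \<subseteq> T \<and> T \<subseteq> adjoint A \<and> resolvent_set T \<noteq> {} \<and>
     Domain A = Domain T \<inter> Domain (adjoint T)}"


section \<open>Rigged Hilbert spaces and \<open>(*)\<close>-extensions\<close>

definition plus_space :: "'a::complex_inner graph \<Rightarrow> 'a set" where
  "plus_space A = Domain (adjoint A)"

definition apply_op :: "'a graph \<Rightarrow> 'a \<Rightarrow> 'a" where
  "apply_op A f = (THE h. (f, h) \<in> A)"

definition plus_inner :: "'a::complex_inner graph \<Rightarrow> 'a \<Rightarrow> 'a \<Rightarrow> complex" where
  "plus_inner A f g = cinner f g + cinner (apply_op (adjoint A) f) (apply_op (adjoint A) g)"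

definition plus_norm :: "'a::complex_inner graph \<Rightarrow> 'a \<Rightarrow> real" where
  "plus_norm A f = sqrt (Re (plus_inner A f f))"

text \<open>An element \<open>\<phi>\<close> of the negative space is represented by the function \<open>g \<mapsto> (\<phi>, g)\<close> on the
  positive space. Since the pairing extends the inner product, this function is conjugate linear.
  It is extended by \<open>0\<close> off the positive space, so that equality in the negative space is equality
  of functions.\<close>

definition minus_space :: "'a::complex_inner graph \<Rightarrow> ('a \<Rightarrow> complex) set" where
  "minus_space A = {\<phi>. (\<forall>g. g \<notin> plus_space A \<longrightarrow> \<phi> g = 0) \<and>
     (\<forall>f\<in>plus_space A. \<forall>g\<in>plus_space A. \<phi> (f + g) = \<phi> f + \<phi> g) \<and>
     (\<forall>c. \<forall>g\<in>plus_space A. \<phi> (c *\<^sub>C g) = cnj c * \<phi> g) \<and>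
     (\<exists>C. \<forall>g\<in>plus_space A. cmod (\<phi> g) \<le> C * plus_norm A g)}"

definition embed :: "'a::complex_inner graph \<Rightarrow> 'a \<Rightarrow> ('a \<Rightarrow> complex)" where
  "embed A h = (\<lambda>g. if g \<in> plus_space A then cinner h g else 0)"

text \<open>A map \<open>B\<close> from the positive to the negative space is represented by \<open>B f g = (B f, g)\<close>, again
  extended by \<open>0\<close>.\<close>

type_synonym 'a rigged_op = "'a \<Rightarrow> 'a \<Rightarrow> complex"

definition bounded_rigged_op :: "'a::complex_inner graph \<Rightarrow> 'a rigged_op \<Rightarrow> bool" where
  "bounded_rigged_op A B \<longleftrightarrow>
     (\<forall>f\<in>plus_space A. B f \<in> minus_space A) \<and> (\<forall>f. f \<notin> plus_space A \<longrightarrow> B f = (\<lambda>_. 0)) \<and>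
     (\<forall>f\<in>plus_space A. \<forall>g\<in>plus_space A. B (f + g) = (\<lambda>u. B f u + B g u)) \<and>
     (\<forall>c. \<forall>f\<in>plus_space A. B (c *\<^sub>C f) = (\<lambda>u. c * B f u)) \<and>
     (\<exists>C. \<forall>f\<in>plus_space A. \<forall>g\<in>plus_space A. cmod (B f g) \<le> C * plus_norm A f * plus_norm A g)"

text \<open>From \<open>(B g, f) = (g, B\<^sup>* f)\<close>, where \<open>(g, \<phi>)\<close> is the conjugate of \<open>(\<phi>, g)\<close>.\<close>

definition rigged_adjoint :: "'a rigged_op \<Rightarrow> 'a rigged_op" where
  "rigged_adjoint B = (\<lambda>f g. cnj (B g f))"

definition rigged_Re :: "'a rigged_op \<Rightarrow> 'a rigged_op" where
  "rigged_Re B = (\<lambda>f g. (B f g + rigged_adjoint B f g) / 2)"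

definition rigged_Im :: "'a rigged_op \<Rightarrow> 'a rigged_op" where
  "rigged_Im B = (\<lambda>f g. (B f g - rigged_adjoint B f g) / (2 * \<i>))"

definition quasi_kernel :: "'a::complex_inner graph \<Rightarrow> 'a rigged_op \<Rightarrow> 'a graph" where
  "quasi_kernel A B = {(f, h). f \<in> plus_space A \<and> B f = embed A h}"

definition star_extension :: "'a::complex_inner graph \<Rightarrow> 'a graph \<Rightarrow> 'a rigged_op \<Rightarrow> bool" where
  "star_extension A T B \<longleftrightarrow> bounded_rigged_op A B \<and> A \<subseteq> T \<and> A \<subseteq> adjoint T \<and>
     (\<forall>(f, h) \<in> T. f \<in> plus_space A \<and> B f = embed A h) \<and>
     (\<forall>(f, h) \<in> adjoint T. f \<in> plus_space A \<and> rigged_adjoint B f = embed A h) \<and>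
     self_adjoint (quasi_kernel A (rigged_Re B))"

text \<open>The solution \<open>f\<close> of \<open>(B - z I) f = \<phi>\<close>.\<close>

definition rigged_resolvent ::
  "'a::complex_inner graph \<Rightarrow> 'a rigged_op \<Rightarrow> complex \<Rightarrow> ('a \<Rightarrow> complex) \<Rightarrow> 'a" where
  "rigged_resolvent A B z \<phi> =
     (THE f. f \<in> plus_space A \<and> (\<lambda>g. B f g - z * embed A f g) = \<phi>)"


section \<open>L-systems\<close>

record 'a L_system =
  symop :: "'a graph"
  mainop :: "'a graph"
  stateop :: "'a rigged_op"
  channel :: "complex \<Rightarrow> 'a \<Rightarrow> complex"

definition bounded_channel :: "'a::complex_inner graph \<Rightarrow> (complex \<Rightarrow> 'a \<Rightarrow> complex) \<Rightarrow> bool" where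
  "bounded_channel A K \<longleftrightarrow> (\<forall>c. K c \<in> minus_space A) \<and>
     (\<forall>c d. K (c + d) = (\<lambda>g. K c g + K d g)) \<and> (\<forall>c d. K (c * d) = (\<lambda>g. c * K d g)) \<and>
     (\<exists>C. \<forall>c. \<forall>g\<in>plus_space A. cmod (K c g) \<le> C * cmod c * plus_norm A g)"

definition channel_adjoint :: "(complex \<Rightarrow> 'a \<Rightarrow> complex) \<Rightarrow> 'a \<Rightarrow> complex" where
  "channel_adjoint K f = cnj (K 1 f)"

lemma channel_adjoint:
  assumes "bounded_channel A K"
  shows "K c f = cinner c (channel_adjoint K f)"
proof -
  have "K (c * 1) = (\<lambda>g. c * K 1 g)"
    using assms unfolding bounded_channel_def by blast
  then show ?thesis
    by (simp add: channel_adjoint_def cinner_complex_def)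
qed

definition is_L_system :: "'a::complex_hilbert L_system \<Rightarrow> bool" where
  "is_L_system \<Theta> \<longleftrightarrow>
     symmetric_operator (symop \<Theta>) \<and> closed (symop \<Theta>) \<and> densely_defined (symop \<Theta>) \<and>
     deficiency_indices_1_1 (symop \<Theta>) \<and>
     mainop \<Theta> \<in> Lambda_class (symop \<Theta>) \<and>
     star_extension (symop \<Theta>) (mainop \<Theta>) (stateop \<Theta>) \<and>
     bounded_channel (symop \<Theta>) (channel \<Theta>) \<and>
     (\<forall>f\<in>plus_space (symop \<Theta>).
        rigged_Im (stateop \<Theta>) f = channel \<Theta> (channel_adjoint (channel \<Theta>) f)) \<and>
     range (channel \<Theta>) = rigged_Im (stateop \<Theta>) ` plus_space (symop \<Theta>)"

definition minimal_L_system :: "'a::complex_hilbert L_system \<Rightarrow> bool" where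
  "minimal_L_system \<Theta> \<longleftrightarrow> prime_operator (symop \<Theta>)"

definition real_op :: "'a::complex_hilbert L_system \<Rightarrow> 'a graph" where
  "real_op \<Theta> = quasi_kernel (symop \<Theta>) (rigged_Re (stateop \<Theta>))"

text \<open>The transfer function is meaningful on the resolvent set of the main operator, the impedance
  function on that of \<^term>\<open>real_op \<Theta>\<close>. Operators on \<open>\<complex>\<close> are identified with
  their values at \<open>1\<close>.\<close>

definition transfer_function :: "'a::complex_hilbert L_system \<Rightarrow> complex \<Rightarrow> complex" where
  "transfer_function \<Theta> z = 1 - 2 * \<i> * channel_adjoint (channel \<Theta>)
     (rigged_resolvent (symop \<Theta>) (stateop \<Theta>) z (channel \<Theta> 1))"

definition impedance_function :: "'a::complex_hilbert L_system \<Rightarrow> complex \<Rightarrow> complex" where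
  "impedance_function \<Theta> z = channel_adjoint (channel \<Theta>)
     (rigged_resolvent (symop \<Theta>) (rigged_Re (stateop \<Theta>)) z (channel \<Theta> 1))"


section \<open>Von Neumann parameter, Hypotheses I and II\<close>

definition von_neumann_vectors ::
  "'a::complex_inner graph \<Rightarrow> 'a graph \<Rightarrow> real \<Rightarrow> 'a \<Rightarrow> 'a \<Rightarrow> bool" where
  "von_neumann_vectors A T \<kappa> gp gm \<longleftrightarrow> A \<subseteq> T \<and> maximal_dissipative T \<and> 0 \<le> \<kappa> \<and> \<kappa> < 1 \<and>
     gp \<in> eigenspace (adjoint A) \<i> \<and> gm \<in> eigenspace (adjoint A) (- \<i>) \<and>
     norm gp = 1 \<and> norm gm = 1 \<and> gp - \<kappa> *\<^sub>R gm \<in> Domain T"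

definition hypothesis_I_with :: "'a::complex_hilbert L_system \<Rightarrow> 'a \<Rightarrow> 'a \<Rightarrow> bool" where
  "hypothesis_I_with \<Theta> gp gm \<longleftrightarrow>
     (\<exists>\<kappa>. von_neumann_vectors (symop \<Theta>) (mainop \<Theta>) \<kappa> gp gm) \<and> gp - gm \<in> Domain (real_op \<Theta>)"

definition hypothesis_II_with :: "'a::complex_hilbert L_system \<Rightarrow> 'a \<Rightarrow> 'a \<Rightarrow> bool" where
  "hypothesis_II_with \<Theta> gp gm \<longleftrightarrow>
     (\<exists>\<kappa>. von_neumann_vectors (symop \<Theta>) (mainop \<Theta>) \<kappa> gp gm) \<and> gp + gm \<in> Domain (real_op \<Theta>)"

definition hypothesis_I :: "'a::complex_hilbert L_system \<Rightarrow> bool" where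
  "hypothesis_I \<Theta> \<longleftrightarrow> (\<exists>gp gm. hypothesis_I_with \<Theta> gp gm)"

definition hypothesis_II :: "'a::complex_hilbert L_system \<Rightarrow> bool" where
  "hypothesis_II \<Theta> \<longleftrightarrow> (\<exists>gp gm. hypothesis_II_with \<Theta> gp gm)"


section \<open>Classes of Herglotz-Nevanlinna functions\<close>

abbreviation upper_half_plane :: "complex set" where
  "upper_half_plane \<equiv> {z. 0 < Im z}"

text \<open>Only the values on the upper half-plane matter.\<close>

definition herglotz_class :: "real \<Rightarrow> (complex \<Rightarrow> complex) set" where
  "herglotz_class a = {M. M holomorphic_on upper_half_plane \<and>
     M ` upper_half_plane \<subseteq> upper_half_plane \<and>
     (\<exists>\<mu> :: real measure. sets \<mu> = sets borel \<and> emeasure \<mu> UNIV = \<infinity> \<and>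
        (\<integral>\<^sup>+x. ennreal (1 / (1 + x\<^sup>2)) \<partial>\<mu>) = ennreal a \<and>
        (\<forall>z\<in>upper_half_plane. M z =
           (LINT x|\<mu>. 1 / (complex_of_real x - z) - complex_of_real (x / (1 + x\<^sup>2)))))}"

definition class_M :: "real \<Rightarrow> (complex \<Rightarrow> complex) set" where
  "class_M \<kappa> = herglotz_class ((1 - \<kappa>) / (1 + \<kappa>))"

definition class_M_inv :: "real \<Rightarrow> (complex \<Rightarrow> complex) set" where
  "class_M_inv \<kappa> = herglotz_class ((1 + \<kappa>) / (1 - \<kappa>))"


section \<open>Coupling under Hypothesis I\<close>

definition coupling_alpha :: "real \<Rightarrow> real \<Rightarrow> real" where
  "coupling_alpha \<kappa>1 \<kappa>2 =
     (if \<kappa>2 = 0 then pi / 2 else arctan (1 / \<kappa>2 * sqrt ((1 - \<kappa>2\<^sup>2) / (1 - \<kappa>1\<^sup>2))))"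

definition coupling_beta :: "real \<Rightarrow> real \<Rightarrow> real" where
  "coupling_beta \<kappa>1 \<kappa>2 = arcsin (\<kappa>1 * sin (coupling_alpha \<kappa>1 \<kappa>2))"

lemma coupling_beta:
  assumes "0 \<le> \<kappa>1" "\<kappa>1 < 1" "0 \<le> \<kappa>2" "\<kappa>2 < 1"
  shows "sin (coupling_beta \<kappa>1 \<kappa>2) = \<kappa>1 * sin (coupling_alpha \<kappa>1 \<kappa>2)"
    and "cos (coupling_beta \<kappa>1 \<kappa>2) =
      (if \<kappa>2 = 0 then sqrt (1 - \<kappa>1\<^sup>2) else 1 / \<kappa>2 * cos (coupling_alpha \<kappa>1 \<kappa>2))"
proof -
  let ?s = "sin (coupling_alpha \<kappa>1 \<kappa>2)" and ?c = "cos (coupling_alpha \<kappa>1 \<kappa>2)"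
  have bound: "\<bar>\<kappa>1 * ?s\<bar> \<le> 1"
    using mult_mono[of "\<bar>\<kappa>1\<bar>" 1 "\<bar>?s\<bar>" 1] assms by (simp add: abs_mult)
  then have le: "- 1 \<le> \<kappa>1 * ?s" "\<kappa>1 * ?s \<le> 1"
    by linarith+
  show "sin (coupling_beta \<kappa>1 \<kappa>2) = \<kappa>1 * ?s"
    unfolding coupling_beta_def by (rule sin_arcsin[OF le])
  have cos: "cos (coupling_beta \<kappa>1 \<kappa>2) = sqrt (1 - (\<kappa>1 * ?s)\<^sup>2)"
    unfolding coupling_beta_def by (rule cos_arcsin[OF le])
  show "cos (coupling_beta \<kappa>1 \<kappa>2) = (if \<kappa>2 = 0 then sqrt (1 - \<kappa>1\<^sup>2) else 1 / \<kappa>2 * ?c)"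
  proof (cases "\<kappa>2 = 0")
    case True
    then show ?thesis
      unfolding cos by (simp add: coupling_alpha_def)
  next
    case False
    define t where "t = 1 / \<kappa>2 * sqrt ((1 - \<kappa>2\<^sup>2) / (1 - \<kappa>1\<^sup>2))"
    have alpha: "coupling_alpha \<kappa>1 \<kappa>2 = arctan t"
      using False by (simp add: coupling_alpha_def t_def)
    have c: "0 < ?c"
      unfolding alpha by (simp add: cos_arctan add_pos_nonneg)
    have "t = tan (coupling_alpha \<kappa>1 \<kappa>2)"
      unfolding alpha by (simp only: tan_arctan)
    then have s: "?s = t * ?c"
      using c by (simp add: tan_def)
    have k: "0 < 1 - \<kappa>1\<^sup>2" "0 \<le> 1 - \<kappa>2\<^sup>2"
      using assms by (simp_all add: power_less_one_iff power_le_one abs_square_less_1)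
    have "t\<^sup>2 = (1 / \<kappa>2)\<^sup>2 * ((1 - \<kappa>2\<^sup>2) / (1 - \<kappa>1\<^sup>2))"
      unfolding t_def power_mult_distrib using k by simp
    then have "\<kappa>2\<^sup>2 * (1 - \<kappa>1\<^sup>2) * t\<^sup>2 = 1 - \<kappa>2\<^sup>2"
      using k False by (simp add: field_simps)
    then have "\<kappa>2\<^sup>2 * (1 - \<kappa>1\<^sup>2) * ?s\<^sup>2 = (1 - \<kappa>2\<^sup>2) * ?c\<^sup>2"
      unfolding s power_mult_distrib by (metis mult.assoc)
    moreover have "?s\<^sup>2 + ?c\<^sup>2 = 1"
      by simp
    ultimately have "\<kappa>2\<^sup>2 * (1 - (\<kappa>1 * ?s)\<^sup>2) = ?c\<^sup>2"
      by algebra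
    then have "1 - (\<kappa>1 * ?s)\<^sup>2 = (1 / \<kappa>2 * ?c)\<^sup>2"
      using False by (simp add: field_simps)
    moreover have "0 \<le> 1 / \<kappa>2 * ?c"
      using c assms by simp
    ultimately show ?thesis
      unfolding cos using False by (metis real_sqrt_unique)
  qed
qed

definition op_sum :: "'a graph \<Rightarrow> 'b graph \<Rightarrow> ('a \<times> 'b) graph" where
  "op_sum A B = {((f, g), (f', g')) | f g f' g'. (f, f') \<in> A \<and> (g, g') \<in> B}"

text \<open>The restriction of \<open>S\<close> to \<open>D + span {x}\<close>.\<close>

definition restrict_op :: "'a::complex_inner graph \<Rightarrow> 'a set \<Rightarrow> 'a \<Rightarrow> 'a graph" where
  "restrict_op S D x = {(f, h) \<in> S. \<exists>d\<in>D. \<exists>c. f = d + c *\<^sub>C x}"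

definition coupling_vector ::
  "real \<Rightarrow> real \<Rightarrow> 'a::complex_inner \<Rightarrow> 'a \<Rightarrow> 'b::complex_inner \<Rightarrow> 'b \<Rightarrow> 'a \<times> 'b" where
  "coupling_vector \<kappa>1 \<kappa>2 gp1 gm1 gp2 gm2 =
     (if \<kappa>2 = 0 then (gp1 - \<kappa>1 *\<^sub>R gm1, - sqrt (1 - \<kappa>1\<^sup>2) *\<^sub>R gm2)
      else (sin (coupling_alpha \<kappa>1 \<kappa>2) *\<^sub>R (gp1 - \<kappa>1 *\<^sub>R gm1),
            cos (coupling_alpha \<kappa>1 \<kappa>2) *\<^sub>R (gp2 - (1 / \<kappa>2) *\<^sub>R gm2)))"

definition coupling_Gp ::
  "real \<Rightarrow> real \<Rightarrow> 'a::complex_inner \<Rightarrow> 'b::complex_inner \<Rightarrow> 'a \<times> 'b" where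
  "coupling_Gp \<kappa>1 \<kappa>2 gp1 gp2 =
     (cos (coupling_alpha \<kappa>1 \<kappa>2) *\<^sub>R gp1, - sin (coupling_alpha \<kappa>1 \<kappa>2) *\<^sub>R gp2)"

definition coupling_Gm ::
  "real \<Rightarrow> real \<Rightarrow> 'a::complex_inner \<Rightarrow> 'b::complex_inner \<Rightarrow> 'a \<times> 'b" where
  "coupling_Gm \<kappa>1 \<kappa>2 gm1 gm2 =
     (cos (coupling_beta \<kappa>1 \<kappa>2) *\<^sub>R gm1, - sin (coupling_beta \<kappa>1 \<kappa>2) *\<^sub>R gm2)"

text \<open>The coupling depends on the deficiency vectors (rotating \<open>g\<^sup>1\<^sub>\<plusminus>\<close> and \<open>g\<^sup>2\<^sub>\<plusminus>\<close> by
  different phases changes the symmetric operator), and the channel operator is only determined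
  up to a unimodular factor. It is therefore a relation with the vectors as parameters.\<close>

definition coupling_I ::
  "'a::complex_hilbert L_system \<Rightarrow> 'a \<Rightarrow> 'a \<Rightarrow> 'b::complex_hilbert L_system \<Rightarrow> 'b \<Rightarrow> 'b \<Rightarrow>
    ('a \<times> 'b) L_system \<Rightarrow> bool" where
  "coupling_I \<Theta>1 gp1 gm1 \<Theta>2 gp2 gm2 \<Theta> \<longleftrightarrow>
     hypothesis_I_with \<Theta>1 gp1 gm1 \<and> hypothesis_I_with \<Theta>2 gp2 gm2 \<and> is_L_system \<Theta> \<and>
     (\<exists>\<kappa>1 \<kappa>2. von_neumann_vectors (symop \<Theta>1) (mainop \<Theta>1) \<kappa>1 gp1 gm1 \<and>
        von_neumann_vectors (symop \<Theta>2) (mainop \<Theta>2) \<kappa>2 gp2 gm2 \<and>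
        (let A0 = op_sum (symop \<Theta>1) (symop \<Theta>2);
             Gp = coupling_Gp \<kappa>1 \<kappa>2 gp1 gp2;
             Gm = coupling_Gm \<kappa>1 \<kappa>2 gm1 gm2
         in symop \<Theta> = restrict_op (adjoint A0) (Domain A0)
                         (coupling_vector \<kappa>1 \<kappa>2 gp1 gm1 gp2 gm2) \<and>
            mainop \<Theta> = restrict_op (adjoint A0) (Domain (symop \<Theta>)) (Gp - (\<kappa>1 * \<kappa>2) *\<^sub>R Gm) \<and>
            Gp - Gm \<in> Domain (real_op \<Theta>)))"


section \<open>General coupling\<close>

text \<open>\<open>\<Theta>'\<close> is the system with the operators of \<open>\<Theta>\<close> that satisfies Hypothesis I with the given
  vectors, and \<open>\<nu>\<close> is the corresponding unimodular factor. If the von Neumann parameter is \<open>0\<close>, a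
  system satisfies both hypotheses, for different choices of \<open>gm\<close>; hence the case distinction is
  made with respect to the given vectors.\<close>

definition hypothesis_I_form ::
  "'a::complex_hilbert L_system \<Rightarrow> 'a \<Rightarrow> 'a \<Rightarrow> 'a L_system \<Rightarrow> complex \<Rightarrow> bool" where
  "hypothesis_I_form \<Theta> gp gm \<Theta>' \<nu> \<longleftrightarrow>
     is_L_system \<Theta>' \<and> symop \<Theta>' = symop \<Theta> \<and> mainop \<Theta>' = mainop \<Theta> \<and>
     hypothesis_I_with \<Theta>' gp gm \<and> cmod \<nu> = 1 \<and>
     (\<forall>z\<in>resolvent_set (mainop \<Theta>). transfer_function \<Theta>' z = \<nu> * transfer_function \<Theta> z) \<and>
     (hypothesis_I_with \<Theta> gp gm \<longrightarrow> \<Theta>' = \<Theta> \<and> \<nu> = 1) \<and>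
     (hypothesis_II_with \<Theta> gp gm \<longrightarrow> \<nu> = - 1)"

definition coupling ::
  "'a::complex_hilbert L_system \<Rightarrow> 'a \<Rightarrow> 'a \<Rightarrow> 'b::complex_hilbert L_system \<Rightarrow> 'b \<Rightarrow> 'b \<Rightarrow>
    ('a \<times> 'b) L_system \<Rightarrow> bool" where
  "coupling \<Theta>1 gp1 gm1 \<Theta>2 gp2 gm2 \<Theta> \<longleftrightarrow> is_L_system \<Theta> \<and>
     (\<exists>\<Theta>1' \<nu>1 \<Theta>2' \<nu>2 \<Theta>'.
        hypothesis_I_form \<Theta>1 gp1 gm1 \<Theta>1' \<nu>1 \<and> hypothesis_I_form \<Theta>2 gp2 gm2 \<Theta>2' \<nu>2 \<and>
        coupling_I \<Theta>1' gp1 gm1 \<Theta>2' gp2 gm2 \<Theta>' \<and>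
        symop \<Theta> = symop \<Theta>' \<and> mainop \<Theta> = mainop \<Theta>' \<and>
        (\<forall>z\<in>resolvent_set (mainop \<Theta>).
           transfer_function \<Theta> z = inverse (\<nu>1 * \<nu>2) * transfer_function \<Theta>' z))"

end

(* Write R = Re A, chi = K 1. From g+ - k g- in Dom T and g+ - g- in Dom Ahat one computes R g+ and R g-
   explicitly, up to one scalar t with |t|^2 = (1 + k) / (1 - k) for real k. Hence some multiple phi of g+ solves
   (R - i) phi = chi, and for z in the upper half-plane (R - z)^-1 chi is a geometric series in the Cayley
   transform C of Ahat applied to phi; so V(z) is determined by the moments (C^n phi, phi). The moments are those
   of a measure on the circle (a weak limit of Fejer-type densities), which has no atom at 1 because C
   has no fixed vector, and whose image on the line has infinite total mass because phi is not in Dom Ahat.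
   Thus V belongs to the class with parameter |phi|^2 = (1 - k) / (1 + k), where k = kappa under Hypothesis I
   and k = - kappa under Hypothesis II.

   For the coupling it remains to identify parameters. The values at i give those of the factors, and
   the explicit deficiency vectors give kappa1 kappa2 for the product. The sign of the phase of the quasi-kernel
   is read off W(-i), which is real exactly if k is real, and then equals k. *)

theory Submission
  imports Defs "HOL-Probability.Helly_Selection"
begin

section \<open>Complex inner products\<close>

text \<open>The classes ask for a scalar measure only, so no spectral resolution of Ahat is built:
  the orbit of one vector under one bounded isometry carries enough, and properties of the measure
  are obtained by carrying functions of \<open>cis x\<close> over to vectors of the orbit. The
  obstacle in the coupling is that the product is prescribed by its transfer function, while the
  phase e of its quasi-kernel relative to the given deficiency vectors is unknown. A complex
  parameter treats all phases at once: rotating g- by e turns kappa into k = kappa cnj(e). The point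
  -i is chosen because g- is an eigenvector there, so the resolvent of the state-space operator
  takes chi to an explicit multiple of g-. Passing from Theta' to Theta changes the value at -i from
  kappa to -kappa; both are real, hence k = -kappa. This gives e = -1 unless kappa = 0, and in that
  case the free phase is absorbed into g- without disturbing the main operator.\<close>

lemma cinner_add_right: "cinner x (y + z) = cinner x y + cinner x z"
  by (metis cinner_add_left cinner_commute complex_cnj_add)

lemma cinner_scaleC_right: "cinner x (c *\<^sub>C y) = cnj c * cinner x y"
  by (metis cinner_commute cinner_scaleC_left complex_cnj_mult)

lemma scaleC_minus_one: "(- 1) *\<^sub>C x = - (x::'a::complex_inner)"
  using scaleR_scaleC[of "-1" x] by simp

lemma cinner_minus_left: "cinner (- x) y = - cinner x y"
  by (metis cinner_scaleC_left mult_minus1 scaleC_minus_one)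

lemma cinner_minus_right: "cinner x (- y) = - cinner x y"
  by (metis cinner_commute cinner_minus_left complex_cnj_minus)

lemma cinner_diff_left: "cinner (x - y) z = cinner x z - cinner y z"
  by (simp add: diff_conv_add_uminus cinner_add_left cinner_minus_left del: add_uminus_conv_diff)

lemma cinner_diff_right: "cinner x (y - z) = cinner x y - cinner x z"
  by (simp add: diff_conv_add_uminus cinner_add_right cinner_minus_right del: add_uminus_conv_diff)

lemma cinner_zero_left [simp]: "cinner 0 x = 0"
  using cinner_diff_left[of x x x] by simp

lemma cinner_zero_right [simp]: "cinner x 0 = 0"
  using cinner_diff_right[of x x x] by simp

lemma cinner_sum_left: "cinner (\<Sum>i\<in>I. f i) x = (\<Sum>i\<in>I. cinner (f i) x)"
  by (induction I rule: infinite_finite_induct) (auto simp: cinner_add_left)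

lemma cinner_sum_right: "cinner x (\<Sum>i\<in>I. f i) = (\<Sum>i\<in>I. cinner x (f i))"
  by (induction I rule: infinite_finite_induct) (auto simp: cinner_add_right)

lemma cinner_self: "cinner x x = complex_of_real ((norm x)\<^sup>2)"
proof -
  have "Im (cinner x x) = 0"
    using cinner_commute[of x x] by (metis Reals_cnj_iff complex_is_Real_iff)
  moreover have "Re (cinner x x) = (norm x)\<^sup>2"
    by (metis inner_eq_Re_cinner dot_square_norm)
  ultimately show ?thesis
    by (simp add: complex_eq_iff)
qed

lemma cinner_self_eq_0: "cinner x x = 0 \<longleftrightarrow> x = 0"
  by (simp add: cinner_self)

lemma norm_scaleC: "norm (c *\<^sub>C x) = cmod c * norm (x::'a::complex_inner)"
proof -
  have "complex_of_real ((norm (c *\<^sub>C x))\<^sup>2) = c * cnj c * complex_of_real ((norm x)\<^sup>2)"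
    by (simp only: cinner_self[symmetric] cinner_scaleC_left cinner_scaleC_right mult_ac)
  also have "\<dots> = complex_of_real ((cmod c * norm x)\<^sup>2)"
    by (simp only: complex_norm_square[symmetric] power_mult_distrib of_real_mult)
  finally have "(norm (c *\<^sub>C x))\<^sup>2 = (cmod c * norm x)\<^sup>2"
    using of_real_eq_iff by blast
  then show ?thesis
    by (simp add: power2_eq_iff_nonneg)
qed

lemma scaleC_minus_right: "c *\<^sub>C (- x) = - (c *\<^sub>C (x::'a::complex_inner))"
  and scaleC_minus_left: "(- c) *\<^sub>C x = - (c *\<^sub>C (x::'a::complex_inner))"
  by simp_all

lemma scaleC_diff_right: "c *\<^sub>C (x - y) = c *\<^sub>C x - c *\<^sub>C (y::'a::complex_inner)"
  and scaleC_diff_left: "(c - d) *\<^sub>C x = c *\<^sub>C x - d *\<^sub>C (x::'a::complex_inner)"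
  by (simp_all add: complex_vector.scale_right_diff_distrib complex_vector.scale_left_diff_distrib)

lemmas cinner_simps = cinner_add_left cinner_add_right cinner_diff_left cinner_diff_right
  cinner_minus_left cinner_minus_right cinner_scaleC_left cinner_scaleC_right

lemma bounded_linear_scaleC: "bounded_linear (\<lambda>x::'a::complex_inner. c *\<^sub>C x)"
proof (rule bounded_linear_intro[where K = "cmod c"])
  show "c *\<^sub>C (r *\<^sub>R x) = r *\<^sub>R (c *\<^sub>C x)" for r and x :: 'a
    by (simp add: scaleR_scaleC scaleC_scaleC mult.commute)
qed (simp_all add: scaleC_add_right norm_scaleC mult.commute)

text \<open>Rotating \<open>x\<close> by the unimodular \<open>c\<close> makes the inner product a
  positive real, so the real Cauchy-Schwarz inequality applies.\<close>

lemma cinner_bound: "cmod (cinner x y) \<le> norm x * norm y"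
proof (cases "cinner x y = 0")
  case False
  define c where "c = cnj (cinner x y) / complex_of_real (cmod (cinner x y))"
  have "cinner (c *\<^sub>C x) y = complex_of_real (cmod (cinner x y))"
    using False by (simp add: c_def cinner_scaleC_left complex_norm_square[symmetric]
        power2_eq_square mult.commute)
  then have "cmod (cinner x y) = inner (c *\<^sub>C x) y"
    by (simp add: inner_eq_Re_cinner)
  also have "\<dots> \<le> norm (c *\<^sub>C x) * norm y"
    by (rule norm_cauchy_schwarz)
  also have "norm (c *\<^sub>C x) = norm x"
    using False by (simp add: norm_scaleC c_def norm_divide)
  finally show ?thesis .
qed simp

lemma bounded_linear_cinner_left: "bounded_linear (\<lambda>x. cinner x y)"
  by (rule bounded_linear_intro[where K = "norm y"])
    (simp_all add: cinner_add_left scaleR_scaleC cinner_scaleC_left scaleC_complex_def cinner_bound)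

lemma bounded_linear_cinner_right: "bounded_linear (\<lambda>y. cinner x y)"
proof (rule bounded_linear_intro[where K = "norm x"])
  show "cmod (cinner x y) \<le> norm y * norm x" for y
    using cinner_bound[of x y] by (simp add: mult.commute)
qed (simp_all add: cinner_add_right scaleR_scaleC cinner_scaleC_right scaleC_complex_def)

text \<open>A minimizing sequence for the distance to \<open>M\<close> is Cauchy by the
  parallelogram law, since midpoints stay in \<open>M\<close>. Its limit is a nearest point, and
  minimality along real lines gives orthogonality.\<close>

lemma projection_exists:
  fixes M :: "'a::complex_hilbert set"
  assumes M: "csubspace M" "closed M"
  shows "\<exists>m\<in>M. \<forall>u\<in>M. cinner (x - m) u = 0"
proof -
  have M0: "0 \<in> M" and Madd: "u \<in> M \<Longrightarrow> v \<in> M \<Longrightarrow> u + v \<in> M"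
    and Mscale: "u \<in> M \<Longrightarrow> c *\<^sub>C u \<in> M" for u v c
    using M(1) by (auto simp: complex_vector.subspace_def)
  define d where "d = Inf ((\<lambda>m. (norm (x - m))\<^sup>2) ` M)"
  have bdd: "bdd_below ((\<lambda>m. (norm (x - m))\<^sup>2) ` M)"
    by (intro bdd_belowI2[where m = 0]) simp
  have d_le: "d \<le> (norm (x - m))\<^sup>2" if "m \<in> M" for m
    unfolding d_def using bdd that by (rule cINF_lower)
  have "\<exists>m\<in>M. (norm (x - m))\<^sup>2 < d + 1 / real (Suc n)" for n
  proof -
    have "\<exists>y\<in>(\<lambda>m. (norm (x - m))\<^sup>2) ` M. y < d + 1 / real (Suc n)"
      unfolding d_def by (rule cInf_lessD) (use M0 in auto)
    then show ?thesis by auto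
  qed
  then obtain s where s: "\<And>n. s n \<in> M" "\<And>n. (norm (x - s n))\<^sup>2 < d + 1 / real (Suc n)"
    by metis
  have par: "(norm (s m - s n))\<^sup>2 \<le> 2 / real (Suc m) + 2 / real (Suc n)" for m n
  proof -
    have "(1/2) *\<^sub>C (s m + s n) \<in> M"
      by (intro Mscale Madd s)
    then have "d \<le> (norm (x - (1/2) *\<^sub>R (s m + s n)))\<^sup>2"
      using d_le by (simp add: scaleR_scaleC)
    moreover have "(norm (s m - s n))\<^sup>2 + 4 * (norm (x - (1/2) *\<^sub>R (s m + s n)))\<^sup>2
        = 2 * (norm (x - s m))\<^sup>2 + 2 * (norm (x - s n))\<^sup>2"
      by (simp add: power2_norm_eq_inner inner_simps algebra_simps inner_commute)
    ultimately show ?thesis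
      using s(2)[of m] s(2)[of n] by simp
  qed
  have "Cauchy s"
  proof (rule CauchyI)
    fix e :: real assume "0 < e"
    then obtain N where N: "4 / e\<^sup>2 < real N"
      using reals_Archimedean2 by blast
    show "\<exists>N. \<forall>m\<ge>N. \<forall>n\<ge>N. norm (s m - s n) < e"
    proof (intro exI allI impI)
      fix m n assume mn: "N \<le> m" "N \<le> n"
      have N0: "0 < real N"
        using N \<open>0 < e\<close> by (smt (verit) divide_pos_pos zero_less_power)
      have "2 / real (Suc m) \<le> 2 / real N" "2 / real (Suc n) \<le> 2 / real N"
        using mn N0 by (auto intro!: divide_left_mono)
      then have "(norm (s m - s n))\<^sup>2 \<le> 4 / real N"
        using par[of m n] by simp
      also have "\<dots> < e\<^sup>2"
        using N N0 \<open>0 < e\<close> by (simp add: field_simps)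
      finally show "norm (s m - s n) < e"
        using \<open>0 < e\<close> by (simp add: power_less_imp_less_base)
    qed
  qed
  then obtain p where p: "s \<longlonglongrightarrow> p"
    using Cauchy_convergent_iff convergent_def by blast
  have "p \<in> M"
    using M(2) s(1) p closed_sequentially by blast
  have "(\<lambda>n. d + 1 / real (Suc n)) \<longlonglongrightarrow> d + 0"
    by (intro tendsto_add tendsto_const LIMSEQ_Suc[OF lim_1_over_n])
  moreover have "(\<lambda>n. (norm (x - s n))\<^sup>2) \<longlonglongrightarrow> (norm (x - p))\<^sup>2"
    by (intro tendsto_intros p)
  ultimately have pd: "(norm (x - p))\<^sup>2 \<le> d"
    using s(2) by (auto intro: LIMSEQ_le less_imp_le)
  have inner0: "inner (x - p) u = 0" if u: "u \<in> M" for u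
  proof (cases "u = 0")
    case False
    \<comment> \<open>The minimizer of the quadratic in \<open>r\<close> that is expanded
      below.\<close>
    define r where "r = inner (x - p) u / (norm u)\<^sup>2"
    have "p + r *\<^sub>R u \<in> M"
      using Madd[OF \<open>p \<in> M\<close> Mscale[OF u]] by (simp add: scaleR_scaleC)
    then have "(norm (x - p))\<^sup>2 \<le> (norm (x - (p + r *\<^sub>R u)))\<^sup>2"
      using order_trans[OF pd d_le] by blast
    also have "x - (p + r *\<^sub>R u) = (x - p) - r *\<^sub>R u"
      by simp
    also have "(norm ((x - p) - r *\<^sub>R u))\<^sup>2
        = (norm (x - p))\<^sup>2 - 2 * r * inner (x - p) u + r\<^sup>2 * (norm u)\<^sup>2"
      unfolding power2_norm_eq_inner inner_diff_left[of "x - p"] inner_diff_right[of _ "x - p"]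
        inner_scaleR_left inner_scaleR_right inner_commute[of u "x - p"]
      by (simp add: power2_eq_square algebra_simps)
    also have "\<dots> = (norm (x - p))\<^sup>2 - (inner (x - p) u)\<^sup>2 / (norm u)\<^sup>2"
      using False by (simp add: r_def power2_eq_square field_simps)
    finally have "(inner (x - p) u)\<^sup>2 / (norm u)\<^sup>2 \<le> 0" by simp
    moreover have "0 < (norm u)\<^sup>2" using False by simp
    ultimately have "(inner (x - p) u)\<^sup>2 \<le> 0"
      by (simp add: divide_le_0_iff)
    then show ?thesis by simp
  qed simp
  have "cinner (x - p) u = 0" if u: "u \<in> M" for u
  proof -
    \<comment> \<open>Real orthogonality to \<open>\<i> *\<^sub>C u\<close> supplies the imaginary
      part.\<close>
    have "Re (cinner (x - p) (\<i> *\<^sub>C u)) = 0" "Re (cinner (x - p) u) = 0"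
      using inner0[OF u] inner0[OF Mscale[OF u, of \<i>]] by (simp_all add: inner_eq_Re_cinner)
    then show ?thesis
      by (simp add: cinner_scaleC_right complex_eq_iff)
  qed
  then show ?thesis
    using \<open>p \<in> M\<close> by blast
qed

section \<open>Symmetric and self-adjoint operators\<close>

lemma adjoint_iff: "(g, h) \<in> adjoint A \<longleftrightarrow> (\<forall>(f, f')\<in>A. cinner f' g = cinner f h)"
  by (simp add: adjoint_in_def)

lemma adjointD: "(g, h) \<in> adjoint A \<Longrightarrow> (f, f') \<in> A \<Longrightarrow> cinner f' g = cinner f h"
  by (auto simp: adjoint_iff)

lemma adjoint_antimono: "A \<subseteq> B \<Longrightarrow> adjoint B \<subseteq> adjoint A"
  by (auto simp: adjoint_in_def)

lemma csubspace_graphD: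
  assumes "csubspace (A::'a::complex_inner graph)"
  shows "(0, 0) \<in> A"
    and "(f, f') \<in> A \<Longrightarrow> (g, g') \<in> A \<Longrightarrow> (f + g, f' + g') \<in> A"
    and "(f, f') \<in> A \<Longrightarrow> (c *\<^sub>C f, c *\<^sub>C f') \<in> A"
    and "(f, f') \<in> A \<Longrightarrow> (g, g') \<in> A \<Longrightarrow> (f - g, f' - g') \<in> A"
proof -
  show "(0, 0) \<in> A"
    using complex_vector.subspace_0[OF assms] by (simp add: zero_prod_def)
  show "(f, f') \<in> A \<Longrightarrow> (g, g') \<in> A \<Longrightarrow> (f + g, f' + g') \<in> A"
    using complex_vector.subspace_add[OF assms, of "(f, f')" "(g, g')"] by simp
  show "(f, f') \<in> A \<Longrightarrow> (c *\<^sub>C f, c *\<^sub>C f') \<in> A"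
    using complex_vector.subspace_scale[OF assms, of "(f, f')" c] by (simp add: scaleC_prod_def)
  show "(f, f') \<in> A \<Longrightarrow> (g, g') \<in> A \<Longrightarrow> (f - g, f' - g') \<in> A"
    using complex_vector.subspace_diff[OF assms, of "(f, f')" "(g, g')"] by simp
qed

lemma csubspace_adjoint: "csubspace (adjoint A)"
proof (rule complex_vector.subspaceI)
  show "0 \<in> adjoint A"
    by (simp add: zero_prod_def adjoint_iff)
  show "p + q \<in> adjoint A" if "p \<in> adjoint A" "q \<in> adjoint A" for p q
    using that by (cases p; cases q) (fastforce simp: adjoint_iff cinner_simps)
  show "c *\<^sub>C p \<in> adjoint A" if "p \<in> adjoint A" for c p
    using that by (cases p) (fastforce simp: adjoint_iff cinner_simps scaleC_prod_def)
qed

lemmas adjoint_graphD = csubspace_graphD[OF csubspace_adjoint]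

lemma single_valuedD': "linear_operator A \<Longrightarrow> (f, h) \<in> A \<Longrightarrow> (f, h') \<in> A \<Longrightarrow> h = h'"
  by (auto simp: linear_operator_def dest: single_valuedD)

lemma linear_operator_adjoint:
  fixes A :: "'a::complex_inner graph"
  assumes "densely_defined A"
  shows "linear_operator (adjoint A)"
  unfolding linear_operator_def
proof (intro conjI csubspace_adjoint single_valuedI)
  fix g h h' assume gh: "(g, h) \<in> adjoint A" "(g, h') \<in> adjoint A"
  have "cinner f (h - h') = 0" if "f \<in> Domain A" for f
    using that gh by (auto simp: cinner_diff_right) (metis adjointD)
  moreover have "closed {f. cinner f (h - h') = 0}"
    by (intro closed_Collect_eq continuous_on_const
        linear_continuous_on bounded_linear_cinner_left)
  ultimately have "closure (Domain A) \<subseteq> {f. cinner f (h - h') = 0}"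
    by (intro closure_minimal) auto
  then have "cinner (h - h') (h - h') = 0"
    using assms by (auto simp: densely_defined_def)
  then show "h = h'"
    by (simp add: cinner_self_eq_0)
qed

lemma closed_adjoint: "closed (adjoint (A::'a::complex_inner graph))"
proof -
  have "adjoint A = (\<Inter>(f, f')\<in>A. {p. cinner f' (fst p) = cinner f (snd p)})"
    by (auto simp: adjoint_in_def)
  also have "closed \<dots>"
    by (auto intro!: closed_Collect_eq bounded_linear.continuous_on[OF bounded_linear_cinner_right]
        continuous_intros)
  finally show ?thesis .
qed

lemma symmetric_form_real:
  assumes "S \<subseteq> adjoint S" "(f, f') \<in> S"
  shows "Im (cinner f' f) = 0"
proof -
  have "cinner f' f = cinner f f'"
    using assms adjointD by blast
  then show ?thesis
    by (metis Reals_cnj_iff cinner_commute complex_is_Real_iff)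
qed

text \<open>The cross terms add up to -2 (Re z) times the real number (f', f), which vanishes on the
  imaginary axis. The identity bounds S - z below.\<close>

lemma symmetric_norm_shift:
  assumes S: "S \<subseteq> adjoint S" "(f, f') \<in> S" and z: "z = \<i> \<or> z = - \<i>"
  shows "(norm (f' - z *\<^sub>C f))\<^sup>2 = (norm f')\<^sup>2 + (norm f)\<^sup>2"
proof -
  have "cinner f' f = cinner f f'"
    using S adjointD by blast
  then have "cinner (f' - z *\<^sub>C f) (f' - z *\<^sub>C f) = cinner f' f' + cinner f f"
    using z by (auto simp: cinner_simps algebra_simps)
  then have "complex_of_real ((norm (f' - z *\<^sub>C f))\<^sup>2)
      = complex_of_real ((norm f')\<^sup>2 + (norm f)\<^sup>2)"
    by (simp only: cinner_self of_real_add)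
  then show ?thesis
    using of_real_eq_iff by blast
qed

text \<open>Von Neumann's decomposition: the range of \<open>S - z\<close> is closed because \<open>S - z\<close> is bounded below,
  and its orthogonal complement is a deficiency subspace.\<close>

lemma deficiency_decomposition:
  fixes S :: "'a::complex_hilbert graph"
  assumes lin: "linear_operator S" and sym: "S \<subseteq> adjoint S" and cl: "closed S"
    and z: "z = \<i> \<or> z = - \<i>"
  shows "\<exists>(f, f')\<in>S. \<exists>v\<in>eigenspace (adjoint S) (cnj z). h = (f' - z *\<^sub>C f) + v"
proof -
  define R where "R = (\<lambda>(f, f'). f' - z *\<^sub>C f) ` S"
  have sub: "csubspace S"
    using lin by (simp add: linear_operator_def)
  note SD = csubspace_graphD[OF sub]
  have "csubspace R"
    unfolding complex_vector.subspace_def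
  proof (intro conjI ballI allI)
    show "0 \<in> R"
      unfolding R_def using SD(1) by force
    fix x assume "x \<in> R"
    then obtain f f' where x: "(f, f') \<in> S" "x = f' - z *\<^sub>C f"
      by (auto simp: R_def)
    show "c *\<^sub>C x \<in> R" for c
      unfolding R_def image_iff
      by (rule bexI[OF _ SD(3)[OF x(1), of c]])
        (simp add: x(2) scaleC_diff_right scaleC_scaleC mult.commute)
    fix y assume "y \<in> R"
    then obtain g g' where y: "(g, g') \<in> S" "y = g' - z *\<^sub>C g"
      by (auto simp: R_def)
    show "x + y \<in> R"
      unfolding R_def image_iff
      by (rule bexI[OF _ SD(2)[OF x(1) y(1)]]) (simp add: x(2) y(2) scaleC_add_right)
  qed
  have "closed R"
    unfolding closed_sequential_limits
  proof (intro allI impI, elim conjE)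
    fix x l assume "\<forall>n. x n \<in> R" and lim: "x \<longlonglongrightarrow> l"
    then have "\<forall>n. \<exists>p. p \<in> S \<and> x n = snd p - z *\<^sub>C fst p"
      unfolding R_def image_iff split_beta by blast
    then obtain F where F: "\<And>n. F n \<in> S" "\<And>n. x n = snd (F n) - z *\<^sub>C fst (F n)"
      using choice[of "\<lambda>n p. p \<in> S \<and> x n = snd p - z *\<^sub>C fst p"] by blast
    have bound: "norm (fst (F m) - fst (F n)) \<le> norm (x m - x n)" for m n
    proof -
      have "(fst (F m) - fst (F n), snd (F m) - snd (F n)) \<in> S"
        using SD(4)[of "fst (F m)" "snd (F m)" "fst (F n)" "snd (F n)"] F(1) by simp
      from symmetric_norm_shift[OF sym this z]
      have "(norm (x m - x n))\<^sup>2
          = (norm (snd (F m) - snd (F n)))\<^sup>2 + (norm (fst (F m) - fst (F n)))\<^sup>2"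
        unfolding F(2) scaleC_diff_right by (simp add: algebra_simps)
      then show ?thesis
        by (simp add: power2_le_imp_le)
    qed
    have "Cauchy (\<lambda>n. fst (F n))"
      using LIMSEQ_imp_Cauchy[OF lim] bound unfolding Cauchy_iff by (meson le_less_trans)
    then obtain f where f: "(\<lambda>n. fst (F n)) \<longlonglongrightarrow> f"
      using Cauchy_convergent_iff convergent_def by blast
    have "(\<lambda>n. x n + z *\<^sub>C fst (F n)) \<longlonglongrightarrow> l + z *\<^sub>C f"
      by (intro tendsto_add lim bounded_linear.tendsto[OF bounded_linear_scaleC] f)
    then have "(\<lambda>n. (fst (F n), snd (F n))) \<longlonglongrightarrow> (f, l + z *\<^sub>C f)"
      by (intro tendsto_Pair f) (simp add: F(2))
    then have "(f, l + z *\<^sub>C f) \<in> S"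
      using closed_sequentially[OF cl, of F] F(1) by simp
    then show "l \<in> R"
      unfolding R_def image_iff by (rule rev_bexI) simp
  qed
  from projection_exists[OF \<open>csubspace R\<close> this, of h]
  obtain m where m: "m \<in> R" "\<And>u. u \<in> R \<Longrightarrow> cinner (h - m) u = 0"
    by blast
  have "cinner f' (h - m) = cinner f (cnj z *\<^sub>C (h - m))" if "(f, f') \<in> S" for f f'
  proof -
    have "cinner (f' - z *\<^sub>C f) (h - m) = 0"
      using m(2)[of "f' - z *\<^sub>C f"] that cinner_commute[of "f' - z *\<^sub>C f" "h - m"]
      by (force simp: R_def)
    then show ?thesis
      by (simp add: cinner_diff_left cinner_scaleC_left cinner_scaleC_right)
  qed
  then have "h - m \<in> eigenspace (adjoint S) (cnj z)"
    by (auto simp: eigenspace_def adjoint_iff)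
  moreover from m(1) obtain f f' where "(f, f') \<in> S" "m = f' - z *\<^sub>C f"
    by (auto simp: R_def)
  ultimately show ?thesis
    by (intro bexI[of _ "(f, f')"]) (auto intro!: bexI[of _ "h - m"])
qed

lemma self_adjointD:
  fixes S :: "'a::complex_inner graph"
  assumes "self_adjoint S"
  shows "linear_operator S" and "adjoint S = S" and "closed S" and "csubspace S"
proof -
  show "linear_operator S" and eq: "adjoint S = S"
    using assms by (simp_all add: self_adjoint_in_def)
  then show "csubspace S"
    by (simp add: linear_operator_def)
  show "closed S"
    using closed_adjoint[of S] unfolding eq .
qed

lemma self_adjoint_eigen_nonreal:
  fixes S :: "'a::complex_inner graph"
  assumes "self_adjoint S" "(f, z *\<^sub>C f) \<in> S" "Im z \<noteq> 0"
  shows "f = 0"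
proof -
  have "Im (cinner (z *\<^sub>C f) f) = 0"
    using symmetric_form_real[of S] self_adjointD(2)[OF assms(1)] assms(2) by blast
  then show ?thesis
    using assms(3) by (simp add: cinner_simps cinner_self)
qed

lemma self_adjoint_range:
  fixes S :: "'a::complex_hilbert graph"
  assumes S: "self_adjoint S" and z: "z = \<i> \<or> z = - \<i>"
  shows "\<exists>f. (f, h + z *\<^sub>C f) \<in> S"
proof -
  note SD = self_adjointD[OF S]
  from deficiency_decomposition[OF SD(1) _ SD(3) z, of h] SD(2)
  obtain f f' v where f: "(f, f') \<in> S" "(v, cnj z *\<^sub>C v) \<in> S" "h = (f' - z *\<^sub>C f) + v"
    by (auto simp: eigenspace_def)
  have "v = 0"
    by (rule self_adjoint_eigen_nonreal[OF S f(2)]) (use z in auto)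
  then have "f' = h + z *\<^sub>C f"
    using f(3) by simp
  then show ?thesis
    using f(1) by blast
qed

text \<open>If \<open>v\<close> were not a multiple of \<open>g\<close>, then {v, g} would extend to
  a basis, and every basis has cardinality 1.\<close>

lemma eigenspace_cdim_1:
  assumes dim: "cdim (eigenspace A z) = 1" and g: "g \<in> eigenspace A z" "g \<noteq> 0"
    and v: "v \<in> eigenspace A z"
  shows "\<exists>c. v = c *\<^sub>C (g::'a::complex_inner)"
proof (rule ccontr)
  assume "\<nexists>c. v = c *\<^sub>C g"
  then have nspan: "v \<notin> complex_vector.span {g}"
    by (auto simp: complex_vector.span_singleton)
  have "complex_vector.independent {g}"
    using g(2) by simp
  then have ind: "complex_vector.independent {v, g}"
    using nspan complex_vector.independent_insertI by blast
  have "{v, g} \<subseteq> eigenspace A z"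
    using v g by blast
  from complex_vector.maximal_independent_subset_extend[OF this ind]
  obtain B where B: "{v, g} \<subseteq> B" "B \<subseteq> eigenspace A z" "complex_vector.independent B"
    "eigenspace A z \<subseteq> complex_vector.span B"
    by blast
  have "card B = 1"
    using complex_vector.basis_card_eq_dim[OF B(2) B(4) B(3)] dim by simp
  then have "v = g"
    using B(1) by (auto simp: card_1_singleton_iff)
  then show False
    using nspan complex_vector.span_base by blast
qed

section \<open>The spectral measure of an isometry\<close>

lemma integral_cis_period:
  "(LBINT x. indicator {0..2 * pi} x *\<^sub>R cis (of_int k * x)) = (if k = 0 then complex_of_real (2 * pi) else 0)"
proof (cases "k = 0")
  case True
  have "(LBINT x. indicator {0..2 * pi} x *\<^sub>R (1::complex)) = complex_of_real (2 * pi) - complex_of_real 0"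
    by (rule integral_FTC_Icc[where F = complex_of_real])
      (auto intro!: continuous_intros derivative_eq_intros simp: has_vector_derivative_def scaleR_conv_of_real)
  then show ?thesis
    using True by simp
next
  case False
  let ?F = "\<lambda>x. cis (of_int k * x) / (\<i> * of_int k)"
  have "(LBINT x. indicator {0..2 * pi} x *\<^sub>R cis (of_int k * x)) = ?F (2 * pi) - ?F 0"
  proof (rule integral_FTC_Icc)
    show "continuous_on {0..2 * pi} (\<lambda>x. cis (of_int k * x))"
      by (intro continuous_intros)
    show "(?F has_vector_derivative cis (of_int k * x)) (at x within {0..2 * pi})" for x
    proof -
      have "((\<lambda>z. exp (\<i> * (of_int k * z)) / (\<i> * of_int k)) has_field_derivative
          exp (\<i> * (of_int k * complex_of_real x))) (at (complex_of_real x))"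
        using False by (auto intro!: derivative_eq_intros simp: mult_ac)
      from has_vector_derivative_real_field[OF this]
      have "((\<lambda>x. exp (\<i> * (of_int k * complex_of_real x)) / (\<i> * of_int k)) has_vector_derivative
          exp (\<i> * (of_int k * complex_of_real x))) (at x within {0..2 * pi})" .
      then show ?thesis
        by (simp add: cis_conv_exp)
    qed
  qed simp
  also have "cis (of_int k * (2 * pi)) = 1"
    using cis_multiple_2pi[of "of_int k"] by (metis Ints_of_int mult.commute)
  finally show ?thesis
    using False by simp
qed

lemma isCont_cis_mult: "isCont (\<lambda>x. cis (c * x)) x"
proof -
  have "continuous_on UNIV (\<lambda>x. cis (c * x))"
    by (intro continuous_intros)
  then show ?thesis
    by (simp add: continuous_on_eq_continuous_at)
qed

text \<open>An isometry suffices, without surjectivity: only nonnegative powers are applied to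
  \<phi>, and the moments of negative order are conjugates of the others.\<close>

locale isometric_orbit =
  fixes C :: "'a::complex_hilbert \<Rightarrow> 'a" and \<phi> :: 'a
  assumes C_add: "C (x + y) = C x + C y"
    and C_scaleC: "C (c *\<^sub>C x) = c *\<^sub>C C x"
    and C_cinner: "cinner (C x) (C y) = cinner x y"
    and norm_\<phi>: "norm \<phi> = 1"
begin

lemma norm_C: "norm (C x) = norm x"
  using C_cinner[of x x] by (simp add: cinner_self flip: of_real_power)

lemma bounded_linear_C: "bounded_linear C"
  by (rule bounded_linear_intro[where K = 1]) (simp_all add: C_add C_scaleC scaleR_scaleC norm_C)

sublocale C: bounded_linear C
  by (rule bounded_linear_C)

lemma C_funpow_cinner: "cinner ((C ^^ (n + k)) \<phi>) ((C ^^ (m + k)) \<phi>) = cinner ((C ^^ n) \<phi>) ((C ^^ m) \<phi>)"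
  by (induction k) (simp_all add: C_cinner)

lemma norm_C_funpow: "norm ((C ^^ n) x) = norm x"
  by (induction n) (simp_all add: norm_C)

text \<open>Densities of Fejer type: the squared norm of \<open>\<Sum>n<N. e\<^sup>-\<^sup>i\<^sup>n\<^sup>x C\<^sup>n \<phi>\<close> over \<open>2 \<pi> N\<close>.\<close>

definition fejer :: "nat \<Rightarrow> real \<Rightarrow> real" where
  "fejer N x = Re (\<Sum>m<N. \<Sum>n<N. cis (of_int (int n - int m) * x) *
     cinner ((C ^^ m) \<phi>) ((C ^^ n) \<phi>)) / (2 * pi * real N)"

text \<open>The double sum is a squared norm, so the density is nonnegative and the
  \<open>Re\<close> in its definition only changes the type.\<close>

lemma fejer_sum:
  "(\<Sum>m<N. \<Sum>n<N. cis (of_int (int n - int m) * x) * cinner ((C ^^ m) \<phi>) ((C ^^ n) \<phi>))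
    = complex_of_real ((norm (\<Sum>n<N. cis (- real n * x) *\<^sub>C (C ^^ n) \<phi>))\<^sup>2)"
proof -
  have "cis (of_int (int n - int m) * x) = cis (- real m * x) * cnj (cis (- real n * x))" for m n
    by (simp add: cis_cnj cis_mult algebra_simps)
  then show ?thesis
    unfolding cinner_self[symmetric] cinner_sum_left cinner_sum_right
    by (subst sum.swap) (simp add: cinner_scaleC_left cinner_scaleC_right mult_ac)
qed

lemma fejer_nonneg: "0 \<le> fejer N x"
  unfolding fejer_def fejer_sum by simp

lemma fejer_complex:
  "complex_of_real (fejer N x) = (\<Sum>m<N. \<Sum>n<N. cis (of_int (int n - int m) * x) *
     cinner ((C ^^ m) \<phi>) ((C ^^ n) \<phi>)) / complex_of_real (2 * pi * real N)"
  unfolding fejer_def fejer_sum by simp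

lemma fejer_measurable [measurable]: "fejer N \<in> borel_measurable borel"
  unfolding fejer_def divide_inverse by (intro borel_measurable_continuous_onI continuous_intros)

text \<open>By orthogonality of the characters only the pairs with m = n + k survive. There are N -
  k of them, and by isometry each carries the same inner product.\<close>

lemma integral_fejer:
  assumes "k \<le> N" "0 < N"
  shows "integrable lborel (\<lambda>x. (indicator {0..2 * pi} x * fejer N x) *\<^sub>R cis (real k * x))"
    and "(LBINT x. (indicator {0..2 * pi} x * fejer N x) *\<^sub>R cis (real k * x))
      = of_real (real (N - k) / real N) * cinner ((C ^^ k) \<phi>) \<phi>"
proof -
  let ?G = "\<lambda>m n. cinner ((C ^^ m) \<phi>) ((C ^^ n) \<phi>)"
  define f where "f j x = indicator {0..2 * pi} x *\<^sub>R cis (of_int j * x)" for j x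
  have eq: "(indicator {0..2 * pi} x * fejer N x) *\<^sub>R cis (real k * x)
      = (\<Sum>m<N. \<Sum>n<N. f (int n + int k - int m) x *
          (?G m n / complex_of_real (2 * pi * real N)))" for x
  proof -
    have "(indicator {0..2 * pi} x * fejer N x) *\<^sub>R cis (real k * x)
        = complex_of_real (indicator {0..2 * pi} x) * (complex_of_real (fejer N x) * cis (real k * x))"
      by (simp add: scaleR_conv_of_real)
    also have "\<dots> = (\<Sum>m<N. \<Sum>n<N. complex_of_real (indicator {0..2 * pi} x) *
        ((cis (of_int (int n - int m) * x) * ?G m n) / complex_of_real (2 * pi * real N) * cis (real k * x)))"
      unfolding fejer_complex by (simp only: sum_divide_distrib sum_distrib_left sum_distrib_right)
    also have "\<dots> = (\<Sum>m<N. \<Sum>n<N. f (int n + int k - int m) x *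
          (?G m n / complex_of_real (2 * pi * real N)))"
    proof (intro sum.cong refl)
      fix m n
      have "cis (of_int (int n + int k - int m) * x) = cis (of_int (int n - int m) * x) * cis (real k * x)"
        by (simp add: cis_mult algebra_simps)
      then show "complex_of_real (indicator {0..2 * pi} x) *
        ((cis (of_int (int n - int m) * x) * ?G m n) / complex_of_real (2 * pi * real N) * cis (real k * x))
        = f (int n + int k - int m) x *
          (?G m n / complex_of_real (2 * pi * real N))"
        by (simp add: f_def scaleR_conv_of_real)
    qed
    finally show ?thesis .
  qed
  have int: "integrable lborel (f j)" and val: "integral\<^sup>L lborel (f j) = (if j = 0 then complex_of_real (2 * pi) else 0)" for j
    unfolding f_def integral_cis_period
    by (rule borel_integrable_compact) (auto intro!: continuous_intros)
  show "integrable lborel (\<lambda>x. (indicator {0..2 * pi} x * fejer N x) *\<^sub>R cis (real k * x))"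
    unfolding eq by (intro Bochner_Integration.integrable_sum integrable_mult_left int)
  have "(LBINT x. (indicator {0..2 * pi} x * fejer N x) *\<^sub>R cis (real k * x))
      = (\<Sum>m<N. \<Sum>n<N. (if int n + int k - int m = 0 then complex_of_real (2 * pi) else 0) *
          (?G m n / complex_of_real (2 * pi * real N)))"
    unfolding eq by (simp add: Bochner_Integration.integral_sum int val)
  also have "\<dots> = (\<Sum>n<N. \<Sum>m<N. if m = n + k then ?G m n / real N else 0)"
    by (subst sum.swap) (auto intro!: sum.cong)
  \<comment> \<open>The index m = n + k must stay below N, which leaves exactly the n below N -
    k.\<close>
  also have "\<dots> = (\<Sum>n<N. if n < N - k then ?G k 0 / real N else 0)"
    using C_funpow_cinner[of k _ 0] by (intro sum.cong refl) (auto simp: add.commute)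
  also have "\<dots> = (\<Sum>n<N - k. ?G k 0 / real N)"
    by (intro sum.mono_neutral_cong_right) auto
  finally show "(LBINT x. (indicator {0..2 * pi} x * fejer N x) *\<^sub>R cis (real k * x))
      = of_real (real (N - k) / real N) * cinner ((C ^^ k) \<phi>) \<phi>"
    by simp
qed

text \<open>The shift to \<open>Suc N\<close> excludes the empty sum, whose density would be 0
  instead of having total mass 1.\<close>

definition fejer_measure :: "nat \<Rightarrow> real measure" where
  "fejer_measure N = density lborel (\<lambda>x. ennreal (indicator {0..2 * pi} x * fejer (Suc N) x))"

lemma real_distribution_fejer_measure: "real_distribution (fejer_measure N)"
proof -
  have int: "integrable lborel (\<lambda>x. complex_of_real (indicator {0..2 * pi} x * fejer (Suc N) x))"
    and val: "(LBINT x. complex_of_real (indicator {0..2 * pi} x * fejer (Suc N) x)) = 1"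
    using integral_fejer[of 0 "Suc N"] by (simp_all add: cinner_self norm_\<phi> scaleR_conv_of_real)
  have int': "integrable lborel (\<lambda>x. indicator {0..2 * pi} x * fejer (Suc N) x)"
    and val': "(LBINT x. indicator {0..2 * pi} x * fejer (Suc N) x) = 1"
    using integrable_Re[OF int] arg_cong[OF val, of Re] integral_Re[OF int] by simp_all
  have "emeasure (fejer_measure N) UNIV = 1"
    using nn_integral_eq_integral[OF int'] val'
    by (simp add: fejer_measure_def emeasure_density fejer_nonneg)
  then have "prob_space (fejer_measure N)"
    by (intro prob_spaceI) (simp add: fejer_measure_def)
  then show ?thesis
    by (simp add: real_distribution_def real_distribution_axioms_def fejer_measure_def)
qed

lemma integral_fejer_measure:
  assumes "k \<le> Suc N"
  shows "(LINT x|fejer_measure N. cis (real k * x))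
    = of_real (real (Suc N - k) / real (Suc N)) * cinner ((C ^^ k) \<phi>) \<phi>"
  unfolding fejer_measure_def
  by (subst integral_density)
    (use integral_fejer(2)[OF assms] fejer_nonneg in \<open>auto intro!: borel_measurable_continuous_onI continuous_intros\<close>)

lemma tight_fejer_measure: "tight fejer_measure"
  unfolding tight_def
proof (intro conjI allI impI real_distribution_fejer_measure)
  fix e :: real assume "0 < e"
  \<comment> \<open>All measures live on [0, 2 pi]; the left end -1 keeps 0 inside the half-open
    interval.\<close>
  have "measure (fejer_measure n) {-1<..2 * pi} = 1" for n
  proof -
    interpret real_distribution "fejer_measure n"
      by (rule real_distribution_fejer_measure)
    have "AE x in fejer_measure n. x \<in> {-1<..2 * pi}"
      unfolding fejer_measure_def by (subst AE_density) (auto intro!: AE_I2 simp: indicator_def)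
    then show ?thesis
      by (subst prob_eq_1) auto
  qed
  then show "\<exists>a b. a < b \<and> (\<forall>n. 1 - e < measure (fejer_measure n) {a<..b})"
    using \<open>0 < e\<close> pi_gt_zero by (intro exI[of _ "-1"] exI[of _ "2 * pi"]) (auto intro: less_trans[of _ 0])
qed

text \<open>Helly selection gives a weak limit along a subsequence; integrals of the bounded
  continuous functions cis (k x) pass to the limit, and the weights (N - k) / N tend to 1. The
  points 0 and 2 pi, both over the point 1 of the circle, may still carry mass here.\<close>

lemma moment_measure_exists:
  "\<exists>M. real_distribution M \<and> (\<forall>k. (LINT x|M. cis (real k * x)) = cinner ((C ^^ k) \<phi>) \<phi>)"
proof -
  from tight_imp_convergent_subsubsequence[OF tight_fejer_measure, of id]
  obtain r M where r: "strict_mono r" and M: "real_distribution M"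
    and w: "weak_conv_m (fejer_measure \<circ> r) M"
    by (auto simp: strict_mono_def)
  have "(LINT x|M. cis (real k * x)) = cinner ((C ^^ k) \<phi>) \<phi>" for k
  proof (rule LIMSEQ_unique)
    show "(\<lambda>n. LINT x|(fejer_measure \<circ> r) n. cis (real k * x)) \<longlonglongrightarrow> (LINT x|M. cis (real k * x))"
      by (rule weak_conv_imp_integral_bdd_continuous_conv[OF _ M w, where B = 1])
        (auto intro!: real_distribution_fejer_measure isCont_cis_mult)
    have "(\<lambda>n. complex_of_real (real (Suc n - k) / real (Suc n))) \<longlonglongrightarrow> complex_of_real 1"
    proof (rule tendsto_of_real)
      have "(\<lambda>n. 1 - real k * inverse (real (Suc n))) \<longlonglongrightarrow> 1 - real k * 0"
        by (intro tendsto_intros LIMSEQ_inverse_real_of_nat)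
      moreover have "\<forall>\<^sub>F n in sequentially. 1 - real k * inverse (real (Suc n)) = real (Suc n - k) / real (Suc n)"
        using eventually_ge_at_top[of k] by eventually_elim (auto simp: of_nat_diff field_simps)
      ultimately show "(\<lambda>n. real (Suc n - k) / real (Suc n)) \<longlonglongrightarrow> 1"
        by (simp add: tendsto_cong)
    qed
    then have "(\<lambda>n. of_real (real (Suc n - k) / real (Suc n)) * cinner ((C ^^ k) \<phi>) \<phi>)
        \<longlonglongrightarrow> of_real 1 * cinner ((C ^^ k) \<phi>) \<phi>"
      by (intro tendsto_mult tendsto_const)
    moreover have "\<forall>\<^sub>F n in sequentially. of_real (real (Suc n - k) / real (Suc n)) * cinner ((C ^^ k) \<phi>) \<phi>
        = (LINT x|fejer_measure n. cis (real k * x))"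
      using eventually_ge_at_top[of k] by eventually_elim (simp add: integral_fejer_measure)
    ultimately have "(\<lambda>n. LINT x|fejer_measure n. cis (real k * x)) \<longlonglongrightarrow> cinner ((C ^^ k) \<phi>) \<phi>"
      by (simp add: tendsto_cong)
    from LIMSEQ_subseq_LIMSEQ[OF this r]
    show "(\<lambda>n. LINT x|(fejer_measure \<circ> r) n. cis (real k * x)) \<longlonglongrightarrow> cinner ((C ^^ k) \<phi>) \<phi>"
      by (simp add: comp_def)
  qed
  with M show ?thesis by blast
qed

end

section \<open>From square integrable functions on the circle to vectors of the orbit\<close>

locale spectral_orbit = isometric_orbit C \<phi> + real_distribution M
  for C :: "'a::complex_hilbert \<Rightarrow> 'a" and \<phi> :: 'a and M :: "real measure" +
  assumes moments: "(LINT x|M. cis (real k * x)) = cinner ((C ^^ k) \<phi>) \<phi>"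
begin

lemma borel_measurable_M: "f \<in> borel_measurable borel \<Longrightarrow> f \<in> borel_measurable M"
  by simp

lemma cis_measurable [measurable]: "cis \<in> borel_measurable M"
  by (intro borel_measurable_M borel_measurable_continuous_onI continuous_intros)

lemma cnj_cis_measurable [measurable]: "(\<lambda>x. cnj (cis x)) \<in> borel_measurable M"
  by (intro borel_measurable_M borel_measurable_continuous_onI continuous_intros)

lemma integrable_bounded:
  fixes f :: "real \<Rightarrow> 'b::{banach, second_countable_topology}"
  shows "f \<in> borel_measurable M \<Longrightarrow> (\<And>x. norm (f x) \<le> B) \<Longrightarrow> integrable M f"
  by (rule integrable_const_bound[where B = B]) auto

lemma integral_cis_powers:
  "(LINT x|M. cis x ^ m * cnj (cis x ^ n)) = cinner ((C ^^ m) \<phi>) ((C ^^ n) \<phi>)"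
proof -
  have le: "(LINT x|M. cis x ^ m * cnj (cis x ^ n)) = cinner ((C ^^ m) \<phi>) ((C ^^ n) \<phi>)" if "n \<le> m" for m n
  proof -
    have "cis x ^ m * cnj (cis x ^ n) = cis (real (m - n) * x)" for x
      using that by (simp only: Complex.DeMoivre cis_cnj cis_mult) (simp add: of_nat_diff algebra_simps)
    then show ?thesis
      using moments[of "m - n"] C_funpow_cinner[of "m - n" n 0] that by simp
  qed
  show ?thesis
  proof (cases "n \<le> m")
    case False
    have "(LINT x|M. cis x ^ m * cnj (cis x ^ n)) = (LINT x|M. cnj (cis x ^ n * cnj (cis x ^ m)))"
      by (simp add: mult.commute)
    also have "\<dots> = cnj (LINT x|M. cis x ^ n * cnj (cis x ^ m))"
      by (rule Bochner_Integration.integral_cnj)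
    also have "\<dots> = cinner ((C ^^ m) \<phi>) ((C ^^ n) \<phi>)"
      using le[of m n] False cinner_commute[of "(C ^^ m) \<phi>" "(C ^^ n) \<phi>"] by simp
    finally show ?thesis .
  qed (rule le)
qed

text \<open>The map sending a polynomial in \<open>cis x\<close> to the same polynomial in
  \<open>C\<close> applied to \<phi> preserves the norm of L2(M). All later facts about M come from
  this isometry.\<close>

lemma norm_orbit_sum:
  assumes "finite I"
  shows "(norm (\<Sum>n\<in>I. a n *\<^sub>C (C ^^ n) \<phi>))\<^sup>2 = (LINT x|M. (cmod (\<Sum>n\<in>I. a n * cis x ^ n))\<^sup>2)"
proof -
  have int: "integrable M (\<lambda>x. cis x ^ m * cnj (cis x ^ n))" for m n
    by (rule integrable_bounded[where B = 1]) (auto simp: norm_mult norm_power)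
  have "complex_of_real ((norm (\<Sum>n\<in>I. a n *\<^sub>C (C ^^ n) \<phi>))\<^sup>2)
      = (\<Sum>m\<in>I. \<Sum>n\<in>I. a m * cnj (a n) * cinner ((C ^^ m) \<phi>) ((C ^^ n) \<phi>))"
    unfolding cinner_self[symmetric] cinner_sum_left cinner_sum_right
    by (subst sum.swap) (simp add: cinner_scaleC_left cinner_scaleC_right mult_ac)
  also have "\<dots> = (LINT x|M. (\<Sum>m\<in>I. \<Sum>n\<in>I. a m * cnj (a n) * (cis x ^ m * cnj (cis x ^ n))))"
    unfolding integral_cis_powers[symmetric] using int
    by (simp add: Bochner_Integration.integral_sum)
  also have "\<dots> = (LINT x|M. complex_of_real ((cmod (\<Sum>n\<in>I. a n * cis x ^ n))\<^sup>2))"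
    unfolding complex_norm_square cnj_sum sum_product
    by (simp add: mult_ac)
  also have "\<dots> = complex_of_real (LINT x|M. (cmod (\<Sum>n\<in>I. a n * cis x ^ n))\<^sup>2)"
    by (rule integral_complex_of_real)
  finally show ?thesis
    using of_real_eq_iff by blast
qed

text \<open>Extends the isometry to dominated limits: the polynomials converge in L2(M), so their
  images are Cauchy. The coefficients may change with N, as averages of partial sums
  require.\<close>

lemma orbit_sum_limit:
  fixes a :: "nat \<Rightarrow> nat \<Rightarrow> complex"
  defines "P \<equiv> \<lambda>N x. \<Sum>n<N. a N n * cis x ^ n"
    and "X \<equiv> \<lambda>N. \<Sum>n<N. a N n *\<^sub>C (C ^^ n) \<phi>"
  assumes h [measurable]: "h \<in> borel_measurable M"
    and lim: "AE x in M. (\<lambda>N. P N x) \<longlonglongrightarrow> h x"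
    and bound: "\<And>N. AE x in M. cmod (P N x) \<le> g x"
    and g: "integrable M (\<lambda>x. (g x)\<^sup>2)"
  shows "\<exists>\<psi>. X \<longlonglongrightarrow> \<psi> \<and> (norm \<psi>)\<^sup>2 = (LINT x|M. (cmod (h x))\<^sup>2)"
proof -
  have [measurable]: "P N \<in> borel_measurable M" for N
    unfolding P_def by measurable
  have bound_all: "AE x in M. \<forall>N. cmod (P N x) \<le> g x"
    using bound by (simp add: AE_all_countable)
  have h_le: "AE x in M. cmod (h x) \<le> g x"
    using lim bound_all
  proof eventually_elim
    case (elim x)
    then show ?case
      by (intro LIMSEQ_le_const2[OF tendsto_norm]) auto
  qed
  have sq_le: "(cmod (u - v))\<^sup>2 \<le> 2 * (cmod u)\<^sup>2 + 2 * (cmod v)\<^sup>2" for u v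
  proof -
    have "(cmod (u - v))\<^sup>2 \<le> (cmod u + cmod v)\<^sup>2"
      by (intro power_mono norm_triangle_ineq4) simp
    also have "\<dots> \<le> 2 * (cmod u)\<^sup>2 + 2 * (cmod v)\<^sup>2"
      using zero_le_power2[of "cmod u - cmod v"] by (simp add: power2_eq_square algebra_simps)
    finally show ?thesis .
  qed
  have sq_P: "AE x in M. \<forall>N. (cmod (P N x))\<^sup>2 \<le> (g x)\<^sup>2"
    using bound_all by eventually_elim (auto intro: power_mono)
  have sq_h: "AE x in M. (cmod (h x))\<^sup>2 \<le> (g x)\<^sup>2"
    using h_le by eventually_elim (auto intro: power_mono)
  have sq_d: "AE x in M. \<forall>N. (cmod (P N x - h x))\<^sup>2 \<le> 4 * (g x)\<^sup>2"
    using sq_P sq_h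
  proof eventually_elim
    case (elim x)
    then show ?case
      using order_trans[OF sq_le[of "P N x" "h x" for N]] by (smt (verit))
  qed
  define d where "d N = (LINT x|M. (cmod (P N x - h x))\<^sup>2)" for N
  have int_d: "integrable M (\<lambda>x. (cmod (P N x - h x))\<^sup>2)" for N
    by (rule Bochner_Integration.integrable_bound[of M "\<lambda>x. 4 * (g x)\<^sup>2"]) (use g sq_d in auto)
  have "d \<longlonglongrightarrow> (LINT x|M. 0)"
    unfolding d_def
  proof (rule integral_dominated_convergence[where w = "\<lambda>x. 4 * (g x)\<^sup>2"])
    show "AE x in M. (\<lambda>N. (cmod (P N x - h x))\<^sup>2) \<longlonglongrightarrow> 0"
      using lim
    proof eventually_elim
      case (elim x)
      then have "(\<lambda>N. (cmod (P N x - h x))\<^sup>2) \<longlonglongrightarrow> (cmod (h x - h x))\<^sup>2"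
        by (intro tendsto_intros)
      then show ?case by simp
    qed
  qed (use g sq_d in auto)
  then have d0: "d \<longlonglongrightarrow> 0"
    by simp
  have diff: "(norm (X N - X N'))\<^sup>2 \<le> 2 * d N + 2 * d N'" for N N'
  proof -
    define K where "K = max N N'"
    \<comment> \<open>Coefficients padded with zeros, so that two polynomials of different length
      can be subtracted term by term.\<close>
    define b where "b L n = (if n < L then a L n else 0)" for L n
    have X_eq: "X L = (\<Sum>n<K. b L n *\<^sub>C (C ^^ n) \<phi>)" if "L \<le> K" for L
      unfolding X_def b_def using that by (intro sum.mono_neutral_cong_left) auto
    have P_eq: "P L x = (\<Sum>n<K. b L n * cis x ^ n)" if "L \<le> K" for L x
      unfolding P_def b_def using that by (intro sum.mono_neutral_cong_left) auto
    have K: "N \<le> K" "N' \<le> K"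
      by (auto simp: K_def)
    have "X N - X N' = (\<Sum>n<K. (b N n - b N' n) *\<^sub>C (C ^^ n) \<phi>)"
      by (simp add: X_eq K scaleC_diff_left sum_subtractf)
    moreover have "P N x - P N' x = (\<Sum>n<K. (b N n - b N' n) * cis x ^ n)" for x
      by (simp add: P_eq K sum_subtractf algebra_simps)
    ultimately have "(norm (X N - X N'))\<^sup>2 = (LINT x|M. (cmod (P N x - P N' x))\<^sup>2)"
      by (simp add: norm_orbit_sum)
    also have "\<dots> \<le> (LINT x|M. 2 * (cmod (P N x - h x))\<^sup>2 + 2 * (cmod (P N' x - h x))\<^sup>2)"
    proof (rule integral_mono')
      show "integrable M (\<lambda>x. 2 * (cmod (P N x - h x))\<^sup>2 + 2 * (cmod (P N' x - h x))\<^sup>2)"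
        using int_d by simp
      show "(cmod (P N x - P N' x))\<^sup>2 \<le> 2 * (cmod (P N x - h x))\<^sup>2 + 2 * (cmod (P N' x - h x))\<^sup>2" for x
        using sq_le[of "P N x - h x" "P N' x - h x"] by simp
    qed simp
    also have "\<dots> = 2 * d N + 2 * d N'"
      unfolding d_def using int_d by simp
    finally show ?thesis .
  qed
  have "Cauchy X"
  proof (rule CauchyI)
    fix e :: real assume "0 < e"
    then have "0 < e\<^sup>2 / 4" by simp
    from order_tendstoD(2)[OF d0 this] obtain K where K: "\<And>N. K \<le> N \<Longrightarrow> d N < e\<^sup>2 / 4"
      unfolding eventually_sequentially by blast
    have "norm (X N - X N') < e" if "K \<le> N" "K \<le> N'" for N N'
    proof -
      have "(norm (X N - X N'))\<^sup>2 < e\<^sup>2"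
        using diff[of N N'] K[OF that(1)] K[OF that(2)] by linarith
      then show ?thesis
        using \<open>0 < e\<close> by (simp add: power_less_imp_less_base)
    qed
    then show "\<exists>K. \<forall>N\<ge>K. \<forall>N'\<ge>K. norm (X N - X N') < e"
      by blast
  qed
  then obtain \<psi> where \<psi>: "X \<longlonglongrightarrow> \<psi>"
    using Cauchy_convergent_iff convergent_def by blast
  have "(\<lambda>N. (norm (X N))\<^sup>2) \<longlonglongrightarrow> (LINT x|M. (cmod (h x))\<^sup>2)"
    unfolding X_def norm_orbit_sum[OF finite_lessThan]
  proof (rule integral_dominated_convergence[where w = "\<lambda>x. (g x)\<^sup>2"])
    show "AE x in M. (\<lambda>N. (cmod (\<Sum>n<N. a N n * cis x ^ n))\<^sup>2) \<longlonglongrightarrow> (cmod (h x))\<^sup>2"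
      using lim unfolding P_def by eventually_elim (intro tendsto_intros)
    show "AE x in M. norm ((cmod (\<Sum>n<N. a N n * cis x ^ n))\<^sup>2) \<le> (g x)\<^sup>2" for N
      using sq_P unfolding P_def by eventually_elim simp
  qed (use g in auto)
  moreover have "(\<lambda>N. (norm (X N))\<^sup>2) \<longlonglongrightarrow> (norm \<psi>)\<^sup>2"
    by (intro tendsto_intros \<psi>)
  ultimately show ?thesis
    using \<psi> LIMSEQ_unique by blast
qed

lemma of_nat_diff_Suc: "j < N \<Longrightarrow> (of_nat (N - j) :: complex) = of_nat (N - 1 - j) + 1"
  using of_nat_Suc[of "N - 1 - j", where ?'a = complex] by (simp add: Suc_diff_Suc del: of_nat_Suc)

text \<open>The sum is the total of the partial sums of the geometric series. Divided by N, the
  identity shows that these Cesaro means approximate 1 / (1 - z) on the unit circle, up to an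
  average of powers.\<close>

lemma cesaro_identity: "(1 - z) * (\<Sum>j<N. of_nat (N - 1 - j) * z ^ j) = of_nat N - (\<Sum>k<N. (z::complex) ^ k)"
proof (induction N)
  case (Suc N)
  have "(\<Sum>j<Suc N. of_nat (Suc N - 1 - j) * z ^ j) = (\<Sum>j<N. of_nat (N - j) * z ^ j)"
    by simp
  also have "\<dots> = (\<Sum>j<N. of_nat (N - 1 - j) * z ^ j + z ^ j)"
    by (intro sum.cong refl, subst of_nat_diff_Suc) (simp_all only: lessThan_iff distrib_right mult_1)
  finally have eq: "(\<Sum>j<Suc N. of_nat (Suc N - 1 - j) * z ^ j)
      = (\<Sum>j<N. of_nat (N - 1 - j) * z ^ j) + (\<Sum>k<N. z ^ k)"
    by (simp only: sum.distrib)
  show ?case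
    unfolding eq distrib_left Suc.IH one_diff_power_eq[symmetric] by simp
qed simp

lemma C_telescope: "C (\<Sum>n<N. (C ^^ n) \<phi>) - (\<Sum>n<N. (C ^^ n) \<phi>) = (C ^^ N) \<phi> - \<phi>"
  by (induction N) (simp_all add: C.add algebra_simps)

text \<open>The counterpart of \<open>cesaro_identity\<close> on the orbit: the same induction with
  \<open>C\<close> for z, applied to \<phi>.\<close>

lemma cesaro_identity_C:
  "(\<Sum>j<N. of_nat (N - 1 - j) *\<^sub>C (C ^^ j) \<phi>) - C (\<Sum>j<N. of_nat (N - 1 - j) *\<^sub>C (C ^^ j) \<phi>)
    = of_nat N *\<^sub>C \<phi> - (\<Sum>k<N. (C ^^ k) \<phi>)"
proof (induction N)
  case (Suc N)
  have eq: "(\<Sum>j<Suc N. of_nat (Suc N - 1 - j) *\<^sub>C (C ^^ j) \<phi>)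
      = (\<Sum>j<N. of_nat (N - 1 - j) *\<^sub>C (C ^^ j) \<phi>) + (\<Sum>j<N. (C ^^ j) \<phi>)"
  proof -
    have "(\<Sum>j<Suc N. of_nat (Suc N - 1 - j) *\<^sub>C (C ^^ j) \<phi>) = (\<Sum>j<N. of_nat (N - j) *\<^sub>C (C ^^ j) \<phi>)"
      by simp
    also have "\<dots> = (\<Sum>j<N. of_nat (N - 1 - j) *\<^sub>C (C ^^ j) \<phi> + (C ^^ j) \<phi>)"
      by (intro sum.cong refl, subst of_nat_diff_Suc) (simp_all only: lessThan_iff scaleC_add_left scaleC_one)
    finally show ?thesis
      by (simp only: sum.distrib)
  qed
  have tel: "(\<Sum>j<N. (C ^^ j) \<phi>) - C (\<Sum>j<N. (C ^^ j) \<phi>) = \<phi> - (C ^^ N) \<phi>"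
    using C_telescope[of N] by (metis minus_diff_eq)
  let ?S = "\<Sum>j<N. of_nat (N - 1 - j) *\<^sub>C (C ^^ j) \<phi>" and ?A = "\<Sum>j<N. (C ^^ j) \<phi>"
  have "?S + ?A - C (?S + ?A) = (?S - C ?S) + (?A - C ?A)"
    by (simp add: C.add)
  then show ?case
    unfolding eq Suc.IH tel by (simp add: scaleC_add_left scaleC_one)
qed simp

lemma norm_average_le_1: "cmod (z::complex) = 1 \<Longrightarrow> cmod ((\<Sum>n<N. z ^ n) / of_nat N) \<le> 1"
proof -
  assume "cmod z = 1"
  then have "cmod (\<Sum>n<N. z ^ n) \<le> real N"
    using norm_sum[of "\<lambda>n. z ^ n" "{..<N}"] by (simp add: norm_power)
  then show ?thesis
    by (cases "N = 0") (simp_all add: norm_divide divide_le_eq_1)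
qed

lemma average_tendsto_0:
  assumes "cmod (z::complex) = 1" "z \<noteq> 1"
  shows "(\<lambda>N. (\<Sum>n<N. z ^ n) / of_nat N) \<longlonglongrightarrow> 0"
proof (rule Lim_null_comparison)
  show "\<forall>\<^sub>F N in sequentially. cmod ((\<Sum>n<N. z ^ n) / of_nat N) \<le> 2 / cmod (1 - z) * (1 / real N)"
  proof (rule always_eventually, rule allI)
    fix N
    have "(\<Sum>n<N. z ^ n) = (1 - z ^ N) / (1 - z)"
      using assms(2) one_diff_power_eq[of z N] by (simp add: field_simps)
    moreover have "cmod (1 - z ^ N) \<le> 2"
      using norm_triangle_ineq4[of 1 "z ^ N"] assms(1) by (simp add: norm_power)
    ultimately show "cmod ((\<Sum>n<N. z ^ n) / of_nat N) \<le> 2 / cmod (1 - z) * (1 / real N)"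
      by (simp add: norm_divide norm_mult divide_right_mono)
  qed
  show "(\<lambda>N. 2 / cmod (1 - z) * (1 / real N)) \<longlonglongrightarrow> 0"
    by (intro tendsto_mult_right_zero lim_1_over_n)
qed

text \<open>The averages of powers of \<open>cis x\<close> tend boundedly to the indicator of
  \<open>cis x = 1\<close>, so the averages of the orbit converge to some \<psi> whose squared norm
  is the mass of that set. Telescoping makes \<psi> a fixed vector, so \<psi> and the mass both
  vanish.\<close>

lemma mean_ergodic:
  assumes fixed: "\<And>\<psi>. C \<psi> = \<psi> \<Longrightarrow> \<psi> = 0"
  shows "(\<lambda>N. (1 / of_nat N) *\<^sub>C (\<Sum>n<N. (C ^^ n) \<phi>)) \<longlonglongrightarrow> 0" and "AE x in M. cis x \<noteq> 1"
proof -
  let ?X = "\<lambda>N. \<Sum>n<N. (1 / of_nat N) *\<^sub>C (C ^^ n) \<phi>"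
  let ?h = "\<lambda>x. if cis x = 1 then 1 else 0 :: complex"
  have [measurable]: "{x. cis x = 1} \<in> sets borel"
    by (intro borel_closed closed_Collect_eq continuous_intros)
  have h_meas: "?h \<in> borel_measurable M"
    by (intro borel_measurable_M) measurable
  have "\<exists>\<psi>. ?X \<longlonglongrightarrow> \<psi> \<and> (norm \<psi>)\<^sup>2 = (LINT x|M. (cmod (?h x))\<^sup>2)"
  proof (rule orbit_sum_limit[where g = "\<lambda>_. 1"])
    have "(\<lambda>N. \<Sum>n<N. 1 / of_nat N * cis x ^ n) \<longlonglongrightarrow> ?h x" for x
    proof (cases "cis x = 1")
      case True
      have "\<forall>\<^sub>F N in sequentially. (\<Sum>n<N. 1 / of_nat N * cis x ^ n) = 1"
        using eventually_gt_at_top[of 0] by eventually_elim (simp add: True)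
      then show ?thesis
        using True by (simp add: tendsto_eventually)
    next
      case False
      then show ?thesis
        using average_tendsto_0[of "cis x"] by (simp add: sum_divide_distrib)
    qed
    then show "AE x in M. (\<lambda>N. \<Sum>n<N. 1 / of_nat N * cis x ^ n) \<longlonglongrightarrow> ?h x"
      by simp
    show "AE x in M. cmod (\<Sum>n<N. 1 / of_nat N * cis x ^ n) \<le> 1" for N
      using norm_average_le_1[of "cis _" N] by (simp add: sum_divide_distrib)
  qed (use h_meas in auto)
  then obtain \<psi> where \<psi>: "?X \<longlonglongrightarrow> \<psi>" "(norm \<psi>)\<^sup>2 = (LINT x|M. (cmod (?h x))\<^sup>2)"
    by blast
  have "(\<lambda>N. C (?X N) - ?X N) \<longlonglongrightarrow> 0"
  proof (rule Lim_null_comparison)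
    show "(\<lambda>N. 2 * (1 / real N)) \<longlonglongrightarrow> 0"
      by (intro tendsto_mult_right_zero lim_1_over_n)
    show "\<forall>\<^sub>F N in sequentially. norm (C (?X N) - ?X N) \<le> 2 * (1 / real N)"
    proof (rule always_eventually, rule allI)
      fix N
      have "C (?X N) - ?X N = (1 / of_nat N) *\<^sub>C ((C ^^ N) \<phi> - \<phi>)"
      proof -
        have "?X N = (1 / of_nat N) *\<^sub>C (\<Sum>n<N. (C ^^ n) \<phi>)"
          by (simp add: complex_vector.scale_sum_right)
        then show ?thesis
          by (simp only: C_scaleC C_telescope flip: scaleC_diff_right)
      qed
      moreover have "norm ((C ^^ N) \<phi> - \<phi>) \<le> 2"
        using norm_triangle_ineq4[of "(C ^^ N) \<phi>" \<phi>] by (simp add: norm_C_funpow norm_\<phi>)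
      ultimately show "norm (C (?X N) - ?X N) \<le> 2 * (1 / real N)"
        by (simp add: norm_scaleC norm_divide divide_right_mono)
    qed
  qed
  moreover have "(\<lambda>N. C (?X N) - ?X N) \<longlonglongrightarrow> C \<psi> - \<psi>"
    by (intro tendsto_diff C.tendsto \<psi>)
  ultimately have "C \<psi> - \<psi> = 0"
    using LIMSEQ_unique by blast
  then have "\<psi> = 0"
    using fixed by simp
  then show "(\<lambda>N. (1 / of_nat N) *\<^sub>C (\<Sum>n<N. (C ^^ n) \<phi>)) \<longlonglongrightarrow> 0"
    using \<psi>(1) by (simp add: complex_vector.scale_sum_right)
  have "(LINT x|M. (cmod (?h x))\<^sup>2) = (LINT x|M. indicator {x. cis x = 1} x)"
    by (intro Bochner_Integration.integral_cong) auto
  also have "\<dots> = prob {x. cis x = 1}"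
    by simp
  finally have "prob {x. cis x = 1} = 0"
    using \<psi>(2) \<open>\<psi> = 0\<close> by simp
  then show "AE x in M. cis x \<noteq> 1"
    by (intro AE_I[where N = "{x. cis x = 1}"]) (auto simp: emeasure_eq_measure)
qed

text \<open>The Cesaro means tend to 1 / (1 - cis x) under the square integrable bound 2 / |1 - cis
  x|, so their images converge to some \<psi>. The remainder in \<psi> - C \<psi> = \<phi> is an
  ergodic average and disappears. The contrapositive later gives the infinite mass.\<close>

lemma in_range_one_minus_C:
  assumes fixed: "\<And>\<psi>. C \<psi> = \<psi> \<Longrightarrow> \<psi> = 0"
    and int: "integrable M (\<lambda>x. 1 / (cmod (1 - cis x))\<^sup>2)"
  shows "\<exists>\<psi>. \<psi> - C \<psi> = \<phi>"
proof -
  let ?X = "\<lambda>N. \<Sum>n<N. (of_nat (N - 1 - n) / of_nat N) *\<^sub>C (C ^^ n) \<phi>"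
  let ?P = "\<lambda>N x. \<Sum>n<N. of_nat (N - 1 - n) / of_nat N * cis x ^ n"
  have P: "?P N x = (1 - (\<Sum>k<N. cis x ^ k) / of_nat N) / (1 - cis x)" if "cis x \<noteq> 1" "0 < N" for N x
  proof -
    have "?P N x = (\<Sum>j<N. of_nat (N - 1 - j) * cis x ^ j) / of_nat N"
      by (simp add: sum_divide_distrib)
    also have "(\<Sum>j<N. of_nat (N - 1 - j) * cis x ^ j) = (of_nat N - (\<Sum>k<N. cis x ^ k)) / (1 - cis x)"
      using cesaro_identity[of "cis x" N] that by (simp add: field_simps)
    finally show ?thesis
      using that by (simp add: diff_divide_distrib mult.commute)
  qed
  have ne: "AE x in M. cis x \<noteq> 1"
    by (rule mean_ergodic(2)[OF fixed])
  have "\<exists>\<psi>. ?X \<longlonglongrightarrow> \<psi> \<and> (norm \<psi>)\<^sup>2 = (LINT x|M. (cmod (1 / (1 - cis x)))\<^sup>2)"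
  proof (rule orbit_sum_limit[where g = "\<lambda>x. 2 / cmod (1 - cis x)"])
    show "(\<lambda>x. 1 / (1 - cis x)) \<in> borel_measurable M"
      by measurable
    show "AE x in M. (\<lambda>N. ?P N x) \<longlonglongrightarrow> 1 / (1 - cis x)"
      using ne
    proof eventually_elim
      case (elim x)
      have "(\<lambda>N. (1 - (\<Sum>k<N. cis x ^ k) / of_nat N) / (1 - cis x)) \<longlonglongrightarrow> (1 - 0) / (1 - cis x)"
        using elim by (intro tendsto_intros average_tendsto_0) auto
      moreover have "\<forall>\<^sub>F N in sequentially. ?P N x = (1 - (\<Sum>k<N. cis x ^ k) / of_nat N) / (1 - cis x)"
        using eventually_gt_at_top[of 0] by eventually_elim (rule P[OF elim])
      ultimately show ?case
        by (simp add: tendsto_cong)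
    qed
    show "AE x in M. cmod (?P N x) \<le> 2 / cmod (1 - cis x)" for N
      using ne
    proof eventually_elim
      case (elim x)
      show ?case
      proof (cases "N = 0")
        case False
        have "cmod (1 - (\<Sum>k<N. cis x ^ k) / of_nat N) \<le> 2"
          using norm_triangle_ineq4[of 1 "(\<Sum>k<N. cis x ^ k) / of_nat N"] norm_average_le_1[of "cis x" N]
          by simp
        then show ?thesis
          using False P[OF elim, of N] by (simp add: norm_divide divide_right_mono)
      qed simp
    qed
    show "integrable M (\<lambda>x. (2 / cmod (1 - cis x))\<^sup>2)"
      using integrable_mult_right[OF int, of 4] by (simp add: power_divide)
  qed
  then obtain \<psi> where \<psi>: "?X \<longlonglongrightarrow> \<psi>"
    by blast
  have "\<forall>\<^sub>F N in sequentially. \<phi> - (1 / of_nat N) *\<^sub>C (\<Sum>n<N. (C ^^ n) \<phi>) = ?X N - C (?X N)"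
    using eventually_gt_at_top[of 0]
  proof eventually_elim
    case (elim N)
    have "?X N = (1 / of_nat N) *\<^sub>C (\<Sum>j<N. of_nat (N - 1 - j) *\<^sub>C (C ^^ j) \<phi>)"
      by (simp add: complex_vector.scale_sum_right scaleC_scaleC)
    then have "?X N - C (?X N) = (1 / of_nat N) *\<^sub>C (of_nat N *\<^sub>C \<phi> - (\<Sum>k<N. (C ^^ k) \<phi>))"
      by (simp only: C_scaleC cesaro_identity_C flip: scaleC_diff_right)
    then show ?case
      using elim by (simp add: scaleC_diff_right scaleC_scaleC scaleC_one)
  qed
  moreover have "(\<lambda>N. ?X N - C (?X N)) \<longlonglongrightarrow> \<psi> - C \<psi>"
    by (intro tendsto_diff C.tendsto \<psi>)
  ultimately have "(\<lambda>N. \<phi> - (1 / of_nat N) *\<^sub>C (\<Sum>n<N. (C ^^ n) \<phi>)) \<longlonglongrightarrow> \<psi> - C \<psi>"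
    by (simp add: tendsto_cong)
  moreover have "(\<lambda>N. \<phi> - (1 / of_nat N) *\<^sub>C (\<Sum>n<N. (C ^^ n) \<phi>)) \<longlonglongrightarrow> \<phi> - 0"
    by (intro tendsto_diff tendsto_const mean_ergodic(1) fixed)
  ultimately show ?thesis
    using LIMSEQ_unique by fastforce
qed

end

section \<open>Integral representation\<close>

definition cayley :: "complex \<Rightarrow> complex" where
  "cayley z = (z - \<i>) / (z + \<i>)"

lemma add_i_nonzero: "0 < Im z \<Longrightarrow> z + \<i> \<noteq> 0"
  by (auto simp: complex_eq_iff)

lemma norm_cayley_less_1:
  assumes "0 < Im z"
  shows "cmod (cayley z) < 1"
proof -
  have "(cmod (z - \<i>))\<^sup>2 < (cmod (z + \<i>))\<^sup>2"
    unfolding cmod_power2 using assms by (simp add: power2_eq_square algebra_simps)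
  then have "cmod (z - \<i>) < cmod (z + \<i>)"
    by (rule power_less_imp_less_base) simp
  then show ?thesis
    using add_i_nonzero[OF assms] by (simp add: cayley_def norm_divide)
qed

text \<open>The solution \<open>l\<close> of \<open>(l + \<i>) / (l - \<i>) = cis x\<close>; a junk value if \<open>cis x = 1\<close>.\<close>

definition cayley_real :: "real \<Rightarrow> real" where
  "cayley_real x = Re (\<i> * (cis x + 1) / (cis x - 1))"

lemma cayley_real_measurable [measurable]: "cayley_real \<in> borel_measurable borel"
proof -
  have [measurable]: "cis \<in> borel_measurable borel"
    by (intro borel_measurable_continuous_onI continuous_intros)
  show ?thesis
    unfolding cayley_real_def by measurable
qed

text \<open>On the unit circle conjugation is inversion, which leaves the quotient unchanged; taking
  \<open>Re\<close> in the definition therefore loses nothing.\<close>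

lemma cayley_real:
  assumes "cis x \<noteq> 1"
  shows "complex_of_real (cayley_real x) = \<i> * (cis x + 1) / (cis x - 1)"
proof -
  define e where "e = cis x"
  have e: "e \<noteq> 0" "e \<noteq> 1" "cnj e = 1 / e"
    using assms by (simp_all add: e_def cis_cnj divide_inverse)
  have "cnj (\<i> * (e + 1) / (e - 1)) = - (\<i> * (1 / e + 1)) / (1 / e - 1)"
    using e by simp
  also have "\<dots> = \<i> * (e + 1) / (e - 1)"
    using e by (simp add: divide_simps) (simp add: algebra_simps)
  finally have "\<i> * (e + 1) / (e - 1) \<in> \<real>"
    by (simp add: Reals_cnj_iff)
  then show ?thesis
    unfolding cayley_real_def e_def by (rule of_real_Re)
qed

text \<open>Translates the weight on the line into the function whose integrability decides whether
  \<phi> lies in the range of 1 - C.\<close>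

lemma one_plus_cayley_real_square:
  assumes "cis x \<noteq> 1"
  shows "1 + (cayley_real x)\<^sup>2 = 4 / (cmod (1 - cis x))\<^sup>2"
proof -
  define e where "e = cis x"
  have e: "e \<noteq> 1" "cmod e = 1"
    using assms by (simp_all add: e_def)
  have "complex_of_real (1 + (cayley_real x)\<^sup>2) = 1 + (\<i> * (e + 1) / (e - 1))\<^sup>2"
    using cayley_real[OF assms] by (simp add: e_def)
  also have "\<dots> = - 4 * e / (e - 1)\<^sup>2"
    using e(1) by (simp add: power2_eq_square divide_simps) (simp add: algebra_simps)
  finally have "cmod (complex_of_real (1 + (cayley_real x)\<^sup>2)) = 4 / (cmod (e - 1))\<^sup>2"
    using e(2) by (simp add: norm_divide norm_mult norm_power)
  then show ?thesis
    by (simp add: e_def norm_minus_commute del: of_real_add of_real_power)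
qed

text \<open>With l for \<open>cayley_real x\<close>, e = cis x and w = cayley z, the left side is (1
  + z l) / (l - z). The substitution turns it into i (1 + w e) / (1 - w e), the Herglotz kernel of
  the disc. The form on the right isolates the geometric series that produces the moments.\<close>

lemma cayley_kernel:
  assumes z: "0 < Im z" and x: "cis x \<noteq> 1"
  shows "(1 + (cayley_real x)\<^sup>2) *\<^sub>R (1 / (complex_of_real (cayley_real x) - z)
      - complex_of_real (cayley_real x / (1 + (cayley_real x)\<^sup>2)))
    = - \<i> + 2 * \<i> * (1 / (1 - cayley z * cis x))"
proof -
  define e w and l :: complex where "e = cis x" and "w = cayley z" and "l = complex_of_real (cayley_real x)"
  have l: "l = \<i> * (e + 1) / (e - 1)" and e: "e - 1 \<noteq> 0"
    using cayley_real[OF x] x by (simp_all add: e_def l_def)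
  have zi: "z + \<i> \<noteq> 0"
    using add_i_nonzero[OF z] .
  have "cmod (w * e) < 1"
    using norm_cayley_less_1[OF z] by (simp add: e_def w_def norm_mult)
  then have we: "1 - w * e \<noteq> 0"
    by auto
  have wz: "w * (z + \<i>) = z - \<i>"
    using zi by (simp add: w_def cayley_def)
  have lz: "(l - z) * (e - 1) = (z + \<i>) * (1 - w * e)"
  proof -
    have "(l - z) * (e - 1) = \<i> * (e + 1) - z * (e - 1)"
      using e by (simp add: l left_diff_distrib)
    also have "\<dots> = (z + \<i>) - (z - \<i>) * e"
      by (simp add: algebra_simps)
    also have "\<dots> = (z + \<i>) * (1 - w * e)"
      unfolding wz[symmetric] by (simp add: algebra_simps)
    finally show ?thesis .
  qed
  have zl: "(1 + z * l) * (e - 1) = \<i> * (z + \<i>) * (1 + w * e)"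
  proof -
    have "(1 + z * l) * (e - 1) = (e - 1) + z * (\<i> * (e + 1))"
      using e by (simp add: l distrib_right)
    also have "\<dots> = \<i> * ((z + \<i>) + (z - \<i>) * e)"
      by (simp add: algebra_simps)
    also have "\<dots> = \<i> * (z + \<i>) * (1 + w * e)"
      unfolding wz[symmetric] by (simp add: algebra_simps)
    finally show ?thesis .
  qed
  have "l - z \<noteq> 0"
    using lz zi we e by auto
  have pos: "1 + (cayley_real x)\<^sup>2 \<noteq> 0"
    by (metis add_pos_nonneg less_irrefl zero_le_power2 zero_less_one)
  have "(1 + (cayley_real x)\<^sup>2) *\<^sub>R (1 / (l - z) - complex_of_real (cayley_real x / (1 + (cayley_real x)\<^sup>2)))
      = (1 + l\<^sup>2) / (l - z) - complex_of_real ((1 + (cayley_real x)\<^sup>2) * (cayley_real x / (1 + (cayley_real x)\<^sup>2)))"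
    by (simp only: scaleR_conv_of_real right_diff_distrib of_real_mult)
      (simp add: l_def)
  also have "(1 + (cayley_real x)\<^sup>2) * (cayley_real x / (1 + (cayley_real x)\<^sup>2)) = cayley_real x"
    using pos by simp
  also have "(1 + l\<^sup>2) / (l - z) - complex_of_real (cayley_real x) = (1 + z * l) / (l - z)"
    using \<open>l - z \<noteq> 0\<close> by (simp add: l_def[symmetric] field_simps power2_eq_square)
  also have "\<dots> = ((1 + z * l) * (e - 1)) / ((l - z) * (e - 1))"
    using e by simp
  also have "\<dots> = \<i> * (1 + w * e) / (1 - w * e)"
    unfolding lz zl using zi by simp
  also have "\<dots> = - \<i> + 2 * \<i> * (1 / (1 - w * e))"
    using we by (simp add: field_simps)
  finally show ?thesis
    by (simp add: l_def w_def e_def)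
qed

lemma holomorphic_bounded_power_series:
  assumes "\<And>n. cmod (c n) \<le> 1"
  shows "(\<lambda>w. \<Sum>n. c n * w ^ n) holomorphic_on ball 0 1"
  unfolding holomorphic_on_open[OF open_ball]
proof (intro ballI)
  fix w :: complex assume "w \<in> ball 0 1"
  then obtain r where r: "cmod w < r" "r < 1"
    using dense by auto
  have r0: "0 < r"
    using r(1) by (smt (verit) norm_ge_zero)
  have "summable (\<lambda>n. c n * complex_of_real r ^ n)"
  proof (rule summable_comparison_test[OF exI[of _ 0]])
    show "summable (\<lambda>n. r ^ n)"
      using r r0 by (intro summable_geometric) simp
    show "\<forall>n\<ge>0. cmod (c n * complex_of_real r ^ n) \<le> r ^ n"
      using assms r0 by (simp add: norm_mult norm_power mult_left_le_one_le)
  qed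
  from termdiffs_strong[OF this, of w]
  show "\<exists>f'. ((\<lambda>w. \<Sum>n. c n * w ^ n) has_field_derivative f') (at w)"
    using r r0 by auto
qed

context isometric_orbit
begin

lemma moment_bound: "cmod (cinner ((C ^^ n) \<phi>) \<phi>) \<le> 1"
  using cinner_bound[of "(C ^^ n) \<phi>" \<phi>] by (simp add: norm_C_funpow norm_\<phi>)

text \<open>The measure on the line is the image of M under \<open>cayley_real\<close>, weighted by
  a (1 + t^2). The weight turns the kernel of the class into that of the disc, and it cancels
  against 1 / (1 + t^2) to leave total a. The assumption \<open>fixed\<close> removes the atom at
  \<open>cis x = 1\<close>, where the substitution breaks down; \<open>range\<close> makes the mass
  infinite.\<close>

lemma herglotz_class_of_orbit:
  assumes fixed: "\<And>\<psi>. C \<psi> = \<psi> \<Longrightarrow> \<psi> = 0" and range: "\<And>\<psi>. \<psi> - C \<psi> \<noteq> \<phi>" and a: "0 < a"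
    and V: "\<And>z. 0 < Im z \<Longrightarrow>
      V z = of_real a * (- \<i> + 2 * \<i> * (\<Sum>n. cinner ((C ^^ n) \<phi>) \<phi> * cayley z ^ n))"
    and V_pos: "\<And>z. 0 < Im z \<Longrightarrow> 0 < Im (V z)"
  shows "V \<in> herglotz_class a"
proof -
  obtain M where M: "real_distribution M" "\<And>k. (LINT x|M. cis (real k * x)) = cinner ((C ^^ k) \<phi>) \<phi>"
    using moment_measure_exists by blast
  interpret spectral_orbit C \<phi> M
    using M by (intro spectral_orbit.intro spectral_orbit_axioms.intro isometric_orbit_axioms) auto
  have ne: "AE x in M. cis x \<noteq> 1"
    by (rule mean_ergodic(2)[OF fixed])
  have [measurable]: "cayley_real \<in> borel_measurable M"
    by (rule borel_measurable_M[OF cayley_real_measurable])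
  have holo: "V holomorphic_on upper_half_plane"
  proof -
    have "((\<lambda>w. \<Sum>n. cinner ((C ^^ n) \<phi>) \<phi> * w ^ n) \<circ> cayley) holomorphic_on upper_half_plane"
    proof (rule holomorphic_on_compose_gen[OF _ holomorphic_bounded_power_series[OF moment_bound]])
      show "cayley holomorphic_on upper_half_plane"
        unfolding cayley_def using add_i_nonzero by (intro holomorphic_intros) auto
      show "cayley ` upper_half_plane \<subseteq> ball 0 1"
        using norm_cayley_less_1 by auto
    qed
    then have "(\<lambda>z. of_real a * (- \<i> + 2 * \<i> * (\<Sum>n. cinner ((C ^^ n) \<phi>) \<phi> * cayley z ^ n)))
        holomorphic_on upper_half_plane"
      unfolding comp_def by (intro holomorphic_intros)
    then show ?thesis
      by (rule holomorphic_transform) (use V in auto)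
  qed
  have series: "(\<Sum>n. cinner ((C ^^ n) \<phi>) \<phi> * w ^ n) = (LINT x|M. 1 / (1 - w * cis x))"
    and series_int: "integrable M (\<lambda>x. 1 / (1 - w * cis x))" if w: "cmod w < 1" for w
  proof -
    have int: "integrable M (\<lambda>x. (w * cis x) ^ n)" for n
      by (rule integrable_bounded[where B = 1])
        (use w in \<open>auto simp: norm_mult norm_power power_le_one less_imp_le\<close>)
    have sm: "summable (\<lambda>n. cmod ((w * cis x) ^ n))" for x
      using w by (simp add: norm_mult norm_power summable_geometric)
    have sm': "summable (\<lambda>n. LINT x|M. cmod ((w * cis x) ^ n))"
      using w by (simp add: norm_mult norm_power summable_geometric)
    have geo: "(\<Sum>n. (w * cis x) ^ n) = 1 / (1 - w * cis x)" for x
      using w by (intro suminf_geometric) (simp add: norm_mult)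
    have eq: "(LINT x|M. (w * cis x) ^ n) = cinner ((C ^^ n) \<phi>) \<phi> * w ^ n" for n
      using moments[of n] by (simp add: power_mult_distrib Complex.DeMoivre mult.commute)
    show "(\<Sum>n. cinner ((C ^^ n) \<phi>) \<phi> * w ^ n) = (LINT x|M. 1 / (1 - w * cis x))"
      using integral_suminf[OF int _ sm'] sm unfolding geo eq by simp
    show "integrable M (\<lambda>x. 1 / (1 - w * cis x))"
      using integrable_suminf[OF int _ sm'] sm unfolding geo by simp
  qed
  define M' where "M' = distr M borel cayley_real"
  define \<mu> where "\<mu> = density M' (\<lambda>t. ennreal (a * (1 + t\<^sup>2)))"
  have pos: "0 < 1 + t\<^sup>2" for t :: real
    by (simp add: add_pos_nonneg)
  have sets_M': "sets M' = sets borel"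
    by (simp add: M'_def)
  have meas_M': "f \<in> borel_measurable borel \<Longrightarrow> f \<in> borel_measurable M'" for f :: "real \<Rightarrow> 'b::topological_space"
    by (simp add: M'_def)
  \<comment> \<open>A finite mass would make 1 / |1 - cis x|^2 integrable, and \<phi> would then lie
    in the range of 1 - C.\<close>
  have mass: "emeasure \<mu> UNIV = \<infinity>"
  proof (rule ccontr)
    assume fin: "emeasure \<mu> UNIV \<noteq> \<infinity>"
    have "emeasure \<mu> UNIV = (\<integral>\<^sup>+x. ennreal (a * (1 + (cayley_real x)\<^sup>2)) \<partial>M)"
      unfolding \<mu>_def M'_def by (simp add: emeasure_density nn_integral_distr)
    also have "\<dots> = (\<integral>\<^sup>+x. ennreal (4 * a * (1 / (cmod (1 - cis x))\<^sup>2)) \<partial>M)"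
      using ne by (intro nn_integral_cong_AE, eventually_elim)
        (simp add: one_plus_cayley_real_square mult.commute)
    finally have "(\<integral>\<^sup>+x. ennreal (4 * a * (1 / (cmod (1 - cis x))\<^sup>2)) \<partial>M) < \<infinity>"
      using fin by (simp add: less_top)
    then have "integrable M (\<lambda>x. 4 * a * (1 / (cmod (1 - cis x))\<^sup>2))"
      using a by (intro integrableI_nonneg) auto
    then have "integrable M (\<lambda>x. 1 / (4 * a) * (4 * a * (1 / (cmod (1 - cis x))\<^sup>2)))"
      by (rule integrable_mult_right)
    then have "integrable M (\<lambda>x. 1 / (cmod (1 - cis x))\<^sup>2)"
      using a by simp
    then show False
      using in_range_one_minus_C fixed range by blast
  qed
  have total: "(\<integral>\<^sup>+x. ennreal (1 / (1 + x\<^sup>2)) \<partial>\<mu>) = ennreal a"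
  proof -
    have "(\<integral>\<^sup>+x. ennreal (1 / (1 + x\<^sup>2)) \<partial>\<mu>) = (\<integral>\<^sup>+x. ennreal (a * (1 + x\<^sup>2)) * ennreal (1 / (1 + x\<^sup>2)) \<partial>M')"
      unfolding \<mu>_def by (intro nn_integral_density meas_M') measurable
    also have "\<dots> = (\<integral>\<^sup>+x. ennreal a \<partial>M')"
    proof (intro nn_integral_cong)
      fix x :: real
      show "ennreal (a * (1 + x\<^sup>2)) * ennreal (1 / (1 + x\<^sup>2)) = ennreal a"
        using a pos[of x] by (simp flip: ennreal_mult)
    qed
    also have "\<dots> = ennreal a"
      by (simp add: M'_def emeasure_distr emeasure_space_1[simplified])
    finally show ?thesis .
  qed
  have repr: "V z = (LINT x|\<mu>. 1 / (complex_of_real x - z) - complex_of_real (x / (1 + x\<^sup>2)))" if z: "0 < Im z" for z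
  proof -
    let ?k = "\<lambda>x. 1 / (complex_of_real x - z) - complex_of_real (x / (1 + x\<^sup>2))"
    have [measurable]: "?k \<in> borel_measurable borel"
      by measurable
    have "(LINT x|\<mu>. ?k x) = (LINT x|M'. (a * (1 + x\<^sup>2)) *\<^sub>R ?k x)"
      unfolding \<mu>_def
    proof (rule integral_density)
      show "AE x in M'. 0 \<le> a * (1 + x\<^sup>2)"
        using a pos by (auto intro!: AE_I2 mult_nonneg_nonneg less_imp_le)
    qed (intro meas_M', measurable)+
    also have "\<dots> = (LINT x|M. (a * (1 + (cayley_real x)\<^sup>2)) *\<^sub>R ?k (cayley_real x))"
      unfolding M'_def by (rule integral_distr) measurable
    also have "\<dots> = (LINT x|M. of_real a * (- \<i> + 2 * \<i> * (1 / (1 - cayley z * cis x))))"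
    proof (rule integral_cong_AE)
      show "AE x in M. (a * (1 + (cayley_real x)\<^sup>2)) *\<^sub>R ?k (cayley_real x)
          = of_real a * (- \<i> + 2 * \<i> * (1 / (1 - cayley z * cis x)))"
        using ne
      proof eventually_elim
        case (elim x)
        show ?case
          unfolding scaleR_scaleR[symmetric] cayley_kernel[OF z elim] by (simp only: scaleR_conv_of_real)
      qed
    qed measurable
    also have "\<dots> = of_real a * (- \<i> + 2 * \<i> * (LINT x|M. 1 / (1 - cayley z * cis x)))"
    proof -
      have "(LINT x|M. of_real a * (- \<i> + 2 * \<i> * k x)) = of_real a * (- \<i> + 2 * \<i> * (LINT x|M. k x))"
        if "integrable M k" for k
        using that by (simp add: prob_space[simplified])
      then show ?thesis
        using series_int[OF norm_cayley_less_1[OF z]] .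
    qed
    also have "\<dots> = V z"
      using series[OF norm_cayley_less_1[OF z]] V[OF z] by simp
    finally show ?thesis by simp
  qed
  show ?thesis
    unfolding herglotz_class_def
    using holo V_pos mass total repr sets_M' by (auto simp: \<mu>_def intro!: exI[of _ \<mu>])
qed

end

section \<open>L-systems\<close>

instance complex_hilbert \<subseteq> banach ..

section \<open>Algebra of the state-space operator on the rigged space\<close>

locale L_sys =
  fixes \<Theta> :: "'a::complex_hilbert L_system"
  assumes L_system: "is_L_system \<Theta>"
begin

abbreviation "A \<equiv> symop \<Theta>"
abbreviation "T \<equiv> mainop \<Theta>"
abbreviation "B \<equiv> stateop \<Theta>"
abbreviation "R \<equiv> rigged_Re (stateop \<Theta>)"
abbreviation "\<xi> \<equiv> channel \<Theta> 1"
abbreviation "Ahat \<equiv> real_op \<Theta>"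
abbreviation "H \<equiv> plus_space (symop \<Theta>)"
abbreviation "E \<equiv> embed (symop \<Theta>)"

lemma A_linear: "linear_operator A" and A_sym: "A \<subseteq> adjoint A" and A_closed: "closed A"
  and A_dense: "densely_defined A" and A_def1: "deficiency_indices_1_1 A"
  and T_linear: "linear_operator T" and A_T: "A \<subseteq> T" and T_A: "T \<subseteq> adjoint A"
  and A_T_adj: "A \<subseteq> adjoint T"
  and Ahat_sa: "self_adjoint Ahat"
  using L_system
  by (auto simp: is_L_system_def symmetric_operator_def Lambda_class_def star_extension_def real_op_def)

lemma B_op: "bounded_rigged_op A B" and K_channel: "bounded_channel A (channel \<Theta>)"
  and T_B: "(f, h) \<in> T \<Longrightarrow> f \<in> H \<and> B f = E h"
  and T_adj_B: "(f, h) \<in> adjoint T \<Longrightarrow> f \<in> H \<and> rigged_adjoint B f = E h"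
  using L_system unfolding is_L_system_def star_extension_def by auto

lemma Im_B: "f \<in> H \<Longrightarrow> rigged_Im B f = channel \<Theta> (cnj (\<xi> f))"
  using L_system unfolding is_L_system_def channel_adjoint_def by auto

lemma adjoint_A_single: "(f, h) \<in> adjoint A \<Longrightarrow> (f, h') \<in> adjoint A \<Longrightarrow> h = h'"
  using single_valuedD'[OF linear_operator_adjoint[OF A_dense]] .

lemma H_subspace: "csubspace H"
proof (rule complex_vector.subspaceI)
  show "0 \<in> H"
    using adjoint_graphD(1)[of A] by (auto simp: plus_space_def)
  show "f + g \<in> H" if "f \<in> H" "g \<in> H" for f g
    using that adjoint_graphD(2)[of _ _ A] unfolding plus_space_def by (meson Domain.simps)
  show "c *\<^sub>C f \<in> H" if "f \<in> H" for c f
    using that adjoint_graphD(3)[of _ _ A] unfolding plus_space_def by (meson Domain.simps)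
qed

lemmas H_add = complex_vector.subspace_add[OF H_subspace]
  and H_diff = complex_vector.subspace_diff[OF H_subspace]
  and H_scale = complex_vector.subspace_scale[OF H_subspace]

lemma minus_space_simps:
  assumes "\<psi> \<in> minus_space A"
  shows "g \<notin> H \<Longrightarrow> \<psi> g = 0" and "f \<in> H \<Longrightarrow> g \<in> H \<Longrightarrow> \<psi> (f + g) = \<psi> f + \<psi> g"
    and "g \<in> H \<Longrightarrow> \<psi> (c *\<^sub>C g) = cnj c * \<psi> g"
  using assms unfolding minus_space_def by auto

lemma xi_minus: "\<xi> \<in> minus_space A"
  using K_channel by (simp add: bounded_channel_def)

lemma B_minus: "f \<in> H \<Longrightarrow> B f \<in> minus_space A"
  using B_op by (simp add: bounded_rigged_op_def)

lemma B_outside: "f \<notin> H \<Longrightarrow> B f u = 0"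
  using B_op by (simp add: bounded_rigged_op_def)

lemma xi_simps:
  shows "g \<notin> H \<Longrightarrow> \<xi> g = 0" and "f \<in> H \<Longrightarrow> g \<in> H \<Longrightarrow> \<xi> (f + g) = \<xi> f + \<xi> g"
    and "g \<in> H \<Longrightarrow> \<xi> (c *\<^sub>C g) = cnj c * \<xi> g"
  using minus_space_simps[OF xi_minus] by auto

lemma xi_diff: "f \<in> H \<Longrightarrow> g \<in> H \<Longrightarrow> \<xi> (f - g) = \<xi> f - \<xi> g"
  using xi_simps(2)[of "f - g" g] H_diff by simp

lemma B_add: "f \<in> H \<Longrightarrow> g \<in> H \<Longrightarrow> B (f + g) u = B f u + B g u"
  and B_scale: "f \<in> H \<Longrightarrow> B (c *\<^sub>C f) u = c * B f u"
  using B_op by (simp_all add: bounded_rigged_op_def)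

lemma R_eq: "R f u = (B f u + cnj (B u f)) / 2"
  by (simp add: rigged_Re_def rigged_adjoint_def)

lemma R_add: "f \<in> H \<Longrightarrow> g \<in> H \<Longrightarrow> R (f + g) u = R f u + R g u"
  by (cases "u \<in> H") (auto simp: R_eq B_add minus_space_simps(2)[OF B_minus] B_outside field_simps)

lemma R_scale: "f \<in> H \<Longrightarrow> R (c *\<^sub>C f) u = c * R f u"
  by (cases "u \<in> H") (auto simp: R_eq B_scale minus_space_simps(3)[OF B_minus] B_outside field_simps)

lemma R_herm: "R f u = cnj (R u f)"
  by (simp add: R_eq)

lemma R_diff: "f \<in> H \<Longrightarrow> g \<in> H \<Longrightarrow> R (f - g) u = R f u - R g u"
  using R_add[of "f - g" g u] H_diff by simp

text \<open>This is B = Re B + i K K* in coordinates: K K* f = (f, chi) chi with chi =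
  \<open>\<xi>\<close> and (f, chi) = \<open>cnj (\<xi> f)\<close>.\<close>

lemma B_R: "f \<in> H \<Longrightarrow> B f u = R f u + \<i> * cnj (\<xi> f) * \<xi> u"
proof -
  assume f: "f \<in> H"
  have "channel \<Theta> (cnj (\<xi> f) * 1) = (\<lambda>g. cnj (\<xi> f) * \<xi> g)"
    using K_channel unfolding bounded_channel_def by blast
  then have "rigged_Im B f u = cnj (\<xi> f) * \<xi> u"
    using Im_B[OF f] by simp
  then have "B f u - cnj (B u f) = 2 * \<i> * (cnj (\<xi> f) * \<xi> u)"
    by (simp add: rigged_Im_def rigged_adjoint_def field_simps)
  then show ?thesis
    by (simp add: R_eq field_simps)
qed

lemma E_simps: "E (f + g) u = E f u + E g u" "E (f - g) u = E f u - E g u" "E (c *\<^sub>C f) u = c * E f u"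
  "u \<in> H \<Longrightarrow> E f u = cinner f u"
  by (auto simp: embed_def cinner_simps)

lemma Ahat_iff: "(f, h) \<in> Ahat \<longleftrightarrow> f \<in> H \<and> (\<forall>u. R f u = E h u)"
  by (auto simp: real_op_def quasi_kernel_def fun_eq_iff)

text \<open>\<open>A\<close> lies below both \<open>T\<close> and its adjoint, so B and its rigged
  adjoint agree there with the action of \<open>A\<close>, and so does their mean.\<close>

lemma A_Ahat: "A \<subseteq> Ahat"
proof (rule subrelI)
  fix f h assume "(f, h) \<in> A"
  then have "f \<in> H" "B f = E h" "rigged_adjoint B f = E h"
    using T_B T_adj_B A_T A_T_adj by blast+
  then show "(f, h) \<in> Ahat"
    by (auto simp: Ahat_iff rigged_Re_def)
qed

lemma Ahat_A: "Ahat \<subseteq> adjoint A"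
  using adjoint_antimono[OF A_Ahat] self_adjointD(2)[OF Ahat_sa] by simp

lemma eigenspace_H: "g \<in> eigenspace (adjoint A) z \<Longrightarrow> g \<in> H"
  by (auto simp: eigenspace_def plus_space_def)

lemma R_form_real: "Im (R f f) = 0"
  by (metis R_herm Reals_cnj_iff complex_is_Real_iff)

text \<open>The quadratic form of Re B is real, so only the channel term contributes. This is where
  dissipativity of the main operator comes from.\<close>

lemma T_form: "(f, h) \<in> T \<Longrightarrow> Im (cinner h f) = (cmod (\<xi> f))\<^sup>2"
proof -
  assume fh: "(f, h) \<in> T"
  then have f: "f \<in> H" "B f = E h"
    using T_B by auto
  then have "cinner h f = R f f + \<i> * (cnj (\<xi> f) * \<xi> f)"
    using B_R[OF f(1), of f] E_simps(4)[OF f(1), of h] by simp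
  also have "cnj (\<xi> f) * \<xi> f = complex_of_real ((cmod (\<xi> f))\<^sup>2)"
    by (metis complex_norm_square mult.commute)
  finally show ?thesis
    using R_form_real[of f] by simp
qed

text \<open>Evaluates the definite description: the difference d of two solutions satisfies R d = z
  d, and the form of R at d is real while z is not.\<close>

lemma resolvent_R_eq:
  assumes f: "f \<in> H" and eq: "\<And>u. R f u = z * E f u + \<xi> u" and z: "Im z \<noteq> 0"
  shows "rigged_resolvent A R z \<xi> = f"
  unfolding rigged_resolvent_def
proof (rule the_equality)
  show "f \<in> H \<and> (\<lambda>g. R f g - z * E f g) = \<xi>"
    using f eq by auto
  fix g assume g: "g \<in> H \<and> (\<lambda>u. R g u - z * E g u) = \<xi>"
  then have "R g u = z * E g u + \<xi> u" for u
    by (auto simp: fun_eq_iff algebra_simps)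
  then have "R (g - f) (g - f) = z * E (g - f) (g - f)"
    using g f eq by (simp add: R_diff E_simps algebra_simps)
  also have "\<dots> = z * complex_of_real ((norm (g - f))\<^sup>2)"
    using E_simps(4)[of "g - f" "g - f"] H_diff g f by (simp only: cinner_self)
  finally have "Im z * (norm (g - f))\<^sup>2 = 0"
    using R_form_real[of "g - f"] by (simp del: of_real_power)
  then show "g = f"
    using z by simp
qed

text \<open>For the difference d of two solutions the imaginary part of the form gives |xi d|^2 =
  -|d|^2. The sign works because -i lies in the half-plane opposite to the dissipative one.\<close>

lemma resolvent_B_eq:
  assumes f: "f \<in> H" and eq: "\<And>u. B f u = - \<i> * E f u + \<xi> u"
  shows "rigged_resolvent A B (- \<i>) \<xi> = f"
  unfolding rigged_resolvent_def
proof (rule the_equality)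
  show "f \<in> H \<and> (\<lambda>g. B f g - - \<i> * E f g) = \<xi>"
    using f eq by auto
  fix g assume g: "g \<in> H \<and> (\<lambda>u. B g u - - \<i> * E g u) = \<xi>"
  then have gB: "B g u = - \<i> * E g u + \<xi> u" for u
    by (auto simp: fun_eq_iff algebra_simps)
  have d: "g - f \<in> H"
    using g f H_diff by blast
  have "B (g - f) (g - f) = - \<i> * E (g - f) (g - f)"
    using B_add[OF d f, of "g - f"] gB[of "g - f"] eq[of "g - f"] by (simp add: E_simps algebra_simps)
  also have "\<dots> = - \<i> * complex_of_real ((norm (g - f))\<^sup>2)"
    using E_simps(4)[OF d] by (simp only: cinner_self)
  finally have "R (g - f) (g - f) + \<i> * (cnj (\<xi> (g - f)) * \<xi> (g - f)) = - \<i> * complex_of_real ((norm (g - f))\<^sup>2)"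
    using B_R[OF d, of "g - f"] by (simp only: mult.assoc)
  moreover have "cnj (\<xi> (g - f)) * \<xi> (g - f) = complex_of_real ((cmod (\<xi> (g - f)))\<^sup>2)"
    by (metis complex_norm_square mult.commute)
  ultimately have "Im (R (g - f) (g - f) + \<i> * complex_of_real ((cmod (\<xi> (g - f)))\<^sup>2))
      = Im (- \<i> * complex_of_real ((norm (g - f))\<^sup>2))"
    by simp
  then have "(cmod (\<xi> (g - f)))\<^sup>2 = - (norm (g - f))\<^sup>2"
    using R_form_real[of "g - f"] by (simp del: of_real_power)
  then have "(norm (g - f))\<^sup>2 = 0"
    using zero_le_power2[of "cmod (\<xi> (g - f))"] zero_le_power2[of "norm (g - f)"] by linarith
  then show "g = f"
    by simp
qed

section \<open>Cayley transform of the quasi-kernel and integral representation of the impedance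
  function\<close>

definition resolvent_i :: "'a \<Rightarrow> 'a" where
  "resolvent_i h = (THE f. (f, h + \<i> *\<^sub>C f) \<in> Ahat)"

lemma resolvent_i_unique: "(f, h + \<i> *\<^sub>C f) \<in> Ahat \<Longrightarrow> (g, h + \<i> *\<^sub>C g) \<in> Ahat \<Longrightarrow> f = g"
proof -
  assume "(f, h + \<i> *\<^sub>C f) \<in> Ahat" "(g, h + \<i> *\<^sub>C g) \<in> Ahat"
  from csubspace_graphD(4)[OF self_adjointD(4)[OF Ahat_sa] this]
  have "(f - g, \<i> *\<^sub>C (f - g)) \<in> Ahat"
    by (simp add: scaleC_diff_right)
  then have "f - g = 0"
    by (rule self_adjoint_eigen_nonreal[OF Ahat_sa]) simp
  then show ?thesis by simp
qed

lemma resolvent_i: "(resolvent_i h, h + \<i> *\<^sub>C resolvent_i h) \<in> Ahat"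
proof -
  obtain f where f: "(f, h + \<i> *\<^sub>C f) \<in> Ahat"
    using self_adjoint_range[OF Ahat_sa, of \<i>] by auto
  show ?thesis
    unfolding resolvent_i_def
    by (rule theI[where P = "\<lambda>f. (f, h + \<i> *\<^sub>C f) \<in> Ahat", OF f]) (rule resolvent_i_unique[OF _ f])
qed

lemma resolvent_i_eqI: "(f, h + \<i> *\<^sub>C f) \<in> Ahat \<Longrightarrow> resolvent_i h = f"
  using resolvent_i_unique resolvent_i by blast

text \<open>The Cayley transform (Ahat + i) (Ahat - i)^-1, in a form that uses only the resolvent at
  i.\<close>

definition cayley_isometry :: "'a \<Rightarrow> 'a" where
  "cayley_isometry h = h + (2 * \<i>) *\<^sub>C resolvent_i h"

lemma cayley_isometric_orbit:
  assumes "norm \<phi> = 1"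
  shows "isometric_orbit cayley_isometry \<phi>"
proof
  note AD = csubspace_graphD[OF self_adjointD(4)[OF Ahat_sa]]
  fix x y :: 'a and c
  have "resolvent_i (x + y) = resolvent_i x + resolvent_i y"
    using AD(2)[OF resolvent_i[of x] resolvent_i[of y]]
    by (intro resolvent_i_eqI) (simp add: scaleC_add_right algebra_simps)
  then show "cayley_isometry (x + y) = cayley_isometry x + cayley_isometry y"
    by (simp add: cayley_isometry_def scaleC_add_right)
  have "resolvent_i (c *\<^sub>C x) = c *\<^sub>C resolvent_i x"
    using AD(3)[OF resolvent_i[of x], of c]
    by (intro resolvent_i_eqI) (simp add: scaleC_add_right scaleC_scaleC mult.commute)
  then show "cayley_isometry (c *\<^sub>C x) = c *\<^sub>C cayley_isometry x"
    by (simp add: cayley_isometry_def scaleC_add_right scaleC_scaleC mult.commute)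
  \<comment> \<open>Symmetry of Ahat at the two resolvent vectors; it is exactly the relation that
    cancels the extra terms of the inner product below.\<close>
  have "cinner (x + \<i> *\<^sub>C resolvent_i x) (resolvent_i y) = cinner (resolvent_i x) (y + \<i> *\<^sub>C resolvent_i y)"
    using adjointD[of "resolvent_i y" _ Ahat, OF _ resolvent_i[of x]] resolvent_i[of y] self_adjointD(2)[OF Ahat_sa]
    by simp
  then show "cinner (cayley_isometry x) (cayley_isometry y) = cinner x y"
    by (simp add: cayley_isometry_def cinner_simps algebra_simps)
qed (rule assms)

text \<open>With w = cayley z and C the Cayley transform, f = (1 - w) (1 - w C)^-1 \<phi> solves (R
  - z) f = chi, and the inverse is a geometric series since |w| < 1. The unit vector \<phi>'
  generates the orbit, so |\<phi>|^2 comes out as the factor a.\<close>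

lemma impedance_herglotz:
  assumes \<phi>: "\<phi> \<in> eigenspace (adjoint A) \<i>" and R\<phi>: "\<And>u. R \<phi> u = \<i> * E \<phi> u + \<xi> u"
    and a: "a = (norm \<phi>)\<^sup>2" "0 < a" and xi\<phi>: "\<xi> \<phi> = - \<i> * of_real a"
  shows "impedance_function \<Theta> \<in> herglotz_class a" and "impedance_function \<Theta> \<i> = \<i> * of_real a"
proof -
  let ?C = cayley_isometry
  define r where "r = norm \<phi>"
  define \<phi>' where "\<phi>' = complex_of_real (1 / r) *\<^sub>C \<phi>"
  have \<phi>H: "\<phi> \<in> H"
    using eigenspace_H \<phi> by blast
  have r: "0 < r"
    using a by (simp add: r_def)
  have \<phi>_eq: "\<phi> = complex_of_real r *\<^sub>C \<phi>'"
    using r by (simp add: \<phi>'_def scaleC_scaleC scaleC_one)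
  have "norm \<phi>' = 1"
    using r by (simp add: \<phi>'_def norm_scaleC r_def norm_divide)
  then interpret C: isometric_orbit ?C \<phi>'
    by (rule cayley_isometric_orbit)
  have C_def: "?C h = h + (2 * \<i>) *\<^sub>C resolvent_i h" for h
    by (simp add: cayley_isometry_def)
  have V_\<i>: "impedance_function \<Theta> \<i> = \<i> * of_real a"
    unfolding impedance_function_def channel_adjoint_def
    using resolvent_R_eq[OF \<phi>H R\<phi>] xi\<phi> by simp
  have main: "impedance_function \<Theta> z = of_real a * (- \<i> + 2 * \<i> * (\<Sum>n. cinner ((?C ^^ n) \<phi>') \<phi>' * cayley z ^ n))"
    "0 < Im (impedance_function \<Theta> z)" if z: "0 < Im z" for z
  proof -
    define w where "w = cayley z"
    have w: "cmod w < 1"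
      using norm_cayley_less_1[OF z] by (simp add: w_def)
    have zi: "z + \<i> \<noteq> 0"
      using add_i_nonzero[OF z] .
    have w1: "(1 - w) * (z + \<i>) = 2 * \<i>" "w * (z + \<i>) = z - \<i>"
      using zi by (simp_all add: w_def cayley_def divide_simps)
    define S where "S = (\<Sum>n. w ^ n *\<^sub>C (?C ^^ n) \<phi>')"
    have sm: "summable (\<lambda>n. w ^ n *\<^sub>C (?C ^^ n) \<phi>')"
    proof (rule summable_norm_cancel)
      show "summable (\<lambda>n. norm (w ^ n *\<^sub>C (?C ^^ n) \<phi>'))"
        using w by (simp add: norm_scaleC C.norm_C_funpow C.norm_\<phi> norm_power summable_geometric)
    qed
    have S_split: "S = \<phi>' + w *\<^sub>C ?C S"
    proof -
      have "w *\<^sub>C ?C S = (\<Sum>n. w *\<^sub>C ?C (w ^ n *\<^sub>C (?C ^^ n) \<phi>'))"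
        unfolding S_def
        by (simp only: bounded_linear.suminf[OF C.bounded_linear_C sm]
            bounded_linear.suminf[OF bounded_linear_scaleC C.C.summable[OF sm]])
      also have "\<dots> = (\<Sum>n. w ^ Suc n *\<^sub>C (?C ^^ Suc n) \<phi>')"
        by (simp add: C.C_scaleC scaleC_scaleC)
      also have "\<dots> = S - \<phi>'"
        unfolding S_def using suminf_split_head[OF sm] by (simp add: scaleC_one)
      finally show ?thesis by simp
    qed
    have S_inner: "cinner S \<phi>' = (\<Sum>n. cinner ((?C ^^ n) \<phi>') \<phi>' * w ^ n)"
      unfolding S_def bounded_linear.suminf[OF bounded_linear_cinner_left sm]
      by (simp add: cinner_scaleC_left mult.commute)
    define S' where "S' = complex_of_real r *\<^sub>C S"
    define g where "g = resolvent_i S'"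
    \<comment> \<open>Since C S' = S' + 2 i g, the splitting of S' rewrites f as \<phi> plus a
      multiple of g. R is known on \<phi> by assumption and on g because g lies in the domain of
      Ahat.\<close>
    define f where "f = (1 - w) *\<^sub>C S'"
    have S'_split: "S' = \<phi> + w *\<^sub>C ?C S'"
      using S_split unfolding S'_def \<phi>_eq C.C_scaleC
      by (metis complex_vector.scale_left_commute scaleC_add_right)
    then have f_eq: "f = \<phi> + (2 * \<i> * w) *\<^sub>C g"
      unfolding f_def C_def g_def[symmetric]
      by (simp add: scaleC_diff_left scaleC_one scaleC_add_right scaleC_scaleC algebra_simps)
    have gA: "(g, S' + \<i> *\<^sub>C g) \<in> Ahat"
      unfolding g_def by (rule resolvent_i)
    then have gH: "g \<in> H"
      by (simp add: Ahat_iff)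
    have fH: "f \<in> H"
      unfolding f_eq using \<phi>H gH H_add H_scale by blast
    have iw: "2 * \<i> * w = (z - \<i>) * (1 - w)"
      using w1 by (metis mult.assoc mult.commute)
    have "\<i> *\<^sub>C \<phi> + (2 * \<i> * w) *\<^sub>C (S' + \<i> *\<^sub>C g) = \<i> *\<^sub>C f + (2 * \<i> * w) *\<^sub>C S'"
      unfolding f_eq by (simp add: scaleC_add_right scaleC_scaleC algebra_simps)
    also have "\<dots> = \<i> *\<^sub>C f + ((z - \<i>) * (1 - w)) *\<^sub>C S'"
      by (simp only: iw)
    also have "\<i> *\<^sub>C f + ((z - \<i>) * (1 - w)) *\<^sub>C S' = z *\<^sub>C f"
      unfolding f_def by (simp add: scaleC_scaleC flip: scaleC_add_left) (simp add: algebra_simps)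
    finally have vec: "\<i> *\<^sub>C \<phi> + (2 * \<i> * w) *\<^sub>C (S' + \<i> *\<^sub>C g) = z *\<^sub>C f" .
    have Rf: "R f u = z * E f u + \<xi> u" for u
    proof -
      have "R f u = R \<phi> u + (2 * \<i> * w) * R g u"
        unfolding f_eq using \<phi>H gH H_scale by (simp add: R_add R_scale)
      also have "\<dots> = E (\<i> *\<^sub>C \<phi> + (2 * \<i> * w) *\<^sub>C (S' + \<i> *\<^sub>C g)) u + \<xi> u"
        using gA by (simp add: Ahat_iff R\<phi> E_simps)
      finally show ?thesis
        unfolding vec by (simp add: E_simps)
    qed
    have Vz: "impedance_function \<Theta> z = cnj (\<xi> f)"
      unfolding impedance_function_def channel_adjoint_def
      using resolvent_R_eq[OF fH Rf] z by simp
    \<comment> \<open>\<open>\<xi>\<close> is bounded only for the plus norm, so it is not applied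
      to the series term by term. Hermitian symmetry of R between f and \<phi> expresses
      \<open>\<xi> f\<close> through an ordinary inner product.\<close>
    have "z * cinner f \<phi> + \<xi> \<phi> = cnj (\<i> * cinner \<phi> f + \<xi> f)"
      using R_herm[of f \<phi>] Rf[of \<phi>] R\<phi>[of f] E_simps(4)[OF fH] E_simps(4)[OF \<phi>H] by simp
    then have "cnj (\<xi> f) = \<xi> \<phi> + (z + \<i>) * cinner f \<phi>"
      using cinner_commute[of f \<phi>] by (simp add: algebra_simps)
    also have "cinner f \<phi> = (1 - w) * (of_real a * cinner S \<phi>')"
    proof -
      have "a = r * r"
        by (simp add: a(1) r_def power2_eq_square)
      then have "cinner f (complex_of_real r *\<^sub>C \<phi>') = (1 - w) * (of_real a * cinner S \<phi>')"
        by (simp add: f_def S'_def cinner_scaleC_left cinner_scaleC_right)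
      then show ?thesis
        by (simp only: \<phi>_eq[symmetric])
    qed
    also have "\<xi> \<phi> + (z + \<i>) * ((1 - w) * (of_real a * cinner S \<phi>'))
        = \<xi> \<phi> + ((1 - w) * (z + \<i>)) * (of_real a * cinner S \<phi>')"
      by (simp only: mult_ac)
    also have "\<dots> = of_real a * (- \<i> + 2 * \<i> * cinner S \<phi>')"
      unfolding w1 xi\<phi> by (simp add: algebra_simps)
    finally show "impedance_function \<Theta> z = of_real a * (- \<i> + 2 * \<i> * (\<Sum>n. cinner ((?C ^^ n) \<phi>') \<phi>' * cayley z ^ n))"
      unfolding Vz S_inner w_def .
    have "f \<noteq> 0"
    proof
      assume "f = 0"
      moreover have "1 - w \<noteq> 0"
        using w by auto
      ultimately have "S' = 0"
        by (simp add: f_def)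
      then have "\<phi> = 0"
        using S'_split by (simp add: C.C.zero)
      then show False
        using a by simp
    qed
    have "R f f = z * complex_of_real ((norm f)\<^sup>2) + \<xi> f"
      using Rf[of f] E_simps(4)[OF fH, of f] by (simp only: cinner_self)
    then have "Im (impedance_function \<Theta> z) = Im z * (norm f)\<^sup>2"
      using R_form_real[of f] by (simp add: Vz del: of_real_power)
    then show "0 < Im (impedance_function \<Theta> z)"
      using z \<open>f \<noteq> 0\<close> by simp
  qed
  \<comment> \<open>A fixed vector has resolvent 0, and Ahat is single-valued at 0.\<close>
  have fixed: "\<psi> = 0" if "?C \<psi> = \<psi>" for \<psi>
  proof -
    have "resolvent_i \<psi> = 0"
      using that by (simp add: C_def)
    then have "(0, \<psi>) \<in> Ahat"
      using resolvent_i[of \<psi>] by simp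
    then show ?thesis
      using csubspace_graphD(1)[OF self_adjointD(4)[OF Ahat_sa]]
        single_valuedD'[OF self_adjointD(1)[OF Ahat_sa]] by blast
  qed
  \<comment> \<open>\<psi> - C \<psi> is a multiple of a resolvent vector, which would put \<phi>
    into the domain of Ahat as an eigenvector at i.\<close>
  have range: "\<psi> - ?C \<psi> \<noteq> \<phi>'" for \<psi>
  proof
    assume "\<psi> - ?C \<psi> = \<phi>'"
    then have "\<phi> = (complex_of_real r * (- 2 * \<i>)) *\<^sub>C resolvent_i \<psi>"
      by (simp add: \<phi>_eq C_def scaleC_scaleC)
        (metis complex_vector.scale_minus_right mult_minus_right scaleC_minus_right scaleC_scaleC)
    then obtain h where h: "(\<phi>, h) \<in> Ahat"
      using csubspace_graphD(3)[OF self_adjointD(4)[OF Ahat_sa] resolvent_i[of \<psi>]] by metis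
    then have "h = \<i> *\<^sub>C \<phi>"
      using Ahat_A \<phi> adjoint_A_single unfolding eigenspace_def by blast
    then have "\<phi> = 0"
      using self_adjoint_eigen_nonreal[OF Ahat_sa, of \<phi> \<i>] h by simp
    then show False
      using a by simp
  qed
  show "impedance_function \<Theta> \<in> herglotz_class a"
    by (rule C.herglotz_class_of_orbit[OF fixed range a(2) main])
  show "impedance_function \<Theta> \<i> = \<i> * of_real a"
    by (rule V_\<i>)
qed

end

text \<open>Both hypotheses, with an arbitrary phase between the deficiency vectors: rotating \<open>gm\<close> normalizes the
  self-adjoint extension and moves the phase into the complex parameter \<open>k\<close>.\<close>

locale L_sys_parameter = L_sys +
  fixes k :: complex and gp gm :: 'a
  assumes k: "k \<noteq> 1"
    and gp: "gp \<in> eigenspace (adjoint A) \<i>" and gm: "gm \<in> eigenspace (adjoint A) (- \<i>)"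
    and norm_gp: "norm gp = 1" and norm_gm: "norm gm = 1"
    and dom_T: "gp - k *\<^sub>C gm \<in> Domain T" and dom_Ahat: "gp - gm \<in> Domain Ahat"
begin

text \<open>Up to the factor 1 - k this is (gp - k gm, chi), the channel coefficient of the vector
  on which \<open>T\<close> is known. The division comes from solving for R gp and R gm.\<close>

definition "t = (cnj (\<xi> gp) - k * cnj (\<xi> gm)) / (1 - k)"

text \<open>The channel part of the form of R at \<open>gm\<close>: R gm gm = -i (1 + p). Reality of
  this form is what fixes the real part of p.\<close>

definition "p = t * \<xi> gm"

lemma gp_H: "gp \<in> H" and gm_H: "gm \<in> H"
  using eigenspace_H gp gm by blast+

lemma adjoint_comb: "(gp - c *\<^sub>C gm, \<i> *\<^sub>C gp + (c * \<i>) *\<^sub>C gm) \<in> adjoint A"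
proof -
  have "(gp - c *\<^sub>C gm, \<i> *\<^sub>C gp - c *\<^sub>C (- \<i>) *\<^sub>C gm) \<in> adjoint A"
    using gp gm unfolding eigenspace_def by (intro adjoint_graphD) auto
  then show ?thesis
    by (simp add: scaleC_scaleC)
qed

text \<open>Two linear equations for R gp and R gm: \<open>dom_T\<close> gives one for R gp - k R gm
  after removing the channel term from B, and \<open>dom_Ahat\<close> gives one for R gp - R gm. The
  determinant is 1 - k up to sign.\<close>

lemma R_gm: "R gm u = - \<i> * E gm u - \<i> * t * \<xi> u"
  and R_gp: "R gp u = \<i> * E gp u - \<i> * t * \<xi> u"
proof -
  obtain f' where f': "(gp - k *\<^sub>C gm, f') \<in> T"
    using dom_T by blast
  then have "f' = \<i> *\<^sub>C gp + (k * \<i>) *\<^sub>C gm"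
    using adjoint_A_single adjoint_comb T_A by blast
  then have "B (gp - k *\<^sub>C gm) u = \<i> * E gp u + k * \<i> * E gm u"
    using T_B[OF f'] by (simp add: E_simps)
  moreover have "\<xi> (gp - k *\<^sub>C gm) = \<xi> gp - cnj k * \<xi> gm"
    using gp_H gm_H H_scale by (simp add: xi_diff xi_simps)
  moreover have "R (gp - k *\<^sub>C gm) u = R gp u - k * R gm u"
    using gp_H gm_H H_scale by (simp add: R_diff R_scale)
  ultimately have 1: "R gp u - k * R gm u + \<i> * ((1 - k) * t) * \<xi> u = \<i> * E gp u + k * \<i> * E gm u"
    using B_R[of "gp - k *\<^sub>C gm" u] gp_H gm_H H_diff H_scale k by (simp add: t_def)
  obtain h where h: "(gp - gm, h) \<in> Ahat"
    using dom_Ahat by blast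
  then have "h = \<i> *\<^sub>C gp + \<i> *\<^sub>C gm"
    using adjoint_A_single adjoint_comb[of 1] Ahat_A by (auto simp: scaleC_one)
  then have 2: "R gp u - R gm u = \<i> * E gp u + \<i> * E gm u"
    using h gp_H gm_H by (simp add: Ahat_iff R_diff E_simps)
  have "(1 - k) * (R gm u + \<i> * t * \<xi> u + \<i> * E gm u) = 0"
    using 1 2 by algebra
  then have "R gm u + \<i> * t * \<xi> u + \<i> * E gm u = 0"
    using k by simp
  then show 3: "R gm u = - \<i> * E gm u - \<i> * t * \<xi> u"
    by algebra
  show "R gp u = \<i> * E gp u - \<i> * t * \<xi> u"
    using 2 3 by algebra
qed

lemma E_unit: "E gp gp = 1" "E gm gm = 1"
  using E_simps(4) gp_H gm_H norm_gp norm_gm by (simp_all add: cinner_self)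

lemma Re_p: "Re p = - 1"
  using R_form_real[of gm] R_gm[of gm] E_unit(2) by (simp add: p_def mult.assoc)

text \<open>Hermitian symmetry of R between \<open>gp\<close> and \<open>gm\<close>, whose own inner
  product cancels.\<close>

lemma t_xi_gp: "t * \<xi> gp = - cnj p"
proof -
  have "R gm gp = - \<i> * cinner gm gp - \<i> * (t * \<xi> gp)" "R gp gm = \<i> * cinner gp gm - \<i> * p"
    using R_gm[of gp] R_gp[of gm] E_simps(4) gp_H gm_H by (simp_all add: p_def)
  then have "- \<i> * cinner gm gp - \<i> * (t * \<xi> gp) = - \<i> * cinner gm gp + \<i> * cnj p"
    using R_herm[of gm gp] cinner_commute[of gm gp] by simp
  then have "\<i> * (t * \<xi> gp + cnj p) = 0"
    by algebra
  then show ?thesis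
    by (simp add: add_eq_0_iff2)
qed

lemma t_nonzero: "t \<noteq> 0"
  using Re_p by (auto simp: p_def)

text \<open>The definition of t multiplied by \<open>cnj t\<close>. It ties |t| and p to k, as
  \<open>transfer_at_minus_i\<close> ties them to the transfer function.\<close>

lemma norm_t: "complex_of_real ((cmod t)\<^sup>2) * (1 - k) = - p - k * cnj p"
proof -
  have "complex_of_real ((cmod t)\<^sup>2) * (1 - k) = cnj t * (t * (1 - k))"
    unfolding complex_norm_square by (simp only: mult_ac)
  also have "\<dots> = cnj (t * \<xi> gp) - k * cnj p"
  proof -
    have "t * (1 - k) = cnj (\<xi> gp) - k * cnj (\<xi> gm)"
      using k by (simp add: t_def)
    then show ?thesis
      by (simp add: p_def right_diff_distrib mult_ac)
  qed
  finally show ?thesis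
    unfolding t_xi_gp by simp
qed

text \<open>For real k the left side of \<open>norm_t\<close> is real. Its imaginary part leaves (1
  - r) Im p = 0, and the real part of p is already known.\<close>

lemma p_real:
  assumes "k = complex_of_real r"
  shows "p = - 1" and "(cmod t)\<^sup>2 * (1 - r) = 1 + r"
proof -
  have "Im (complex_of_real ((cmod t)\<^sup>2) * (1 - k)) = 0"
    using assms by simp
  then have "(1 - r) * Im p = 0"
    unfolding norm_t using assms by (simp add: algebra_simps)
  then have "Im p = 0"
    using k assms by auto
  then show p: "p = - 1"
    using Re_p by (simp add: complex_eq_iff)
  have "complex_of_real ((cmod t)\<^sup>2 * (1 - r)) = complex_of_real (1 + r)"
    using norm_t assms p by simp
  then show "(cmod t)\<^sup>2 * (1 - r) = 1 + r"
    using of_real_eq_iff by blast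
qed

text \<open>The multiple i / t of \<open>gp\<close> is the one for which R gp = i gp - i t chi
  becomes the equation (R - i) \<phi> = chi; its squared norm is 1 / |t|^2.\<close>

lemma impedance_class:
  assumes r: "k = complex_of_real r" "\<bar>r\<bar> < 1"
  shows "impedance_function \<Theta> \<in> herglotz_class ((1 - r) / (1 + r))"
    and "impedance_function \<Theta> \<i> = \<i> * of_real ((1 - r) / (1 + r))"
proof -
  have a: "(1 - r) / (1 + r) = (norm ((\<i> / t) *\<^sub>C gp))\<^sup>2"
  proof -
    have "(norm ((\<i> / t) *\<^sub>C gp))\<^sup>2 = 1 / (cmod t)\<^sup>2"
      by (simp add: norm_scaleC norm_gp norm_divide power_divide)
    moreover have "1 / (cmod t)\<^sup>2 = (1 - r) / (1 + r)"
      using r(2) t_nonzero p_real(2)[OF r(1)] by (simp add: field_simps)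
    ultimately show ?thesis
      by simp
  qed
  have "0 < (1 - r) / (1 + r)"
    using r(2) by simp
  moreover have "(\<i> / t) *\<^sub>C gp \<in> eigenspace (adjoint A) \<i>"
    using gp adjoint_graphD(3)[of gp "\<i> *\<^sub>C gp" A "\<i> / t"] by (simp add: eigenspace_def scaleC_scaleC mult.commute)
  moreover have "R ((\<i> / t) *\<^sub>C gp) u = \<i> * E ((\<i> / t) *\<^sub>C gp) u + \<xi> u" for u
    using t_nonzero gp_H by (simp add: R_scale R_gp E_simps field_simps)
  moreover have "\<xi> ((\<i> / t) *\<^sub>C gp) = - \<i> * of_real ((1 - r) / (1 + r))"
  proof -
    have "t * \<xi> gp = 1"
      using t_xi_gp p_real(1)[OF r(1)] by simp
    then have "\<xi> ((\<i> / t) *\<^sub>C gp) = - \<i> / (t * cnj t)"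
      using t_nonzero gp_H by (simp add: xi_simps field_simps)
    also have "\<dots> = - \<i> * of_real (1 / (cmod t)\<^sup>2)"
      unfolding complex_norm_square[symmetric] by simp
    also have "1 / (cmod t)\<^sup>2 = (1 - r) / (1 + r)"
      unfolding a by (simp add: norm_scaleC norm_gp norm_divide power_divide)
    finally show ?thesis .
  qed
  ultimately show "impedance_function \<Theta> \<in> herglotz_class ((1 - r) / (1 + r))"
    and "impedance_function \<Theta> \<i> = \<i> * of_real ((1 - r) / (1 + r))"
    using impedance_herglotz[OF _ _ a] by blast+
qed

text \<open>With y = (gm, chi), B gm = -i gm + i (y - t) chi, so the resolvent takes chi to a
  multiple of \<open>gm\<close> and W(-i) = (t + y) / (t - y). Multiplying by \<open>cnj t\<close>
  replaces t and y by |t|^2 and \<open>cnj p\<close>. The case y = t is excluded because it would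
  make Re p nonnegative.\<close>

lemma transfer_at_minus_i:
  "(of_real ((cmod t)\<^sup>2) - cnj p) * transfer_function \<Theta> (- \<i>) = of_real ((cmod t)\<^sup>2) + cnj p"
proof -
  define y where "y = cnj (\<xi> gm)"
  have py: "cnj p = cnj t * y" and tt: "of_real ((cmod t)\<^sup>2) = cnj t * t"
    unfolding complex_norm_square by (simp_all add: p_def y_def)
  have yt: "y - t \<noteq> 0"
  proof
    assume "y - t = 0"
    then have "cnj p = of_real ((cmod t)\<^sup>2)"
      unfolding py tt by simp
    then have "Re p = (cmod t)\<^sup>2"
      by (metis complex_cnj_complex_of_real complex_cnj_cnj Re_complex_of_real)
    then show False
      using Re_p zero_le_power2[of "cmod t"] by linarith
  qed
  let ?c = "1 / (\<i> * (y - t))"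
  have "B gm u = - \<i> * E gm u + \<i> * (y - t) * \<xi> u" for u
    using B_R[OF gm_H, of u] R_gm[of u] by (simp add: y_def algebra_simps)
  then have "B (?c *\<^sub>C gm) u = - \<i> * E (?c *\<^sub>C gm) u + \<xi> u" for u
    using yt gm_H by (simp add: B_scale E_simps field_simps)
  then have "rigged_resolvent A B (- \<i>) \<xi> = ?c *\<^sub>C gm"
    by (intro resolvent_B_eq H_scale gm_H)
  then have "transfer_function \<Theta> (- \<i>) = 1 - 2 * \<i> * (?c * y)"
    using gm_H by (simp add: transfer_function_def channel_adjoint_def xi_simps y_def)
  also have "\<dots> = (t + y) / (t - y)"
    using yt by (simp add: field_simps)
  finally have "(t - y) * transfer_function \<Theta> (- \<i>) = t + y"
    using yt by simp
  then have "cnj t * ((t - y) * transfer_function \<Theta> (- \<i>)) = cnj t * (t + y)"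
    by simp
  then show ?thesis
    unfolding py tt by (simp add: algebra_simps)
qed

text \<open>If p = -1, both k and W(-i) equal (\<tau> - 1) / (\<tau> + 1) with \<tau> = |t|^2.
  Reality of either one forces p = -1, through \<open>norm_t\<close> or through
  \<open>transfer_at_minus_i\<close>.\<close>

lemma transfer_real_iff: "transfer_function \<Theta> (- \<i>) = of_real r \<longleftrightarrow> k = of_real r"
proof -
  define \<tau> where "\<tau> = (cmod t)\<^sup>2"
  have \<tau>: "0 < \<tau>"
    using t_nonzero by (simp add: \<tau>_def)
  have W: "(of_real \<tau> + 1) * transfer_function \<Theta> (- \<i>) = of_real \<tau> - 1"
    and K: "(of_real \<tau> + 1) * k = of_real \<tau> - 1" if "p = - 1"
    using transfer_at_minus_i norm_t that by (simp_all add: \<tau>_def[symmetric] algebra_simps)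
  have \<tau>1: "complex_of_real \<tau> + 1 \<noteq> 0"
    using \<tau> by (simp add: complex_eq_iff)
  show ?thesis
  proof
    assume r: "transfer_function \<Theta> (- \<i>) = of_real r"
    have "complex_of_real (\<tau> * (1 - r)) = - cnj p * of_real (1 + r)"
      using transfer_at_minus_i by (simp add: r \<tau>_def[symmetric] algebra_simps)
    then have "Im (- cnj p * of_real (1 + r)) = 0" "Re (- cnj p * of_real (1 + r)) = \<tau> * (1 - r)"
      by (metis Im_complex_of_real, metis Re_complex_of_real)
    then have "Im p * (1 + r) = 0" "1 + r = \<tau> * (1 - r)"
      using Re_p by simp_all
    \<comment> \<open>If r were -1, the relation 1 + r = \<tau> (1 - r) would read 0 = 2
      \<tau>.\<close>
    moreover have "1 + r \<noteq> 0"
      using \<open>1 + r = \<tau> * (1 - r)\<close> \<tau> by auto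
    ultimately have "p = - 1"
      using Re_p by (simp add: complex_eq_iff)
    then show "k = of_real r"
      using W K r \<tau>1 by (metis mult_cancel_left)
  next
    assume "k = of_real r"
    then show "transfer_function \<Theta> (- \<i>) = of_real r"
      using W K \<tau>1 p_real(1) by (metis mult_cancel_left)
  qed
qed

end

section \<open>The main operator at -i, the phase of the quasi-kernel, and the two
  hypotheses\<close>

context L_sys
begin

lemma deficiency_vector_plus: "g \<in> eigenspace (adjoint A) \<i> \<Longrightarrow> g \<noteq> 0 \<Longrightarrow> v \<in> eigenspace (adjoint A) \<i> \<Longrightarrow> \<exists>c. v = c *\<^sub>C g"
  and deficiency_vector_minus: "g \<in> eigenspace (adjoint A) (- \<i>) \<Longrightarrow> g \<noteq> 0 \<Longrightarrow> v \<in> eigenspace (adjoint A) (- \<i>) \<Longrightarrow> \<exists>c. v = c *\<^sub>C g"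
  using A_def1 eigenspace_cdim_1 unfolding deficiency_indices_1_1_def by blast+

text \<open>The imaginary part of the form of T + i at f is at least |f|^2, and Cauchy-Schwarz
  bounds it above.\<close>

lemma T_bounded_below: "(f, f') \<in> T \<Longrightarrow> norm f \<le> norm (f' + \<i> *\<^sub>C f)"
proof (cases "f = 0")
  case False
  assume T: "(f, f') \<in> T"
  have "(norm f)\<^sup>2 \<le> Im (cinner (f' + \<i> *\<^sub>C f) f)"
    using T_form[OF T] by (simp add: cinner_simps cinner_self del: of_real_power)
  also have "\<dots> \<le> norm (f' + \<i> *\<^sub>C f) * norm f"
    using abs_Im_le_cmod[of "cinner (f' + \<i> *\<^sub>C f) f"] cinner_bound[of "f' + \<i> *\<^sub>C f" f] by linarith
  finally show ?thesis
    using False by (simp add: power2_eq_square)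
qed simp

text \<open>The range of A + i misses only multiples of \<open>gp\<close>. On
  \<open>gp - k *\<^sub>C gm\<close> the operator T + i annihilates the \<open>gm\<close> part and
  yields 2 i gp, which fills the gap.\<close>

lemma T_range:
  assumes gp: "gp \<in> eigenspace (adjoint A) \<i>" "gp \<noteq> 0" and gm: "gm \<in> eigenspace (adjoint A) (- \<i>)"
    and dom: "gp - k *\<^sub>C gm \<in> Domain T"
  shows "\<exists>f. (f, h - \<i> *\<^sub>C f) \<in> T"
proof -
  have Tsub: "csubspace T"
    using T_linear by (simp add: linear_operator_def)
  obtain f f' v where f: "(f, f') \<in> A" and v: "v \<in> eigenspace (adjoint A) \<i>" and h: "h = (f' - (- \<i>) *\<^sub>C f) + v"
    using deficiency_decomposition[OF A_linear A_sym A_closed, of "- \<i>" h] by auto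
  obtain c where c: "v = c *\<^sub>C gp"
    using deficiency_vector_plus[OF gp v] by blast
  obtain u where u: "(gp - k *\<^sub>C gm, u) \<in> T"
    using dom by blast
  have "(gp - k *\<^sub>C gm, \<i> *\<^sub>C gp - k *\<^sub>C (- \<i>) *\<^sub>C gm) \<in> adjoint A"
    using gp gm unfolding eigenspace_def by (intro adjoint_graphD) auto
  then have u_eq: "u = \<i> *\<^sub>C gp - k *\<^sub>C (- \<i>) *\<^sub>C gm"
    using u T_A adjoint_A_single by blast
  let ?d = "c / (2 * \<i>)"
  have "(f + ?d *\<^sub>C (gp - k *\<^sub>C gm), f' + ?d *\<^sub>C u) \<in> T"
    using f A_T u by (intro csubspace_graphD[OF Tsub]) auto
  moreover have "f' + ?d *\<^sub>C u = h - \<i> *\<^sub>C (f + ?d *\<^sub>C (gp - k *\<^sub>C gm))"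
  proof -
    have "?d *\<^sub>C u + \<i> *\<^sub>C ?d *\<^sub>C (gp - k *\<^sub>C gm) = (?d * \<i>) *\<^sub>C gp + (\<i> * ?d) *\<^sub>C gp"
      unfolding u_eq by (simp add: scaleC_diff_right scaleC_scaleC algebra_simps)
    also have "\<dots> = (?d * \<i> + \<i> * ?d) *\<^sub>C gp"
      by (rule scaleC_add_left[symmetric])
    also have "?d * \<i> + \<i> * ?d = 2 * \<i> * ?d"
      by algebra
    also have "\<dots> = c"
      by simp
    finally have "?d *\<^sub>C u + \<i> *\<^sub>C ?d *\<^sub>C (gp - k *\<^sub>C gm) = v"
      using c by simp
    then show ?thesis
      unfolding h by (simp add: scaleC_add_right algebra_simps)
  qed
  ultimately show ?thesis
    by metis
qed

lemma minus_i_in_resolvent_set: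
  assumes range: "\<And>h. \<exists>f. (f, h - \<i> *\<^sub>C f) \<in> T"
  shows "- \<i> \<in> resolvent_set T"
  unfolding resolvent_set_def
proof (intro CollectI conjI allI exI[of _ 1])
  have Tsub: "csubspace T"
    using T_linear by (simp add: linear_operator_def)
  show "\<exists>!f. (f, h + - \<i> *\<^sub>C f) \<in> T" for h
  proof -
    have "f = g" if "(f, h - \<i> *\<^sub>C f) \<in> T" "(g, h - \<i> *\<^sub>C g) \<in> T" for f g
      using T_bounded_below[OF csubspace_graphD(4)[OF Tsub that]] by (simp add: scaleC_diff_right)
    then show ?thesis
      using range[of h] by auto
  qed
  show "\<forall>(f, f')\<in>T. norm f \<le> 1 * norm (f' - - \<i> *\<^sub>C f)"
    using T_bounded_below by auto
qed

text \<open>S + i is injective for every dissipative S, so S cannot properly extend an operator T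
  for which T + i is already onto.\<close>

lemma T_maximal_dissipative:
  assumes range: "\<And>h. \<exists>f. (f, h - \<i> *\<^sub>C f) \<in> T"
  shows "maximal_dissipative T"
  unfolding maximal_dissipative_def
proof (intro conjI allI impI T_linear)
  show "dissipative T"
    unfolding dissipative_def using T_form by auto
  fix S assume S: "linear_operator S \<and> dissipative S \<and> T \<subseteq> S"
  have "(f, f') \<in> T" if f: "(f, f') \<in> S" for f f'
  proof -
    obtain g where g: "(g, f' + \<i> *\<^sub>C f - \<i> *\<^sub>C g) \<in> T"
      using range by blast
    then have "(f - g, f' - (f' + \<i> *\<^sub>C f - \<i> *\<^sub>C g)) \<in> S"
      using S f csubspace_graphD(4) unfolding linear_operator_def by blast
    then have "(f - g, - (\<i> *\<^sub>C (f - g))) \<in> S"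
      by (simp add: scaleC_diff_right)
    then have "0 \<le> Im (cinner (- (\<i> *\<^sub>C (f - g))) (f - g))"
      using S unfolding dissipative_def by blast
    then have "norm (f - g) = 0"
      by (simp add: cinner_minus_left cinner_scaleC_left cinner_self del: of_real_power)
    then show ?thesis
      using g by simp
  qed
  then show "S = T"
    using S by auto
qed

text \<open>The solution f of (Ahat + i) f = 2 i gp differs from \<open>gp\<close> by an element of
  the other deficiency space, that is by a multiple e of \<open>gm\<close>. Reality of the form of
  Ahat at f then gives |e| = 1.\<close>

lemma phase_exists:
  assumes gp: "gp \<in> eigenspace (adjoint A) \<i>" and gm: "gm \<in> eigenspace (adjoint A) (- \<i>)"
    and norms: "norm gp = 1" "norm gm = 1"
  shows "\<exists>e. cmod e = 1 \<and> gp - e *\<^sub>C gm \<in> Domain Ahat"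
proof -
  obtain f where f: "(f, (2 * \<i>) *\<^sub>C gp - \<i> *\<^sub>C f) \<in> Ahat"
    using self_adjoint_range[OF Ahat_sa, of "- \<i>" "(2 * \<i>) *\<^sub>C gp"] by auto
  have "(gp - f, \<i> *\<^sub>C gp - ((2 * \<i>) *\<^sub>C gp - \<i> *\<^sub>C f)) \<in> adjoint A"
    using gp f Ahat_A by (intro adjoint_graphD(4)) (auto simp: eigenspace_def)
  moreover have "\<i> *\<^sub>C gp - ((2 * \<i>) *\<^sub>C gp - \<i> *\<^sub>C f) = (- \<i>) *\<^sub>C (gp - f)"
  proof -
    have "(2 * \<i>) *\<^sub>C gp = \<i> *\<^sub>C gp + \<i> *\<^sub>C gp"
      by (simp flip: scaleC_add_left)
    then show ?thesis
      by (simp add: scaleC_diff_right)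
  qed
  ultimately have "gp - f \<in> eigenspace (adjoint A) (- \<i>)"
    by (simp add: eigenspace_def)
  moreover have "gm \<noteq> 0"
    using norms by auto
  ultimately obtain e where e: "gp - f = e *\<^sub>C gm"
    using deficiency_vector_minus[OF gm] by blast
  then have f_eq: "f = gp - e *\<^sub>C gm"
    by (metis diff_diff_eq2 add_diff_cancel_left' diff_add_cancel)
  have "Im (cinner ((2 * \<i>) *\<^sub>C gp - \<i> *\<^sub>C f) f) = 0"
    using symmetric_form_real[OF _ f] self_adjointD(2)[OF Ahat_sa] by simp
  moreover have "(2 * \<i>) *\<^sub>C gp - \<i> *\<^sub>C f = \<i> *\<^sub>C (gp + e *\<^sub>C gm)"
  proof -
    have "(2 * \<i>) *\<^sub>C gp = \<i> *\<^sub>C gp + \<i> *\<^sub>C gp"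
      by (simp flip: scaleC_add_left)
    then show ?thesis
      by (simp add: f_eq scaleC_diff_right scaleC_add_right)
  qed
  ultimately have "Re (cinner (gp + e *\<^sub>C gm) (gp - e *\<^sub>C gm)) = 0"
    by (simp add: f_eq cinner_scaleC_left)
  \<comment> \<open>The mixed terms are conjugate to each other and enter with opposite signs, so
    their real parts cancel.\<close>
  moreover have "Re (cinner (e *\<^sub>C gm) gp) = Re (cinner gp (e *\<^sub>C gm))"
    by (subst cinner_commute) simp
  ultimately have "Re (cinner gp gp) = Re (cinner (e *\<^sub>C gm) (e *\<^sub>C gm))"
    by (simp only: cinner_add_left cinner_diff_right plus_complex.simps minus_complex.simps)
  then have "(cmod e)\<^sup>2 = 1"
    by (simp add: cinner_self norm_scaleC norms del: of_real_power)
  then have "cmod e = 1"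
    by (simp add: power2_eq_1_iff) (smt (verit) norm_ge_zero)
  then show ?thesis
    using f f_eq by blast
qed

text \<open>The sign \<sigma> selects the hypothesis: 1 for I and -1 for II. Since \<sigma>^2 = 1,
  moving it into both \<open>gm\<close> and the parameter leaves the vector in the domain of
  \<open>T\<close> unchanged.\<close>

lemma parameter_of_von_neumann:
  assumes vn: "von_neumann_vectors A T \<kappa> gp gm" and \<sigma>: "\<sigma> = 1 \<or> \<sigma> = - 1"
    and dom: "gp - \<sigma> *\<^sub>C gm \<in> Domain Ahat"
  shows "L_sys_parameter \<Theta> (\<sigma> * of_real \<kappa>) gp (\<sigma> *\<^sub>C gm)"
proof
  show "\<sigma> * of_real \<kappa> \<noteq> 1"
    using vn \<sigma> by (auto simp: von_neumann_vectors_def complex_eq_iff)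
  show "gp \<in> eigenspace (adjoint A) \<i>" "norm gp = 1"
    using vn by (auto simp: von_neumann_vectors_def)
  show "\<sigma> *\<^sub>C gm \<in> eigenspace (adjoint A) (- \<i>)"
    using vn adjoint_graphD(3)[of gm "(- \<i>) *\<^sub>C gm" A \<sigma>]
    by (simp add: von_neumann_vectors_def eigenspace_def scaleC_scaleC mult.commute)
  show "norm (\<sigma> *\<^sub>C gm) = 1"
    using vn \<sigma> by (auto simp: von_neumann_vectors_def norm_scaleC)
  have "(\<sigma> * of_real \<kappa>) *\<^sub>C \<sigma> *\<^sub>C gm = \<kappa> *\<^sub>R gm"
    using \<sigma> by (auto simp: scaleC_scaleC scaleR_scaleC)
  then show "gp - (\<sigma> * of_real \<kappa>) *\<^sub>C \<sigma> *\<^sub>C gm \<in> Domain T"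
    using vn by (simp add: von_neumann_vectors_def)
qed (rule dom)

lemma impedance_hypothesis_I:
  assumes vn: "von_neumann_vectors A T \<kappa> gp gm" and dom: "gp - gm \<in> Domain Ahat"
  shows "impedance_function \<Theta> \<i> = \<i> * of_real ((1 - \<kappa>) / (1 + \<kappa>))"
proof -
  interpret L_sys_parameter \<Theta> "1 * of_real \<kappa>" gp "1 *\<^sub>C gm"
    by (rule parameter_of_von_neumann[OF vn]) (use dom in \<open>simp_all add: scaleC_one\<close>)
  show ?thesis
    by (rule impedance_class(2)) (use vn in \<open>simp_all add: von_neumann_vectors_def\<close>)
qed

lemma impedance_hypothesis_II:
  assumes vn: "von_neumann_vectors A T \<kappa> gp gm" and dom: "gp + gm \<in> Domain Ahat"
  shows "impedance_function \<Theta> \<in> class_M_inv \<kappa>"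
    and "impedance_function \<Theta> \<i> = \<i> * of_real ((1 + \<kappa>) / (1 - \<kappa>))"
proof -
  interpret L_sys_parameter \<Theta> "- 1 * of_real \<kappa>" gp "(- 1) *\<^sub>C gm"
    by (rule parameter_of_von_neumann[OF vn]) (use dom in \<open>simp_all add: scaleC_one\<close>)
  show "impedance_function \<Theta> \<in> class_M_inv \<kappa>"
    and "impedance_function \<Theta> \<i> = \<i> * of_real ((1 + \<kappa>) / (1 - \<kappa>))"
    using impedance_class[of "- \<kappa>"] vn by (simp_all add: von_neumann_vectors_def class_M_inv_def)
qed

end

text \<open>At i the kernel collapses to i / (1 + x^2), so the normalization of the measure is
  visible in a single value. This lets class membership determine its parameter.\<close>

lemma herglotz_class_at_i:
  assumes "V \<in> herglotz_class a" "0 \<le> a"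
  shows "V \<i> = \<i> * of_real a"
proof -
  obtain \<mu> :: "real measure" where \<mu>: "sets \<mu> = sets borel"
      "(\<integral>\<^sup>+x. ennreal (1 / (1 + x\<^sup>2)) \<partial>\<mu>) = ennreal a"
      "V \<i> = (LINT x|\<mu>. 1 / (complex_of_real x - \<i>) - complex_of_real (x / (1 + x\<^sup>2)))"
    using assms(1) unfolding herglotz_class_def by force
  have kernel: "1 / (complex_of_real x - \<i>) - complex_of_real (x / (1 + x\<^sup>2)) = \<i> * complex_of_real (1 / (1 + x\<^sup>2))" for x
  proof -
    define X where "X = complex_of_real x"
    have nz: "X - \<i> \<noteq> 0" "X + \<i> \<noteq> 0"
      by (auto simp: X_def complex_eq_iff)
    have "1 + X\<^sup>2 = (X - \<i>) * (X + \<i>)"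
      by (simp add: power2_eq_square algebra_simps)
    then have "1 / (X - \<i>) - X / (1 + X\<^sup>2) = \<i> * (1 / (1 + X\<^sup>2))"
      using nz by (simp add: divide_simps)
    then show ?thesis
      by (simp add: X_def)
  qed
  have "(LINT x|\<mu>. 1 / (1 + x\<^sup>2)) = a"
  proof (subst integral_eq_nn_integral)
    have "(\<lambda>x. 1 / (1 + x\<^sup>2)) \<in> borel_measurable (borel :: real measure)"
      by measurable
    then show "(\<lambda>x. 1 / (1 + x\<^sup>2)) \<in> borel_measurable \<mu>"
      using measurable_cong_sets[OF \<mu>(1) refl] by blast
  qed (use \<mu>(2) assms(2) in auto)
  then show ?thesis
    unfolding \<mu>(3) kernel by (simp only: integral_mult_right_zero integral_complex_of_real)
qed

section \<open>Coupling\<close>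

lemma linear_operator_zero: "linear_operator A \<Longrightarrow> (0, 0) \<in> A"
  using csubspace_graphD(1) by (auto simp: linear_operator_def)

lemma adjoint_op_sum:
  assumes "(g1, h1) \<in> adjoint A" "(g2, h2) \<in> adjoint B"
  shows "((g1, g2), (h1, h2)) \<in> adjoint (op_sum A B)"
proof -
  have "cinner f' (g1, g2) = cinner f (h1, h2)" if "(f, f') \<in> op_sum A B" for f f'
  proof -
    from that have "(fst f, fst f') \<in> A" "(snd f, snd f') \<in> B"
      by (auto simp: op_sum_def)
    then show ?thesis
      using adjointD[OF assms(1)] adjointD[OF assms(2)] by (simp add: cinner_prod_def)
  qed
  then show ?thesis
    by (auto simp: adjoint_iff)
qed

lemma densely_defined_op_sum:
  assumes "densely_defined A" "densely_defined B"
  shows "densely_defined (op_sum A B)"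
proof -
  have "Domain (op_sum A B) = Domain A \<times> Domain B"
    by (fastforce simp: op_sum_def)
  then show ?thesis
    using assms by (simp add: densely_defined_def closure_Times)
qed

lemma op_sum_symmetric:
  assumes "A \<subseteq> adjoint A" "B \<subseteq> adjoint B"
  shows "op_sum A B \<subseteq> adjoint (op_sum A B)"
  using assms adjoint_op_sum by (fastforce simp: op_sum_def)

lemma eigen_minus_in_adjoint:
  assumes "gp \<in> eigenspace (adjoint A) \<i>" "gm \<in> eigenspace (adjoint A) (- \<i>)"
  shows "(a *\<^sub>C gp + b *\<^sub>C gm, (a * \<i>) *\<^sub>C gp - (b * \<i>) *\<^sub>C gm) \<in> adjoint A"
proof -
  have "(a *\<^sub>C gp + b *\<^sub>C gm, a *\<^sub>C \<i> *\<^sub>C gp + b *\<^sub>C (- \<i>) *\<^sub>C gm) \<in> adjoint A"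
    using assms unfolding eigenspace_def by (intro adjoint_graphD) auto
  then show ?thesis
    by (simp add: scaleC_scaleC)
qed

lemma coupling_G_norms:
  assumes "norm gp1 = 1" "norm gp2 = 1"
  shows "norm (coupling_Gp \<kappa>1 \<kappa>2 gp1 gp2) = 1" and "norm (coupling_Gm \<kappa>1 \<kappa>2 gp1 gp2) = 1"
  using assms by (simp_all add: coupling_Gp_def coupling_Gm_def norm_Pair)

text \<open>The symmetric operator extends the orthogonal sum by the single vector
  \<open>cv\<close>. Pairs of multiples of \<open>gp1\<close>, \<open>gp2\<close>, or of
  \<open>gm1\<close>, \<open>gm2\<close>, are eigenvectors of the adjoint of the sum, and one
  pairing with \<open>cv\<close> decides whether they remain so for the smaller adjoint. The angles
  are chosen to make this pairing vanish for \<open>Gp\<close> and \<open>Gm\<close>.\<close>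

lemma coupling_I_von_neumann:
  assumes c: "coupling_I \<Theta>1 gp1 gm1 \<Theta>2 gp2 gm2 \<Theta>" and L1: "is_L_system \<Theta>1" and L2: "is_L_system \<Theta>2"
  shows "\<exists>\<kappa>1 \<kappa>2 Gp Gm. von_neumann_vectors (symop \<Theta>1) (mainop \<Theta>1) \<kappa>1 gp1 gm1 \<and>
      von_neumann_vectors (symop \<Theta>2) (mainop \<Theta>2) \<kappa>2 gp2 gm2 \<and>
      von_neumann_vectors (symop \<Theta>) (mainop \<Theta>) (\<kappa>1 * \<kappa>2) Gp Gm \<and> Gp - Gm \<in> Domain (real_op \<Theta>)"
proof -
  interpret L1: L_sys \<Theta>1 by unfold_locales (rule L1)
  interpret L2: L_sys \<Theta>2 by unfold_locales (rule L2)
  interpret L: L_sys \<Theta> by unfold_locales (use c in \<open>simp add: coupling_I_def\<close>)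
  define A0 where "A0 = op_sum (symop \<Theta>1) (symop \<Theta>2)"
  obtain \<kappa>1 \<kappa>2 where vn1: "von_neumann_vectors (symop \<Theta>1) (mainop \<Theta>1) \<kappa>1 gp1 gm1"
    and vn2: "von_neumann_vectors (symop \<Theta>2) (mainop \<Theta>2) \<kappa>2 gp2 gm2"
    and A_eq: "symop \<Theta> = restrict_op (adjoint A0) (Domain A0) (coupling_vector \<kappa>1 \<kappa>2 gp1 gm1 gp2 gm2)"
    and T_eq: "mainop \<Theta> = restrict_op (adjoint A0) (Domain (symop \<Theta>))
      (coupling_Gp \<kappa>1 \<kappa>2 gp1 gp2 - (\<kappa>1 * \<kappa>2) *\<^sub>R coupling_Gm \<kappa>1 \<kappa>2 gm1 gm2)"
    and dom: "coupling_Gp \<kappa>1 \<kappa>2 gp1 gp2 - coupling_Gm \<kappa>1 \<kappa>2 gm1 gm2 \<in> Domain (real_op \<Theta>)"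
    using c unfolding coupling_I_def Let_def A0_def by blast
  define Gp Gm where "Gp = coupling_Gp \<kappa>1 \<kappa>2 gp1 gp2" and "Gm = coupling_Gm \<kappa>1 \<kappa>2 gm1 gm2"
  have kappas: "0 \<le> \<kappa>1" "\<kappa>1 < 1" "0 \<le> \<kappa>2" "\<kappa>2 < 1" and norms: "norm gp1 = 1" "norm gp2 = 1" "norm gm1 = 1" "norm gm2 = 1"
    and g1: "gp1 \<in> eigenspace (adjoint (symop \<Theta>1)) \<i>" "gm1 \<in> eigenspace (adjoint (symop \<Theta>1)) (- \<i>)"
    and g2: "gp2 \<in> eigenspace (adjoint (symop \<Theta>2)) \<i>" "gm2 \<in> eigenspace (adjoint (symop \<Theta>2)) (- \<i>)"
    using vn1 vn2 by (simp_all add: von_neumann_vectors_def)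
  have A0_adj: "((a1 *\<^sub>C gp1 + b1 *\<^sub>C gm1, a2 *\<^sub>C gp2 + b2 *\<^sub>C gm2),
      ((a1 * \<i>) *\<^sub>C gp1 - (b1 * \<i>) *\<^sub>C gm1, (a2 * \<i>) *\<^sub>C gp2 - (b2 * \<i>) *\<^sub>C gm2)) \<in> adjoint A0" for a1 a2 b1 b2
    unfolding A0_def by (intro adjoint_op_sum eigen_minus_in_adjoint g1 g2)
  have A0_sym: "A0 \<subseteq> adjoint A0"
    unfolding A0_def by (intro op_sum_symmetric L1.A_sym L2.A_sym)
  have A0_single: "(f, h) \<in> adjoint A0 \<Longrightarrow> (f, h') \<in> adjoint A0 \<Longrightarrow> h = h'" for f h h'
    unfolding A0_def
    by (rule single_valuedD'[OF linear_operator_adjoint[OF densely_defined_op_sum[OF L1.A_dense L2.A_dense]]])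
  define sa ca sb cb where "sa = complex_of_real (sin (coupling_alpha \<kappa>1 \<kappa>2))"
    and "ca = complex_of_real (cos (coupling_alpha \<kappa>1 \<kappa>2))"
    and "sb = complex_of_real (sin (coupling_beta \<kappa>1 \<kappa>2))" and "cb = complex_of_real (cos (coupling_beta \<kappa>1 \<kappa>2))"
  note trig = coupling_beta[OF kappas]
  have Gp_eq: "Gp = (ca *\<^sub>C gp1, - sa *\<^sub>C gp2)" and Gm_eq: "Gm = (cb *\<^sub>C gm1, - sb *\<^sub>C gm2)"
    by (simp_all add: Gp_def Gm_def coupling_Gp_def coupling_Gm_def ca_def sa_def cb_def sb_def scaleR_scaleC scaleC_minus_left)
  have Gp_adj: "(Gp, \<i> *\<^sub>C Gp) \<in> adjoint A0" and Gm_adj: "(Gm, (- \<i>) *\<^sub>C Gm) \<in> adjoint A0"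
    using A0_adj[of ca 0 "- sa" 0] A0_adj[of 0 cb 0 "- sb"]
    by (simp_all add: Gp_eq Gm_eq scaleC_prod_def scaleC_scaleC mult.commute)
  \<comment> \<open>The two relations are all that is needed of the coefficients, and they make the
    rest independent of whether \<kappa>2 is 0.\<close>
  obtain a1 b1 a2 b2 where L_eq: "coupling_vector \<kappa>1 \<kappa>2 gp1 gm1 gp2 gm2 = (a1 *\<^sub>C gp1 + b1 *\<^sub>C gm1, a2 *\<^sub>C gp2 + b2 *\<^sub>C gm2)"
    and orth_p: "a1 * ca = a2 * sa" and orth_m: "b1 * cb = b2 * sb"
  proof (cases "\<kappa>2 = 0")
    case True
    have "ca = 0" "sb = complex_of_real \<kappa>1" "cb = complex_of_real (sqrt (1 - \<kappa>1\<^sup>2))"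
      using trig True by (simp_all add: ca_def sb_def cb_def coupling_alpha_def)
    then show ?thesis
      using True by (intro that[of 1 "- complex_of_real \<kappa>1" 0 "- complex_of_real (sqrt (1 - \<kappa>1\<^sup>2))"])
        (simp_all add: coupling_vector_def scaleR_scaleC scaleC_one scaleC_minus_left)
  next
    case False
    have "sb = \<kappa>1 * sa" "cb = ca / \<kappa>2"
      using trig False by (simp_all add: ca_def sa_def sb_def cb_def)
    then show ?thesis
      using False by (intro that[of sa "- (\<kappa>1 * sa)" ca "- (ca / \<kappa>2)"])
        (simp_all add: coupling_vector_def scaleR_scaleC scaleC_minus_left scaleC_diff_right scaleC_scaleC
          sa_def ca_def mult.commute)
  qed
  define cv cv' where "cv = (a1 *\<^sub>C gp1 + b1 *\<^sub>C gm1, a2 *\<^sub>C gp2 + b2 *\<^sub>C gm2)"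
    and "cv' = ((a1 * \<i>) *\<^sub>C gp1 - (b1 * \<i>) *\<^sub>C gm1, (a2 * \<i>) *\<^sub>C gp2 - (b2 * \<i>) *\<^sub>C gm2)"
  have cv_adj: "(cv, cv') \<in> adjoint A0"
    unfolding cv_def cv'_def by (rule A0_adj)
  have cv_p: "cinner cv' Gp = cinner cv (\<i> *\<^sub>C Gp)"
  proof -
    \<comment> \<open>Adding i cv removes the \<open>gm\<close> components and doubles the
      \<open>gp\<close> components, which leaves exactly \<open>orth_p\<close>.\<close>
    have "cinner (cv' + \<i> *\<^sub>C cv) Gp = 2 * \<i> * (a1 * cnj ca * cinner gp1 gp1 - a2 * cnj sa * cinner gp2 gp2)"
      by (simp add: cv_def cv'_def Gp_eq cinner_prod_def scaleC_prod_def cinner_simps algebra_simps)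
    also have "\<dots> = 0"
      using orth_p by (simp add: cinner_self norms ca_def sa_def)
    finally show ?thesis
      by (simp add: cinner_add_left cinner_scaleC_left cinner_scaleC_right add_eq_0_iff2)
  qed
  have cv_m: "cinner cv' Gm = cinner cv ((- \<i>) *\<^sub>C Gm)"
  proof -
    have "cinner (cv' - \<i> *\<^sub>C cv) Gm = - 2 * \<i> * (b1 * cnj cb * cinner gm1 gm1 - b2 * cnj sb * cinner gm2 gm2)"
      by (simp add: cv_def cv'_def Gm_eq cinner_prod_def scaleC_prod_def cinner_simps algebra_simps)
    also have "\<dots> = 0"
      using orth_m by (simp add: cinner_self norms cb_def sb_def)
    finally show ?thesis
      by (simp add: cinner_diff_left cinner_minus_right cinner_scaleC_left cinner_scaleC_right)
  qed
  have eigen: "G \<in> eigenspace (adjoint (symop \<Theta>)) z"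
    if adj: "(G, z *\<^sub>C G) \<in> adjoint A0" and cv: "cinner cv' G = cinner cv (z *\<^sub>C G)" for G z
  proof -
    have "cinner f' G = cinner f (z *\<^sub>C G)" if "(f, f') \<in> symop \<Theta>" for f f'
    proof -
      from that obtain d d' c where f: "(f, f') \<in> adjoint A0" "(d, d') \<in> A0" "f = d + c *\<^sub>C cv"
        unfolding A_eq restrict_op_def L_eq cv_def by blast
      have "(d + c *\<^sub>C cv, d' + c *\<^sub>C cv') \<in> adjoint A0"
        using f(2) A0_sym cv_adj by (intro adjoint_graphD) auto
      then have "f' = d' + c *\<^sub>C cv'"
        using A0_single f(1,3) by blast
      moreover have "cinner d' G = cinner d (z *\<^sub>C G)"
        using adjointD[OF adj f(2)] .
      ultimately show ?thesis
        using cv f(3) by (simp add: cinner_add_left cinner_scaleC_left)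
    qed
    then show ?thesis
      by (auto simp: eigenspace_def adjoint_iff)
  qed
  have Gp: "Gp \<in> eigenspace (adjoint (symop \<Theta>)) \<i>" and Gm: "Gm \<in> eigenspace (adjoint (symop \<Theta>)) (- \<i>)"
    by (intro eigen Gp_adj Gm_adj cv_p cv_m)+
  have norm_G: "norm Gp = 1" "norm Gm = 1"
    using coupling_G_norms norms by (auto simp: Gp_def Gm_def)
  have dom_T: "Gp - (\<kappa>1 * \<kappa>2) *\<^sub>R Gm \<in> Domain (mainop \<Theta>)"
  proof -
    have "(Gp - (\<kappa>1 * \<kappa>2) *\<^sub>R Gm, \<i> *\<^sub>C Gp - (\<kappa>1 * \<kappa>2) *\<^sub>R (- \<i>) *\<^sub>C Gm) \<in> adjoint A0"
      unfolding scaleR_scaleC by (intro adjoint_graphD Gp_adj Gm_adj)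
    moreover have "(0, 0) \<in> symop \<Theta>"
      by (rule linear_operator_zero[OF L.A_linear])
    then have "0 \<in> Domain (symop \<Theta>)"
      by blast
    moreover have "Gp - (\<kappa>1 * \<kappa>2) *\<^sub>R Gm = 0 + 1 *\<^sub>C (Gp - (\<kappa>1 * \<kappa>2) *\<^sub>R Gm)"
      by (simp add: scaleC_one)
    ultimately show ?thesis
      unfolding T_eq restrict_op_def Gp_def[symmetric] Gm_def[symmetric] by blast
  qed
  have "0 \<le> \<kappa>1 * \<kappa>2" "\<kappa>1 * \<kappa>2 < 1"
    using kappas mult_strict_mono'[of \<kappa>1 1 \<kappa>2 1] by simp_all
  \<comment> \<open>Not part of the definition of the coupling; it follows because T + i is
    onto.\<close>
  moreover have "maximal_dissipative (mainop \<Theta>)"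
  proof (rule L.T_maximal_dissipative)
    have "Gp - complex_of_real (\<kappa>1 * \<kappa>2) *\<^sub>C Gm \<in> Domain (mainop \<Theta>)"
      using dom_T by (simp only: scaleR_scaleC)
    moreover have "Gp \<noteq> 0"
      using norm_G by auto
    ultimately show "\<exists>f. (f, h - \<i> *\<^sub>C f) \<in> mainop \<Theta>" for h
      using L.T_range[OF Gp _ Gm] by blast
  qed
  ultimately have "von_neumann_vectors (symop \<Theta>) (mainop \<Theta>) (\<kappa>1 * \<kappa>2) Gp Gm"
    using L.A_T Gp Gm norm_G dom_T by (simp add: von_neumann_vectors_def)
  then show ?thesis
    using vn1 vn2 dom unfolding Gp_def Gm_def by blast
qed

text \<open>The quasi-kernel of \<Theta> has some phase e, so relative to \<open>gp\<close> and
  \<open>e *\<^sub>C gm\<close> the parameter is \<kappa> cnj(e). The value of the transfer function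
  at -i is \<kappa> for \<Theta>' and thus -\<kappa> for \<Theta>; being real, it equals the
  parameter.\<close>

lemma hypothesis_II_of_transfer:
  assumes L: "is_L_system \<Theta>" and L': "is_L_system \<Theta>'"
    and ops: "symop \<Theta>' = symop \<Theta>" "mainop \<Theta>' = mainop \<Theta>"
    and vn: "von_neumann_vectors (symop \<Theta>) (mainop \<Theta>) \<kappa> gp gm" and I: "gp - gm \<in> Domain (real_op \<Theta>')"
    and W: "\<And>z. z \<in> resolvent_set (mainop \<Theta>) \<Longrightarrow> transfer_function \<Theta> z = - transfer_function \<Theta>' z"
  shows "\<exists>gm'. von_neumann_vectors (symop \<Theta>) (mainop \<Theta>) \<kappa> gp gm' \<and> gp + gm' \<in> Domain (real_op \<Theta>)"
proof -
  interpret L: L_sys \<Theta> by unfold_locales (rule L)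
  interpret L': L_sys \<Theta>' by unfold_locales (rule L')
  have gp: "gp \<in> eigenspace (adjoint (symop \<Theta>)) \<i>" and gm: "gm \<in> eigenspace (adjoint (symop \<Theta>)) (- \<i>)"
    and norms: "norm gp = 1" "norm gm = 1" and dom_T: "gp - of_real \<kappa> *\<^sub>C gm \<in> Domain (mainop \<Theta>)"
    and \<kappa>: "0 \<le> \<kappa>" "\<kappa> < 1"
    using vn by (auto simp: von_neumann_vectors_def scaleR_scaleC)
  obtain e where e: "cmod e = 1" "gp - e *\<^sub>C gm \<in> Domain (real_op \<Theta>)"
    using L.phase_exists[OF gp gm norms] by blast
  have "gp \<noteq> 0"
    using norms by auto
  then have "- \<i> \<in> resolvent_set (mainop \<Theta>)"
    by (intro L.minus_i_in_resolvent_set L.T_range[OF gp _ gm dom_T])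
  then have W_i: "transfer_function \<Theta> (- \<i>) = - transfer_function \<Theta>' (- \<i>)"
    by (rule W)
  interpret P': L_sys_parameter \<Theta>' "1 * of_real \<kappa>" gp "1 *\<^sub>C gm"
    by (rule L'.parameter_of_von_neumann) (use vn I ops in \<open>simp_all add: scaleC_one\<close>)
  have W': "transfer_function \<Theta>' (- \<i>) = of_real \<kappa>"
    using P'.transfer_real_iff[of \<kappa>] by simp
  have cc: "cnj e * e = 1"
    using complex_norm_square[of e] e(1) by (simp add: mult.commute)
  have sc: "(of_real \<kappa> * cnj e) *\<^sub>C e *\<^sub>C gm = of_real \<kappa> *\<^sub>C gm"
    using cc by (simp add: scaleC_scaleC mult.assoc)
  have param: "L_sys_parameter \<Theta> (of_real \<kappa> * cnj e) gp (e *\<^sub>C gm)"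
  proof
    have "cmod (of_real \<kappa> * cnj e) < 1"
      using e(1) \<kappa> by (simp add: norm_mult)
    then show "of_real \<kappa> * cnj e \<noteq> 1"
      by (metis less_irrefl norm_one)
    show "e *\<^sub>C gm \<in> eigenspace (adjoint (symop \<Theta>)) (- \<i>)"
      using gm adjoint_graphD(3)[of gm "(- \<i>) *\<^sub>C gm" "symop \<Theta>" e]
      by (simp add: eigenspace_def scaleC_scaleC mult.commute)
    show "gp - (of_real \<kappa> * cnj e) *\<^sub>C e *\<^sub>C gm \<in> Domain (mainop \<Theta>)"
      unfolding sc by (rule dom_T)
  qed (use gp norms e in \<open>simp_all add: norm_scaleC\<close>)
  then have "of_real \<kappa> * cnj e = of_real (- \<kappa>)"
    using L_sys_parameter.transfer_real_iff[OF param, of "- \<kappa>"] W_i W' by simp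
  then have \<kappa>e: "\<kappa> = 0 \<or> e = - 1"
    by (metis complex_cnj_cnj complex_cnj_minus complex_cnj_one mult_cancel_left mult_minus1_right
        of_real_eq_0_iff of_real_minus)
  \<comment> \<open>For \<kappa> different from 0 this is \<open>gm\<close> itself, since e = -1.
    For \<kappa> = 0 it absorbs the undetermined phase, which the domain of the main operator does
    not see.\<close>
  define gm' where "gm' = - (e *\<^sub>C gm)"
  have "gm' \<in> eigenspace (adjoint (symop \<Theta>)) (- \<i>)"
    using gm adjoint_graphD(3)[of gm "(- \<i>) *\<^sub>C gm" "symop \<Theta>" "- e"]
    by (simp add: gm'_def eigenspace_def scaleC_scaleC scaleC_minus_left mult.commute)
  moreover have "\<kappa> *\<^sub>R gm' = \<kappa> *\<^sub>R gm"
    using \<kappa>e by (auto simp: gm'_def scaleC_minus_left scaleC_one)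
  moreover have "norm gm' = 1"
    using e norms by (simp add: gm'_def norm_scaleC)
  ultimately have "von_neumann_vectors (symop \<Theta>) (mainop \<Theta>) \<kappa> gp gm'"
    using vn by (auto simp: von_neumann_vectors_def)
  moreover have "gp + gm' \<in> Domain (real_op \<Theta>)"
    using e(2) by (simp add: gm'_def)
  ultimately show ?thesis
    by blast
qed

theorem corollary6p9:
  fixes \<Theta>1 :: "'a::complex_hilbert L_system" and gp1 gm1 :: 'a
    and \<Theta>2 :: "'b::complex_hilbert L_system" and gp2 gm2 :: 'b
    and \<Theta> :: "('a \<times> 'b) L_system" and \<kappa>1 \<kappa>2 :: real
  assumes "is_L_system \<Theta>1" and "minimal_L_system \<Theta>1"
    and "is_L_system \<Theta>2" and "minimal_L_system \<Theta>2"
    and "hypothesis_I_with \<Theta>1 gp1 gm1"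
    and "hypothesis_II_with \<Theta>2 gp2 gm2"
    and "coupling \<Theta>1 gp1 gm1 \<Theta>2 gp2 gm2 \<Theta>"
    and "0 \<le> \<kappa>1" and "\<kappa>1 < 1" and "0 \<le> \<kappa>2" and "\<kappa>2 < 1"
    and "impedance_function \<Theta>1 \<in> class_M \<kappa>1"
    and "impedance_function \<Theta>2 \<in> class_M_inv \<kappa>2"
  shows "hypothesis_II \<Theta> \<and> impedance_function \<Theta> \<in> class_M_inv (\<kappa>1 * \<kappa>2)"
proof -
  note L1 = assms(1) and L2 = assms(3) and I1 = assms(5) and II2 = assms(6) and c = assms(7)
    and \<kappa>1 = assms(8,9) and \<kappa>2 = assms(10,11) and V1 = assms(12) and V2 = assms(13)
  interpret L1: L_sys \<Theta>1 by unfold_locales (rule L1)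
  interpret L2: L_sys \<Theta>2 by unfold_locales (rule L2)
  have L: "is_L_system \<Theta>"
    using c by (simp add: coupling_def)
  interpret L: L_sys \<Theta> by unfold_locales (rule L)
  obtain \<Theta>1' \<nu>1 \<Theta>2' \<nu>2 \<Theta>' where form1: "hypothesis_I_form \<Theta>1 gp1 gm1 \<Theta>1' \<nu>1"
    and form2: "hypothesis_I_form \<Theta>2 gp2 gm2 \<Theta>2' \<nu>2"
    and cI: "coupling_I \<Theta>1' gp1 gm1 \<Theta>2' gp2 gm2 \<Theta>'"
    and ops: "symop \<Theta> = symop \<Theta>'" "mainop \<Theta> = mainop \<Theta>'"
    and W: "\<forall>z\<in>resolvent_set (mainop \<Theta>). transfer_function \<Theta> z = inverse (\<nu>1 * \<nu>2) * transfer_function \<Theta>' z"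
    using c unfolding coupling_def by blast
  \<comment> \<open>The hypotheses are stated for the same vectors as the coupling, so the last two
    clauses of \<open>hypothesis_I_form\<close> fix the factors.\<close>
  have \<nu>: "\<nu>1 = 1" "\<nu>2 = - 1"
    using form1 I1 form2 II2 by (simp_all add: hypothesis_I_form_def)
  have ops1: "symop \<Theta>1' = symop \<Theta>1" "mainop \<Theta>1' = mainop \<Theta>1"
    and ops2: "symop \<Theta>2' = symop \<Theta>2" "mainop \<Theta>2' = mainop \<Theta>2"
    and L1': "is_L_system \<Theta>1'" and L2': "is_L_system \<Theta>2'"
    using form1 form2 by (simp_all add: hypothesis_I_form_def)
  have L': "is_L_system \<Theta>'"
    using cI by (simp add: coupling_I_def)
  obtain k1 k2 Gp Gm where vn1: "von_neumann_vectors (symop \<Theta>1) (mainop \<Theta>1) k1 gp1 gm1"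
    and vn2: "von_neumann_vectors (symop \<Theta>2) (mainop \<Theta>2) k2 gp2 gm2"
    and vn: "von_neumann_vectors (symop \<Theta>) (mainop \<Theta>) (k1 * k2) Gp Gm" and dom: "Gp - Gm \<in> Domain (real_op \<Theta>')"
    using coupling_I_von_neumann[OF cI L1' L2'] unfolding ops1 ops2 ops[symmetric] by blast
  \<comment> \<open>The parameter k1 belongs to the von Neumann vectors, \<kappa>1 to the class of
    the impedance function. The value at i is computed from either, and the fraction is injective in
    the parameter.\<close>
  have "\<i> * complex_of_real ((1 - k1) / (1 + k1)) = \<i> * complex_of_real ((1 - \<kappa>1) / (1 + \<kappa>1))"
    using L1.impedance_hypothesis_I[OF vn1] I1 herglotz_class_at_i[OF V1[unfolded class_M_def]] \<kappa>1
    by (simp add: hypothesis_I_with_def)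
  then have "(1 - k1) / (1 + k1) = (1 - \<kappa>1) / (1 + \<kappa>1)"
    by (simp only: mult_cancel_left of_real_eq_iff complex_i_not_zero simp_thms)
  then have k1: "k1 = \<kappa>1"
    using vn1 \<kappa>1 by (simp add: von_neumann_vectors_def field_simps)
  have "\<i> * complex_of_real ((1 + k2) / (1 - k2)) = \<i> * complex_of_real ((1 + \<kappa>2) / (1 - \<kappa>2))"
    using L2.impedance_hypothesis_II(2)[OF vn2] II2 herglotz_class_at_i[OF V2[unfolded class_M_inv_def]] \<kappa>2
    by (simp add: hypothesis_II_with_def)
  then have "(1 + k2) / (1 - k2) = (1 + \<kappa>2) / (1 - \<kappa>2)"
    by (simp only: mult_cancel_left of_real_eq_iff complex_i_not_zero simp_thms)
  then have k2: "k2 = \<kappa>2"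
    using vn2 \<kappa>2 by (simp add: von_neumann_vectors_def field_simps)
  \<comment> \<open>The factors \<nu>1 = 1 and \<nu>2 = -1 give exactly the change of sign between
    the transfer functions of \<Theta>' and \<Theta>.\<close>
  have "\<exists>gm'. von_neumann_vectors (symop \<Theta>) (mainop \<Theta>) (k1 * k2) Gp gm' \<and> Gp + gm' \<in> Domain (real_op \<Theta>)"
    by (rule hypothesis_II_of_transfer[OF L L' _ _ vn dom]) (use ops W \<nu> in simp_all)
  then obtain gm' where "von_neumann_vectors (symop \<Theta>) (mainop \<Theta>) (\<kappa>1 * \<kappa>2) Gp gm'" "Gp + gm' \<in> Domain (real_op \<Theta>)"
    unfolding k1 k2 by blast
  then show ?thesis
    using L.impedance_hypothesis_II(1) unfolding hypothesis_II_def hypothesis_II_with_def by blast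
qed

end
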